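(* Let $\mathbb X$ be a flow space which is dense at the point $x_\bullet$. If $\mathbb X$ is aperiodic, then $\mathbb X$ admits an expansion $(X_i,f_i,p_i)$ about $x_\bullet$ in which every bonding map $f_i$ is proper. Otherwise, $\mathbb X$ admits an expansion about $x_\bullet$ for which $f_{1,n}=f_1\circ\cdots\circ f_{n-1}$ is degenerate proper for every $n\ge2$. In particular, every minimal flow space admits an expansion about each of its points.
   Context: A flow space is a compact metrizable space $\mathbb X$ of topological dimension one with a continuous $\mathbb R$-action $(t,x)\mapsto t.x$ without fixed points. It is minimal if every orbit is dense and aperiodic if no orbit is periodic (homeomorphic to a circle). $\mathbb X$ is dense at $x$ if every neighbourhood of $x$ meets the forward orbit $\{t.y:t>0\}$ of every $y\in\mathbb X$. Oriented wedge of circles: one-point union of finitely many circles, each oriented. Positive map: continuous surjection between oriented wedges sending wedge point to wedge point, orientation preserving on each circle, locally injective away from the wedge point. Projection $p\colon\mathbb X\to W$: continuous surjection, locally injective and orientation preserving along orbits. Expansion about $x_\bullet$: oriented wedges $X_i$ (wedge points $x_i$), positive maps $f_i\colon X_{i+1}\to X_i$, projections $p_i$ with $p_i(x_\bullet)=x_i$, $p_n=f_{n,m}\circ p_m$ ($m>n$, $f_{n,m}=f_n\circ\cdots\circ f_{m-1}$), and $x\mapsto(p_i(x))_i$ a homeomorphism onto $\varprojlim(X_i,f_i)$. Symbolic representation $f_s$ of a positive map $f$ (circles labelled by letters): $f_s(b)$ is the word of circles traversed, in order, by the image of circle $b$ traversed once positively from the wedge point. $f$ is proper if there are letters $c,d$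 with every $f_s(b)$ of the form $c\,v_b\,d$ ($v_b$ a possibly empty word); degenerate proper if there is a letter $a$ with every $f_s(b)$ beginning and ending with $a$ and $f_s(b)=a$ for at least one $b$. *)

theory Defs
  imports "HOL-Analysis.Analysis"
begin

definition cov_dim_le :: "'a topology \<Rightarrow> nat \<Rightarrow> bool" where
  "cov_dim_le X n \<longleftrightarrow>
     (\<forall>\<U>. finite \<U> \<and> (\<forall>U\<in>\<U>. openin X U) \<and> \<Union>\<U> = topspace X \<longrightarrow>
        (\<exists>\<V>. finite \<V> \<and> (\<forall>V\<in>\<V>. openin X V) \<and> \<Union>\<V> = topspace X \<and>
             (\<forall>V\<in>\<V>. \<exists>U\<in>\<U>. V \<subseteq> U) \<and>
             (\<forall>x\<in>topspace X. card {V\<in>\<V>. x \<in> V} \<le> n + 1)))"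

definition top_dim_one :: "'a topology \<Rightarrow> bool" where
  "top_dim_one X \<longleftrightarrow> cov_dim_le X 1 \<and> \<not> cov_dim_le X 0"

definition orbit :: "(real \<Rightarrow> 'a \<Rightarrow> 'a) \<Rightarrow> 'a \<Rightarrow> 'a set" where
  "orbit \<phi> x = range (\<lambda>t. \<phi> t x)"

definition flow_space :: "'a topology \<Rightarrow> (real \<Rightarrow> 'a \<Rightarrow> 'a) \<Rightarrow> bool" where
  "flow_space X \<phi> \<longleftrightarrow>
     compact_space X \<and> metrizable_space X \<and> top_dim_one X \<and>
     continuous_map (prod_topology euclideanreal X) X (\<lambda>(t, x). \<phi> t x) \<and>
     (\<forall>x\<in>topspace X. \<phi> 0 x = x) \<and>
     (\<forall>s t x. x \<in> topspace X \<longrightarrow> \<phi> (s + t) x = \<phi> s (\<phi> t x)) \<and>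
     (\<forall>x\<in>topspace X. \<exists>t. \<phi> t x \<noteq> x)"

definition minimal_flow :: "'a topology \<Rightarrow> (real \<Rightarrow> 'a \<Rightarrow> 'a) \<Rightarrow> bool" where
  "minimal_flow X \<phi> \<longleftrightarrow> (\<forall>x\<in>topspace X. X closure_of (orbit \<phi> x) = topspace X)"

definition aperiodic_flow :: "'a topology \<Rightarrow> (real \<Rightarrow> 'a \<Rightarrow> 'a) \<Rightarrow> bool" where
  "aperiodic_flow X \<phi> \<longleftrightarrow>
     (\<forall>x\<in>topspace X. \<not> (subtopology X (orbit \<phi> x)
                             homeomorphic_space top_of_set (sphere (0::complex) 1)))"

definition dense_at :: "'a topology \<Rightarrow> (real \<Rightarrow> 'a \<Rightarrow> 'a) \<Rightarrow> 'a \<Rightarrow> bool" where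
  "dense_at X \<phi> x \<longleftrightarrow>
     (\<forall>U. openin X U \<and> x \<in> U \<longrightarrow> (\<forall>y\<in>topspace X. \<exists>t>0. \<phi> t y \<in> U))"

text \<open>Circle i is the circle in the complex plane of centre i+1 and radius i+1; these
  circles pairwise meet only at 0. Circle i is oriented by the parametrisation wcirc i.\<close>

definition wcirc :: "nat \<Rightarrow> real \<Rightarrow> complex" where
  "wcirc i t = of_real (real i + 1) * (1 - cis (2 * pi * t))"

definition wedge :: "nat \<Rightarrow> complex set" where
  "wedge k = (\<Union>i<k. wcirc i ` {0..1})"

abbreviation W :: "nat \<Rightarrow> complex topology" where
  "W k \<equiv> top_of_set (wedge k)"

definition positive_map :: "nat \<Rightarrow> nat \<Rightarrow> (complex \<Rightarrow> complex) \<Rightarrow> bool" where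
  "positive_map m k f \<longleftrightarrow>
     continuous_map (W m) (W k) f \<and> f ` wedge m = wedge k \<and> f 0 = 0 \<and>
     (\<forall>b<m. \<forall>s. f (wcirc b s) \<noteq> 0 \<longrightarrow>
        (\<exists>a<k. \<exists>e>0. \<exists>h. strict_mono_on {s-e<..<s+e} h \<and>
            (\<forall>t\<in>{s-e<..<s+e}. f (wcirc b t) = wcirc a (h t)))) \<and>
     (\<forall>z\<in>wedge m - {0}. \<exists>U. openin (W m) U \<and> z \<in> U \<and> inj_on f U)"

definition traversal_word :: "(complex \<Rightarrow> complex) \<Rightarrow> nat \<Rightarrow> nat list \<Rightarrow> bool" where
  "traversal_word f b w \<longleftrightarrow>
     (\<exists>s::nat \<Rightarrow> real. s 0 = 0 \<and> s (length w) = 1 \<and>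
        (\<forall>j<length w. s j < s (Suc j)) \<and>
        (\<forall>j\<le>length w. f (wcirc b (s j)) = 0) \<and>
        (\<forall>j<length w. \<forall>t\<in>{s j<..<s (Suc j)}. f (wcirc b t) \<in> wcirc (w ! j) ` {0<..<1}))"

definition sym_rep :: "(complex \<Rightarrow> complex) \<Rightarrow> nat \<Rightarrow> nat list" where
  "sym_rep f b = (THE w. traversal_word f b w)"

definition proper_posmap :: "nat \<Rightarrow> (complex \<Rightarrow> complex) \<Rightarrow> bool" where
  "proper_posmap m f \<longleftrightarrow> (\<exists>c d. \<forall>b<m. \<exists>v. sym_rep f b = c # v @ [d])"

definition degenerate_proper :: "nat \<Rightarrow> (complex \<Rightarrow> complex) \<Rightarrow> bool" where
  "degenerate_proper m f \<longleftrightarrow>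
     (\<exists>a. (\<forall>b<m. sym_rep f b \<noteq> [] \<and> hd (sym_rep f b) = a \<and> last (sym_rep f b) = a) \<and>
          (\<exists>b<m. sym_rep f b = [a]))"

definition projection ::
  "'a topology \<Rightarrow> (real \<Rightarrow> 'a \<Rightarrow> 'a) \<Rightarrow> nat \<Rightarrow> ('a \<Rightarrow> complex) \<Rightarrow> bool" where
  "projection X \<phi> k p \<longleftrightarrow>
     continuous_map X (W k) p \<and> p ` topspace X = wedge k \<and>
     (\<forall>x\<in>topspace X. \<exists>e>0. inj_on (\<lambda>t. p (\<phi> t x)) {-e<..<e}) \<and>
     (\<forall>x\<in>topspace X. p x \<noteq> 0 \<longrightarrow>
        (\<exists>a<k. \<exists>e>0. \<exists>h. strict_mono_on {-e<..<e} h \<and>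
            (\<forall>t\<in>{-e<..<e}. p (\<phi> t x) = wcirc a (h t))))"

definition bond :: "(nat \<Rightarrow> complex \<Rightarrow> complex) \<Rightarrow> nat \<Rightarrow> nat \<Rightarrow> complex \<Rightarrow> complex" where
  "bond f n m = foldr (\<circ>) (map f [n..<m]) id"

definition inv_limit :: "(nat \<Rightarrow> nat) \<Rightarrow> (nat \<Rightarrow> complex \<Rightarrow> complex) \<Rightarrow> (nat \<Rightarrow> complex) topology" where
  "inv_limit k f = subtopology (product_topology (\<lambda>i. W (k i)) UNIV)
                     {z. \<forall>i. z i = f i (z (Suc i))}"

definition expansion ::
  "'a topology \<Rightarrow> (real \<Rightarrow> 'a \<Rightarrow> 'a) \<Rightarrow> 'a \<Rightarrow> (nat \<Rightarrow> nat) \<Rightarrow>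
   (nat \<Rightarrow> complex \<Rightarrow> complex) \<Rightarrow> (nat \<Rightarrow> 'a \<Rightarrow> complex) \<Rightarrow> bool" where
  "expansion X \<phi> x0 k f p \<longleftrightarrow>
     (\<forall>i. 1 \<le> k i) \<and>
     (\<forall>i. positive_map (k (Suc i)) (k i) (f i)) \<and>
     (\<forall>i. projection X \<phi> (k i) (p i)) \<and>
     (\<forall>i. p i x0 = 0) \<and>
     (\<forall>n m. n < m \<longrightarrow> (\<forall>x\<in>topspace X. p n x = bond f n m (p m x))) \<and>
     homeomorphic_map X (inv_limit k f) (\<lambda>x i. p i x)"

end

(* Averaging the distance to the base point over a short time gives a function increasing along the
   flow near that point; its level set S is a local cross-section. Since S x [-e, e] embeds in a
   one-dimensional space, the Poincare--Miranda theorem shows that distinct points of S are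
   separated by clopen sets, so a small clopen piece K of S is a zero-dimensional cross-section and
   the flow is the suspension of the first return map T of K. Kakutani--Rokhlin towers over a
   decreasing sequence of clopen sets shrinking to the base point, each refining the previous ones
   and jointly separating points, project the flow space onto wedges with one circle per tower. The
   bonding maps record how a tower of one level is cut into towers of the previous level; choosing
   each base inside a single tower base of the previous level, and inside the image of a single top
   floor, makes all these words begin alike and end alike. If the base point is periodic, K is chosen
   so that T fixes it, and its tower then has height one at every level. *)
theory Submission
  imports Defs
begin

subsection \<open>Wedges of circles\<close>

text \<open>A word \<open>c # v @ [d]\<close> has at least two letters, so every new column must
  cross at least two old bases. If \<open>h\<close> is the height of the old tower based at
  \<open>x0\<close> and \<open>(T ^^ h) x0\<close> differs from \<open>x0\<close>, the new base can
  be chosen disjoint from its image under \<open>T ^^ h\<close>, and a new column then continues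
  beyond its first old column. Only a periodic base point resists this, hence the degenerate case.
  The dichotomy of the theorem speaks of all orbits; it reduces to the orbit of \<open>x0\<close>
  because a circle orbit is closed, so that density at \<open>x0\<close> forces \<open>x0\<close> to
  lie on it. Arcs are parametrised by the elapsed fraction of the return time, not by time itself:
  return times vary within a tower, and a common parameter is what lets a coarser projection factor
  through a finer one. Points are separated in the inverse limit by countably many clopen sets
  \<open>D n\<close>: the floors of level \<open>n + 1\<close> decide membership in
  \<open>D n\<close>, and its base lies wholly on the side of \<open>x0\<close>.\<close>

lemma wcirc_add_int: "s - t \<in> \<int> \<Longrightarrow> wcirc a s = wcirc a t"
proof -
  assume "s - t \<in> \<int>"
  then obtain n :: int where "s = t + of_int n"
    by (metis Ints_cases add.commute diff_add_cancel)
  then have "2 * pi * s = 2 * pi * t + 2 * pi * of_int n"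
    by (simp add: algebra_simps)
  then show ?thesis
    by (simp add: wcirc_def cis.ctr cos_add sin_add)
qed

lemma wcirc_0 [simp]: "wcirc a 0 = 0"
  by (simp add: wcirc_def)

lemma wcirc_1 [simp]: "wcirc a 1 = 0"
  using wcirc_add_int[of 1 0 a] by simp

lemma cis_2pi_eq_iff: "cis (2 * pi * s) = cis (2 * pi * t) \<longleftrightarrow> s - t \<in> \<int>"
proof
  assume "cis (2 * pi * s) = cis (2 * pi * t)"
  then have "sin (2 * pi * s) = sin (2 * pi * t) \<and> cos (2 * pi * s) = cos (2 * pi * t)"
    by (auto simp: complex_eq_iff)
  then obtain n :: int where "2 * pi * s = 2 * pi * t + 2 * pi * of_int n"
    using sin_cos_eq_iff[of "2 * pi * s" "2 * pi * t"] by auto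
  then have "2 * pi * s = 2 * pi * (t + of_int n)"
    by (simp add: algebra_simps)
  then have "s = t + of_int n"
    by simp
  then show "s - t \<in> \<int>"
    by simp
next
  assume "s - t \<in> \<int>"
  then have "wcirc 0 s = wcirc 0 t"
    by (rule wcirc_add_int)
  then show "cis (2 * pi * s) = cis (2 * pi * t)"
    by (simp add: wcirc_def)
qed

lemma wcirc_eq_0_iff: "wcirc a s = 0 \<longleftrightarrow> s \<in> \<int>"
proof -
  have "real a + 1 \<noteq> 0"
    by linarith
  then have "of_real (real a + 1) \<noteq> (0::complex)"
    using of_real_eq_0_iff by blast
  then have "wcirc a s = 0 \<longleftrightarrow> cis (2 * pi * s) = cis (2 * pi * 0)"
    unfolding wcirc_def by (auto simp del: of_real_add)
  then show ?thesis
    using cis_2pi_eq_iff[of s 0] by simp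
qed

text \<open>This is the equation of circle \<open>a\<close> in the plane. At a nonzero point it
  determines the radius, hence the circle.\<close>

lemma wcirc_norm: "(cmod (wcirc a s))\<^sup>2 = 2 * (real a + 1) * Re (wcirc a s)"
proof -
  have "(sin (2 * pi * s))\<^sup>2 = 1 - (cos (2 * pi * s))\<^sup>2"
    by (simp add: sin_squared_eq)
  moreover have "(cmod (wcirc a s))\<^sup>2 =
      (real a + 1)\<^sup>2 * ((1 - cos (2 * pi * s))\<^sup>2 + (sin (2 * pi * s))\<^sup>2)"
    unfolding cmod_power2 wcirc_def by (simp add: power_mult_distrib distrib_left)
  moreover have "Re (wcirc a s) = (real a + 1) * (1 - cos (2 * pi * s))"
    by (simp add: wcirc_def)
  ultimately show ?thesis
    by (simp add: power2_eq_square) (simp add: algebra_simps)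
qed

lemma wcirc_eq_same_circle:
  assumes "wcirc a s = wcirc b t" "wcirc a s \<noteq> 0"
  shows "a = b"
proof -
  have *: "2 * (real a + 1) * Re (wcirc a s) = 2 * (real b + 1) * Re (wcirc a s)"
    using wcirc_norm[of a s] wcirc_norm[of b t] unfolding assms(1) by linarith
  have "Re (wcirc a s) \<noteq> 0"
    using wcirc_norm[of a s] assms(2) by auto
  with * show ?thesis
    by (metis add_right_cancel mult_cancel_left mult_cancel_right of_nat_eq_iff zero_neq_numeral)
qed

text \<open>At the wedge point the circles may differ, but both parameters are integers. Thus a
  single real parameter controls injectivity even where a path changes circles.\<close>

lemma wcirc_eq_diff_Ints:
  assumes "wcirc a s = wcirc b t"
  shows "s - t \<in> \<int>"
proof (cases "wcirc a s = 0")
  case True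
  then show ?thesis
    using assms wcirc_eq_0_iff by (metis Ints_diff)
next
  case False
  then have "a = b"
    using wcirc_eq_same_circle assms by blast
  moreover have "real a + 1 \<noteq> 0"
    by linarith
  then have "of_real (real a + 1) \<noteq> (0::complex)"
    using of_real_eq_0_iff by blast
  ultimately have "cis (2 * pi * s) = cis (2 * pi * t)"
    using assms unfolding wcirc_def by (simp del: of_real_add)
  then show ?thesis
    by (simp add: cis_2pi_eq_iff)
qed

lemma not_Ints_between_0_1: "0 < u \<Longrightarrow> u < 1 \<Longrightarrow> (u::real) \<notin> \<int>"
  by (auto elim!: Ints_cases)

lemma real_Ints_diff_less_1: "s - t \<in> \<int> \<Longrightarrow> \<bar>s - t\<bar> < 1 \<Longrightarrow> s = (t::real)"
  by (metis Ints_nonzero_abs_ge1 eq_iff_diff_eq_0 not_le)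

lemma continuous_on_wcirc [continuous_intros]:
  "continuous_on S f \<Longrightarrow> continuous_on S (\<lambda>x. wcirc a (f x))"
  unfolding wcirc_def cis_conv_exp by (intro continuous_intros)

lemma wcirc_frac: "wcirc a (frac s) = wcirc a s"
  by (rule wcirc_add_int) (simp add: frac_def)

lemma wcirc_in_wedge: "a < k \<Longrightarrow> wcirc a s \<in> wedge k"
  unfolding wedge_def
  by (metis (no_types, lifting) UN_I atLeastAtMost_iff frac_ge_0 frac_lt_1 imageI lessThan_iff less_imp_le wcirc_frac)

lemma wedge_cases:
  assumes "z \<in> wedge k"
  obtains b s where "b < k" "0 \<le> s" "s < 1" "z = wcirc b s"
proof -
  obtain b s where "b < k" "0 \<le> s" "s \<le> 1" "z = wcirc b s"
    using assms unfolding wedge_def by auto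
  then show thesis
    using that[of b "frac s"] by (auto simp: wcirc_frac frac_lt_1)
qed

text \<open>An arc is open because its complement is a finite union of compact arcs.\<close>

lemma openin_wedge_arc:
  assumes "b < k" "0 \<le> u" "v \<le> 1"
  shows "openin (W k) (wcirc b ` {u<..<v})"
proof -
  let ?C = "(\<Union>i\<in>{..<k} - {b}. wcirc i ` {0..1}) \<union> wcirc b ` ({0..u} \<union> {v..1})"
  have "compact ?C"
    by (intro compact_Un compact_UN compact_continuous_image continuous_intros) auto
  moreover have "wedge k - wcirc b ` {u<..<v} = wedge k \<inter> ?C"
  proof -
    have arc1: "wcirc b s \<noteq> wcirc i t" if "u < s" "s < v" "i \<noteq> b" for s i t
    proof
      assume *: "wcirc b s = wcirc i t"
      moreover have "s \<notin> \<int>"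
        using not_Ints_between_0_1 that assms by auto
      ultimately show False
        using wcirc_eq_same_circle[OF *] wcirc_eq_0_iff that(3) by blast
    qed
    have arc2: "wcirc b s \<noteq> wcirc b t" if "u < s" "s < v" "t \<in> {0..u} \<union> {v..1}" for s t
    proof
      assume "wcirc b s = wcirc b t"
      then have "s - t \<in> \<int>"
        by (rule wcirc_eq_diff_Ints)
      then have "s = t"
        by (rule real_Ints_diff_less_1) (use that assms in auto)
      then show False
        using that by auto
    qed
    have "wcirc b s \<notin> ?C" if "u < s" "s < v" for s
      using arc1[OF that] arc2[OF that] by blast
    then have *: "wcirc b ` {u<..<v} \<inter> ?C = {}"
      by fastforce
    have **: "wedge k \<subseteq> wcirc b ` {u<..<v} \<union> ?C"
    proof
      fix z assume "z \<in> wedge k"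
      then obtain i s where iz: "i < k" "s \<in> {0..1}" "z = wcirc i s"
        unfolding wedge_def by auto
      show "z \<in> wcirc b ` {u<..<v} \<union> ?C"
      proof (cases "i = b")
        case True
        then have "s \<in> {u<..<v} \<or> s \<in> {0..u} \<union> {v..1}"
          using iz by auto
        then show ?thesis
          using iz True by blast
      next
        case False
        then show ?thesis
          using iz by blast
      qed
    qed
    have aux: "A - B = A \<inter> C" if "B \<inter> C = {}" "A \<subseteq> B \<union> C" for A B C :: "complex set"
      using that by blast
    show ?thesis
      by (rule aux[OF * **])
  qed
  moreover have "wcirc b ` {u<..<v} \<subseteq> wedge k"
    using wcirc_in_wedge[OF assms(1)] by blast
  ultimately show ?thesis
    unfolding openin_closedin_eq topspace_euclidean_subtopology
    using closedin_closed_Int[OF compact_imp_closed] by metis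
qed

text \<open>Both sequences are the sorted enumeration of one finite set. The lemma identifies the
  subdivision points of two traversals.\<close>

lemma strict_mono_upto_unique:
  fixes s s' :: "nat \<Rightarrow> real"
  assumes "\<And>j. j < n \<Longrightarrow> s j < s (Suc j)" "\<And>j. j < n' \<Longrightarrow> s' j < s' (Suc j)"
    and "s ` {..n} = s' ` {..n'}"
  shows "n = n'" and "\<And>j. j \<le> n \<Longrightarrow> s j = s' j"
proof -
  have sorted: "sorted_wrt (<) (map r [0..<Suc m])" if r: "\<And>j. j < m \<Longrightarrow> r j < r (Suc j)"
    for r :: "nat \<Rightarrow> real" and m
  proof -
    have "r i < r j" if "i < j" "j \<le> m" for i j
      using that
    proof (induction j)
      case (Suc j)
      then show ?case
        using r[of j] by (cases "i = j") auto
    qed simp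
    then show ?thesis
      by (auto simp del: upt_Suc simp: sorted_wrt_iff_nth_less)
  qed
  have set_map: "set (map r [0..<Suc m]) = r ` {..m}" for r :: "nat \<Rightarrow> real" and m
    by (auto simp del: upt_Suc simp: lessThan_Suc_atMost[symmetric] atLeast0LessThan)
  have *: "map s [0..<Suc n] = map s' [0..<Suc n']"
    using sorted[of n s] sorted[of n' s'] assms set_map[of s n] set_map[of s' n']
    by (intro strict_sorted_equal) auto
  from * have "length (map s [0..<Suc n]) = length (map s' [0..<Suc n'])"
    by simp
  then show nn: "n = n'"
    by simp
  show "s j = s' j" if "j \<le> n" for j
    using arg_cong[OF *, of "\<lambda>xs. xs ! j"] that nn by (simp del: upt_Suc)
qed

text \<open>The subdivision points are intrinsic: they are exactly the zeros of \<open>f\<close>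
  along the circle. On each open interval between them a single nonzero value already determines the
  letter. This gives the definite description in \<open>sym_rep\<close> its meaning.\<close>

lemma traversal_word_unique:
  assumes "traversal_word f b w" "traversal_word f b w'"
  shows "w = w'"
proof -
  have zeros: "\<exists>s. (\<forall>j<length w. s j < s (Suc j)) \<and>
      s ` {..length w} = {t\<in>{0..1}. f (wcirc b t) = 0} \<and>
      (\<forall>j<length w. \<forall>t\<in>{s j<..<s (Suc j)}. f (wcirc b t) \<in> wcirc (w ! j) ` {0<..<1})"
    if tr: "traversal_word f b w" for w
  proof -
    obtain s :: "nat \<Rightarrow> real" where s: "s 0 = 0" "s (length w) = 1"
      "\<forall>j<length w. s j < s (Suc j)" "\<forall>j\<le>length w. f (wcirc b (s j)) = 0"
      "\<forall>j<length w. \<forall>t\<in>{s j<..<s (Suc j)}. f (wcirc b t) \<in> wcirc (w ! j) ` {0<..<1}"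
      using tr unfolding traversal_word_def by auto
    have mono: "s i \<le> s j" if "i \<le> j" "j \<le> length w" for i j
      using that
    proof (induction j rule: dec_induct)
      case (step m)
      then show ?case
        using s(3)[rule_format, of m] by simp
    qed simp
    have "\<exists>j\<le>length w. t = s j" if "0 \<le> t" "t \<le> 1" and t0: "f (wcirc b t) = 0" for t
    proof -
      \<comment> \<open>The last subdivision point not after \<open>t\<close>. A zero strictly
        beyond it would lie in the following open interval, whose image avoids the wedge
        point.\<close>
      define j where "j = (GREATEST j. j \<le> length w \<and> s j \<le> t)"
      have ex: "\<exists>j. j \<le> length w \<and> s j \<le> t"
        using s(1) that by auto
      have j: "j \<le> length w" "s j \<le> t"
        using GreatestI_ex_nat[of "\<lambda>j. j \<le> length w \<and> s j \<le> t", OF ex] unfolding j_def by auto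
      have "t \<le> s j"
      proof (rule ccontr)
        assume "\<not> t \<le> s j"
        then have lt: "s j < t"
          by simp
        then have "j \<noteq> length w"
          using s(2) that by auto
        then have jl: "j < length w"
          using j by simp
        have "\<not> s (Suc j) \<le> t"
        proof
          assume "s (Suc j) \<le> t"
          then have "Suc j \<le> j"
            using jl Greatest_le_nat[of "\<lambda>j. j \<le> length w \<and> s j \<le> t" "Suc j" "length w"]
            unfolding j_def by auto
          then show False
            by simp
        qed
        then have "0 \<in> wcirc (w ! j) ` {0<..<1}"
          using s(5) jl lt t0 by (metis greaterThanLessThan_iff not_le)
        then obtain u where "u \<in> {0<..<1}" "wcirc (w ! j) u = 0"
          by (metis imageE)
        then show False
          using not_Ints_between_0_1 by (auto simp: wcirc_eq_0_iff)
      qed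
      then show ?thesis
        using j by auto
    qed
    moreover have "0 \<le> s j \<and> s j \<le> 1" if "j \<le> length w" for j
      using mono[of 0 j] mono[of j "length w"] that s(1,2) by simp
    ultimately have "s ` {..length w} = {t\<in>{0..1}. f (wcirc b t) = 0}"
      using s(4) unfolding set_eq_iff image_iff mem_Collect_eq by (metis atLeastAtMost_iff atMost_iff)
    then show ?thesis
      by (intro exI[of _ s] conjI s(3,5))
  qed
  obtain s where s: "\<forall>j<length w. s j < s (Suc j)"
      "s ` {..length w} = {t\<in>{0..1}. f (wcirc b t) = 0}"
      "\<forall>j<length w. \<forall>t\<in>{s j<..<s (Suc j)}. f (wcirc b t) \<in> wcirc (w ! j) ` {0<..<1}"
    using zeros[OF assms(1)] by blast
  obtain s' where s': "\<forall>j<length w'. s' j < s' (Suc j)"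
      "s' ` {..length w'} = {t\<in>{0..1}. f (wcirc b t) = 0}"
      "\<forall>j<length w'. \<forall>t\<in>{s' j<..<s' (Suc j)}. f (wcirc b t) \<in> wcirc (w' ! j) ` {0<..<1}"
    using zeros[OF assms(2)] by blast
  have "s ` {..length w} = s' ` {..length w'}"
    using s(2) s'(2) by simp
  note eq = strict_mono_upto_unique[OF s(1)[rule_format] s'(1)[rule_format] this]
  show ?thesis
  proof (rule nth_equalityI)
    fix j assume j: "j < length w"
    obtain t where t: "s j < t" "t < s (Suc j)"
      using s(1) j dense by blast
    then have "f (wcirc b t) \<in> wcirc (w ! j) ` {0<..<1}" "f (wcirc b t) \<in> wcirc (w' ! j) ` {0<..<1}"
      using s(3)[rule_format, of j t] s'(3)[rule_format, of j t] j eq(1) eq(2)[of j] eq(2)[of "Suc j"]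
      by simp_all
    then obtain u u' where "u \<in> {0<..<1}" "wcirc (w ! j) u = wcirc (w' ! j) u'"
      by (metis imageE)
    moreover from this have "wcirc (w ! j) u \<noteq> 0"
      using not_Ints_between_0_1 by (metis greaterThanLessThan_iff wcirc_eq_0_iff)
    ultimately show "w ! j = w' ! j"
      using wcirc_eq_same_circle by blast
  qed (rule eq)
qed

lemma sym_rep_eq: "traversal_word f b w \<Longrightarrow> sym_rep f b = w"
  unfolding sym_rep_def using traversal_word_unique by blast

subsection \<open>Locally constant functions\<close>

text \<open>Continuity into a discrete space, stated so that the values (numbers, truth values,
  pairs, lists) need no topology.\<close>

definition locally_const :: "'b::topological_space set \<Rightarrow> ('b \<Rightarrow> 'c) \<Rightarrow> bool" where
  "locally_const K g \<longleftrightarrow>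
     (\<forall>x\<in>K. \<exists>U. openin (top_of_set K) U \<and> x \<in> U \<and> (\<forall>y\<in>U. g y = g x))"

lemma locally_constE:
  assumes "locally_const K g" "x \<in> K"
  obtains U where "openin (top_of_set K) U" "x \<in> U" "\<And>y. y \<in> U \<Longrightarrow> g y = g x"
proof -
  have "\<exists>U. openin (top_of_set K) U \<and> x \<in> U \<and> (\<forall>y\<in>U. g y = g x)"
    using assms(1)[unfolded locally_const_def] assms(2) by (rule bspec)
  then obtain U where U: "openin (top_of_set K) U" "x \<in> U" "\<forall>y\<in>U. g y = g x"
    by (elim exE conjE) (rule that)
  show thesis
    by (rule that[OF U(1,2)]) (rule bspec[OF U(3)])
qed

lemma locally_const_const [simp]: "locally_const K (\<lambda>x. c)"
  unfolding locally_const_def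
proof
  fix x assume "x \<in> K"
  then show "\<exists>U. openin (top_of_set K) U \<and> x \<in> U \<and> (\<forall>y\<in>U. c = c)"
    by (intro exI[of _ K]) auto
qed

lemma locally_const_apply2:
  assumes "locally_const K g" "locally_const K h"
  shows "locally_const K (\<lambda>x. F (g x) (h x))"
  unfolding locally_const_def
proof
  fix x assume x: "x \<in> K"
  obtain U where U: "openin (top_of_set K) U" "x \<in> U" "\<And>y. y \<in> U \<Longrightarrow> g y = g x"
    using locally_constE[OF assms(1) x] by blast
  obtain V where V: "openin (top_of_set K) V" "x \<in> V" "\<And>y. y \<in> V \<Longrightarrow> h y = h x"
    using locally_constE[OF assms(2) x] by blast
  have "F (g y) (h y) = F (g x) (h x)" if "y \<in> U \<inter> V" for y
    using U(3)[of y] V(3)[of y] that by simp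
  then show "\<exists>U. openin (top_of_set K) U \<and> x \<in> U \<and> (\<forall>y\<in>U. F (g y) (h y) = F (g x) (h x))"
    using openin_Int[OF U(1) V(1)] U(2) V(2) by blast
qed

lemma locally_const_apply: "locally_const K g \<Longrightarrow> locally_const K (\<lambda>x. F (g x))"
  by (rule locally_const_apply2[of K g g "\<lambda>u v. F u"])

lemma locally_const_comp:
  assumes "locally_const K g" "continuous_on K T" "T ` K \<subseteq> K"
  shows "locally_const K (\<lambda>x. g (T x))"
  unfolding locally_const_def
proof
  fix x assume x: "x \<in> K"
  then obtain U where U: "openin (top_of_set K) U" "T x \<in> U" "\<And>y. y \<in> U \<Longrightarrow> g y = g (T x)"
    using locally_constE[OF assms(1), of "T x"] assms(3) by blast
  have "openin (top_of_set K) (K \<inter> T -` U)"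
    using continuous_openin_preimage[OF assms(2) _ U(1)] assms(3) by blast
  then show "\<exists>U. openin (top_of_set K) U \<and> x \<in> U \<and> (\<forall>y\<in>U. g (T y) = g (T x))"
    using U(2,3) x by blast
qed

lemma locally_const_openin:
  assumes "locally_const K P"
  shows "openin (top_of_set K) {x\<in>K. P x}"
proof (subst openin_subopen, intro ballI)
  fix x assume "x \<in> {x\<in>K. P x}"
  then obtain U where U: "openin (top_of_set K) U" "x \<in> U" "\<And>y. y \<in> U \<Longrightarrow> P y = P x"
    using locally_constE[OF assms] by blast
  then show "\<exists>U. openin (top_of_set K) U \<and> x \<in> U \<and> U \<subseteq> {x\<in>K. P x}"
    using openin_imp_subset[OF U(1)] \<open>x \<in> {x\<in>K. P x}\<close> by blast
qed

lemma locally_const_mem: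
  assumes "locally_const K P"
  shows "locally_const K (\<lambda>x. x \<in> {x\<in>K. P x})"
  unfolding locally_const_def
proof
  fix x assume "x \<in> K"
  then obtain U where U: "openin (top_of_set K) U" "x \<in> U" "\<And>y. y \<in> U \<Longrightarrow> P y = P x"
    using locally_constE[OF assms] by blast
  then show "\<exists>U. openin (top_of_set K) U \<and> x \<in> U \<and>
      (\<forall>y\<in>U. (y \<in> {x\<in>K. P x}) = (x \<in> {x\<in>K. P x}))"
    using openin_imp_subset[OF U(1)] \<open>x \<in> K\<close> by blast
qed

lemma locally_const_clopen:
  assumes "openin (top_of_set K) C" "closedin (top_of_set K) C"
  shows "locally_const K (\<lambda>x. x \<in> C)"
  unfolding locally_const_def
proof
  fix x assume x: "x \<in> K"
  have "openin (top_of_set K) (K - C)"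
    using assms(2) openin_diff[OF openin_subtopology_self] by blast
  then show "\<exists>U. openin (top_of_set K) U \<and> x \<in> U \<and> (\<forall>y\<in>U. (y \<in> C) = (x \<in> C))"
    using assms(1) x by (cases "x \<in> C") blast+
qed

lemma locally_const_finite_image:
  assumes "compact K" "locally_const K g"
  shows "finite (g ` K)"
proof -
  have "\<exists>U. open U \<and> x \<in> U \<and> (\<forall>y\<in>U \<inter> K. g y = g x)" if "x \<in> K" for x
    using locally_constE[OF assms(2) that] unfolding openin_open by (metis Int_commute Int_iff)
  then obtain U where U: "\<And>x. x \<in> K \<Longrightarrow> open (U x) \<and> x \<in> U x \<and> (\<forall>y\<in>U x \<inter> K. g y = g x)"
    by metis
  then obtain F where F: "F \<subseteq> K" "finite F" "K \<subseteq> (\<Union>x\<in>F. U x)"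
    using compactE_image[OF assms(1), of K U] by (metis UN_iff subsetI)
  have "g ` K \<subseteq> g ` F"
  proof
    fix v assume "v \<in> g ` K"
    then obtain y where "y \<in> K" "v = g y"
      by blast
    moreover from this obtain x where "x \<in> F" "y \<in> U x"
      using F by blast
    ultimately show "v \<in> g ` F"
      using U[of x] F(1) by blast
  qed
  then show ?thesis
    using F(2) finite_subset by blast
qed

lemma locally_const_map:
  assumes "\<And>m. locally_const K (g m)"
  shows "locally_const K (\<lambda>x. map (\<lambda>m. g m x) [0..<n])"
proof (induction n)
  case (Suc n)
  show ?case
    using locally_const_apply2[OF Suc assms[of n], of "\<lambda>u v. u @ [v]"] by simp
qed simp

text \<open>Near a point the value of \<open>g\<close> is frozen, so only one member of the family
  \<open>h\<close> matters there. This handles words whose length is itself a return time.\<close>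

lemma locally_const_dep:
  assumes "locally_const K g" "\<And>v. locally_const K (h v)"
  shows "locally_const K (\<lambda>x. h (g x) x)"
  unfolding locally_const_def
proof
  fix x assume x: "x \<in> K"
  obtain U where U: "openin (top_of_set K) U" "x \<in> U" "\<And>y. y \<in> U \<Longrightarrow> g y = g x"
    using locally_constE[OF assms(1) x] by blast
  obtain V where V: "openin (top_of_set K) V" "x \<in> V" "\<And>y. y \<in> V \<Longrightarrow> h (g x) y = h (g x) x"
    using locally_constE[OF assms(2) x] by blast
  have "h (g y) y = h (g x) x" if "y \<in> U \<inter> V" for y
    using U(3)[of y] V(3)[of y] that by simp
  then show "\<exists>U. openin (top_of_set K) U \<and> x \<in> U \<and> (\<forall>y\<in>U. h (g y) y = h (g x) x)"
    using openin_Int[OF U(1) V(1)] U(2) V(2) by blast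
qed

text \<open>If the least index at a point is \<open>N\<close>, it depends only on the truth of
  \<open>P 0\<close>, ..., \<open>P N\<close>, finitely many conditions that are frozen on a common
  neighbourhood.\<close>

lemma locally_const_Least:
  fixes P :: "nat \<Rightarrow> 'b::topological_space \<Rightarrow> bool"
  assumes "\<And>n. locally_const K (P n)" "\<And>x. x \<in> K \<Longrightarrow> \<exists>n. P n x"
  shows "locally_const K (\<lambda>x. LEAST n. P n x)"
  unfolding locally_const_def
proof
  fix x assume x: "x \<in> K"
  define N where "N = (LEAST n. P n x)"
  obtain U where U: "openin (top_of_set K) U" "x \<in> U"
    "\<forall>y\<in>U. map (\<lambda>m. P m y) [0..<Suc N] = map (\<lambda>m. P m x) [0..<Suc N]"
    using bspec[OF locally_const_map[of K P "Suc N", OF assms(1), unfolded locally_const_def] x]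
    by (elim exE conjE) (rule that)
  have "(LEAST n. P n y) = N" if "y \<in> U" for y
  proof -
    have eq: "P m y = P m x" if "m \<le> N" for m
      using arg_cong[OF bspec[OF U(3) \<open>y \<in> U\<close>], of "\<lambda>xs. xs ! m"] that by (simp del: upt_Suc)
    show ?thesis
    proof (rule Least_equality)
      show "P N y"
        using eq[of N] LeastI_ex[OF assms(2)[OF x]] N_def by simp
      show "N \<le> m" if "P m y" for m
        using eq[of m] that not_less_Least[of m "\<lambda>n. P n x"] N_def by force
    qed
  qed
  then show "\<exists>U. openin (top_of_set K) U \<and> x \<in> U \<and> (\<forall>y\<in>U. (LEAST n. P n y) = (LEAST n. P n x))"
    using U(1,2) unfolding N_def by blast
qed

subsection \<open>Kakutani--Rokhlin towers\<close>

text \<open>The discrete counterpart of the flow. The sets \<open>D n\<close> replace a metric,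
  since deciding membership in all of them separates points; \<open>returns\<close> is what density
  at \<open>x0\<close> becomes for the return map.\<close>

locale clopen_dynamics =
  fixes K :: "'b::topological_space set" and T T' :: "'b \<Rightarrow> 'b" and D :: "nat \<Rightarrow> 'b set" and x0 :: 'b
  assumes compact_K: "compact K"
    and T_in: "x \<in> K \<Longrightarrow> T x \<in> K" and T'_in: "x \<in> K \<Longrightarrow> T' x \<in> K"
    and T'T: "x \<in> K \<Longrightarrow> T' (T x) = x" and TT': "x \<in> K \<Longrightarrow> T (T' x) = x"
    and cont_T: "continuous_on K T" and cont_T': "continuous_on K T'"
    and x0_in: "x0 \<in> K"
    and D_lc: "locally_const K (\<lambda>x. x \<in> D n)"
    and D_sep: "x \<in> K \<Longrightarrow> y \<in> K \<Longrightarrow> x \<noteq> y \<Longrightarrow> \<exists>n. x \<in> D n \<longleftrightarrow> y \<notin> D n"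
    and returns: "openin (top_of_set K) C \<Longrightarrow> x0 \<in> C \<Longrightarrow> x \<in> K \<Longrightarrow> \<exists>n\<ge>1. (T ^^ n) x \<in> C"
begin

text \<open>There are \<open>k\<close> towers of heights \<open>l\<close>; the point \<open>x\<close> lies on floor \<open>M x\<close> of tower \<open>J x\<close>.\<close>

definition tower :: "nat \<Rightarrow> (nat \<Rightarrow> nat) \<Rightarrow> ('b \<Rightarrow> nat) \<Rightarrow> ('b \<Rightarrow> nat) \<Rightarrow> bool" where
  "tower k l J M \<longleftrightarrow> locally_const K J \<and> locally_const K M \<and>
     (\<forall>x\<in>K. J x < k \<and> M x < l (J x)) \<and> (\<forall>j<k. \<exists>x\<in>K. J x = j \<and> M x = 0) \<and>
     (\<forall>x\<in>K. if M x + 1 < l (J x) then J (T x) = J x \<and> M (T x) = M x + 1 else M (T x) = 0) \<and>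
     M x0 = 0"

lemma Tn_in: "x \<in> K \<Longrightarrow> (T ^^ n) x \<in> K"
  by (induction n) (auto simp: T_in)

lemma T'n_in: "x \<in> K \<Longrightarrow> (T' ^^ n) x \<in> K"
  by (induction n) (auto simp: T'_in)

lemma Tn_T'n: "x \<in> K \<Longrightarrow> (T ^^ n) ((T' ^^ n) x) = x"
  by (induction n) (auto simp: funpow_swap1[of T] TT' T'n_in)

lemma Tn_T'n_le: "x \<in> K \<Longrightarrow> i \<le> m \<Longrightarrow> (T ^^ i) ((T' ^^ m) x) = (T' ^^ (m - i)) x"
  using Tn_T'n[of "(T' ^^ (m - i)) x" i] T'n_in[of x "m - i"]
    funpow_add[of i "m - i" T'] by simp

lemma Tn_T'n_ge: "x \<in> K \<Longrightarrow> m \<le> i \<Longrightarrow> (T ^^ i) ((T' ^^ m) x) = (T ^^ (i - m)) x"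
  using Tn_T'n[of x m] funpow_add[of "i - m" m T] by simp

lemma locally_const_Tn: "locally_const K g \<Longrightarrow> locally_const K (\<lambda>x. g ((T ^^ n) x))"
proof (induction n)
  case (Suc n)
  have "locally_const K (\<lambda>x. g ((T ^^ n) (T x)))"
    using locally_const_comp[OF Suc.IH[OF Suc.prems] cont_T] T_in by blast
  then show ?case
    by (simp add: funpow_swap1)
qed simp

lemma locally_const_T'n: "locally_const K g \<Longrightarrow> locally_const K (\<lambda>x. g ((T' ^^ n) x))"
proof (induction n)
  case (Suc n)
  have "locally_const K (\<lambda>x. g ((T' ^^ n) (T' x)))"
    using locally_const_comp[OF Suc.IH[OF Suc.prems] cont_T'] T'_in by blast
  then show ?case
    by (simp add: funpow_swap1)
qed simp

text \<open>A column leads from one visit to \<open>C\<close> up to the next. Columns that show the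
  same word of labels (\<open>code\<close>) form one tower, whose height is the length of the word;
  compactness leaves only finitely many words.\<close>

lemma tower_over:
  fixes lab :: "'b \<Rightarrow> 'l"
  assumes C: "locally_const K (\<lambda>x. x \<in> C)" "C \<subseteq> K" "x0 \<in> C" and lab: "locally_const K lab"
  shows "\<exists>k l J M. tower k l J M \<and> (\<forall>x\<in>K. M x = 0 \<longleftrightarrow> x \<in> C) \<and>
    (\<forall>x\<in>K. \<forall>y\<in>K. J x = J y \<and> M x = M y \<longrightarrow> lab x = lab y)"
proof -
  define N where "N x = (LEAST n. 1 \<le> n \<and> (T ^^ n) x \<in> C)" for x
  define M where "M x = (LEAST m. (T' ^^ m) x \<in> C)" for x
  define b where "b x = (T' ^^ M x) x" for x
  define code where "code x = map (\<lambda>m. lab ((T ^^ m) x)) [0..<N x]" for x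
  have "C = {x\<in>K. x \<in> C}"
    using C(2) by blast
  then have "openin (top_of_set K) C"
    using locally_const_openin[OF C(1)] by simp
  then have ex: "\<exists>n. 1 \<le> n \<and> (T ^^ n) x \<in> C" if "x \<in> K" for x
    using returns C(3) that by blast
  have N: "1 \<le> N x" "(T ^^ N x) x \<in> C" if "x \<in> K" for x
    using LeastI_ex[OF ex[OF that]] unfolding N_def by auto
  have N_less: "(T ^^ n) x \<notin> C" if "1 \<le> n" "n < N x" for n x
    using not_less_Least[of n "\<lambda>n. 1 \<le> n \<and> (T ^^ n) x \<in> C"] that unfolding N_def by blast
  have N_lc: "locally_const K N"
    unfolding N_def
    by (intro locally_const_Least locally_const_apply2[of K _ _ "(\<and>)"]
        locally_const_const locally_const_Tn C(1) ex)
  obtain B where B: "\<And>x. x \<in> K \<Longrightarrow> N x \<le> B"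
    using locally_const_finite_image[OF compact_K N_lc] finite_nat_set_iff_bounded_le by auto
  \<comment> \<open>A past visit exists because \<open>B\<close> bounds all return times: the point
    \<open>B\<close> steps back reaches \<open>C\<close> no later than the present.\<close>
  have exM: "\<exists>m. (T' ^^ m) x \<in> C" if "x \<in> K" for x
  proof -
    have "(T ^^ N ((T' ^^ B) x)) ((T' ^^ B) x) \<in> C"
      using N(2) T'n_in that by blast
    then show ?thesis
      using Tn_T'n_le[OF that B[OF T'n_in[OF that]]] by metis
  qed
  have M: "(T' ^^ M x) x \<in> C" if "x \<in> K" for x
    using LeastI_ex[OF exM[OF that]] unfolding M_def by auto
  have M_less: "(T' ^^ m) x \<notin> C" if "m < M x" for m x
    using not_less_Least[of m "\<lambda>m. (T' ^^ m) x \<in> C"] that unfolding M_def by blast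
  have M_eq: "M x = m" if "(T' ^^ m) x \<in> C" "\<And>i. i < m \<Longrightarrow> (T' ^^ i) x \<notin> C" for m x
    unfolding M_def by (rule Least_equality) (use that in \<open>auto simp: not_less[symmetric]\<close>)
  have M_lc: "locally_const K M"
    unfolding M_def by (intro locally_const_Least locally_const_T'n C(1) exM)
  have M_0: "M x = 0 \<longleftrightarrow> x \<in> C" if "x \<in> K" for x
    using M[OF that] M_eq[of 0 x] by auto
  have code_lc: "locally_const K code"
    unfolding code_def
    by (rule locally_const_dep[OF N_lc]) (intro locally_const_map locally_const_Tn lab)
  have b_in: "b x \<in> C" if "x \<in> K" for x
    using M[OF that] b_def by simp
  have cb_lc: "locally_const K (\<lambda>x. code (b x))"
    unfolding b_def
    by (rule locally_const_dep[OF M_lc]) (intro locally_const_T'n code_lc)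
  have "finite (code ` C)"
    using locally_const_finite_image[OF compact_K code_lc] C(2) by (meson finite_subset image_mono)
  then obtain idx where idx: "bij_betw idx (code ` C) {0..<card (code ` C)}"
    using ex_bij_betw_finite_nat by blast
  define k where "k = card (code ` C)"
  define J where "J x = idx (code (b x))" for x
  define l where "l j = length (inv_into (code ` C) idx j)" for j
  have J_lt: "J x < k" if "x \<in> K" for x
    using bij_betwE[OF idx] b_in[OF that] unfolding J_def k_def by auto
  have J_eqD: "code (b x) = code (b y)" if "x \<in> K" "y \<in> K" "J x = J y" for x y
    using inj_onD[OF bij_betw_imp_inj_on[OF idx]] that b_in unfolding J_def by blast
  \<comment> \<open>Strictly between its two ends a column avoids \<open>C\<close>: up to
    \<open>x\<close> by minimality of \<open>M x\<close>, and beyond \<open>x\<close> by minimality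
    of \<open>N x\<close>.\<close>
  have NMN: "N (b x) = M x + N x" if x: "x \<in> K" for x
    unfolding N_def[of "b x"]
  proof (rule Least_equality)
    show "1 \<le> M x + N x \<and> (T ^^ (M x + N x)) (b x) \<in> C"
      unfolding b_def using N[OF x] Tn_T'n_ge[OF x, of "M x" "M x + N x"] by simp
    fix n assume n: "1 \<le> n \<and> (T ^^ n) (b x) \<in> C"
    show "M x + N x \<le> n"
    proof (cases "n \<le> M x")
      case True
      then have "(T' ^^ (M x - n)) x \<in> C"
        using n Tn_T'n_le[OF x True] unfolding b_def by simp
      then show ?thesis
        using M_less[of "M x - n" x] n True by simp
    next
      case False
      then have "(T ^^ (n - M x)) x \<in> C"
        using n Tn_T'n_ge[OF x, of "M x" n] unfolding b_def by simp
      then show ?thesis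
        using N_less[of "n - M x" x] False by force
    qed
  qed
  have lJ: "l (J x) = M x + N x" if x: "x \<in> K" for x
  proof -
    have "inv_into (code ` C) idx (J x) = code (b x)"
      unfolding J_def using bij_betw_imp_inj_on[OF idx] b_in[OF x] by (simp add: inv_into_f_f)
    then show ?thesis
      unfolding l_def using NMN[OF x] by (simp add: code_def)
  qed
  have T_C: "M (T x) = 0" "N x = 1" if x: "x \<in> K" "T x \<in> C" for x
    using M_0[OF T_in] that N_less[of 1 x] N(1)[of x] by fastforce+
  have T_nC: "M (T x) = M x + 1" "J (T x) = J x" "N x > 1" if x: "x \<in> K" "T x \<notin> C" for x
  proof -
    have sh: "(T' ^^ Suc i) (T x) = (T' ^^ i) x" for i
      using T'T[OF x(1)] by (simp add: funpow_swap1)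
    show M1: "M (T x) = M x + 1"
    proof (rule M_eq)
      show "(T' ^^ (M x + 1)) (T x) \<in> C"
        using sh[of "M x"] M[OF x(1)] by simp
      show "(T' ^^ i) (T x) \<notin> C" if "i < M x + 1" for i
        using sh M_less x(2) that by (cases i) auto
    qed
    have "b (T x) = b x"
      unfolding b_def M1 using sh[of "M x"] by simp
    then show "J (T x) = J x"
      unfolding J_def by simp
    show "N x > 1"
      using N[OF x(1)] x(2) by (cases "N x = 1") auto
  qed
  have "tower k l J M"
    unfolding tower_def
  proof (intro conjI ballI allI impI)
    show "locally_const K J"
      unfolding J_def by (rule locally_const_apply[OF cb_lc])
    show "locally_const K M"
      by (rule M_lc)
    show "J x < k" "M x < l (J x)" if "x \<in> K" for x
      using J_lt lJ N(1) that by force+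
    show "\<exists>x\<in>K. J x = j \<and> M x = 0" if "j < k" for j
    proof -
      have "j \<in> idx ` (code ` C)"
        using that idx unfolding bij_betw_def k_def by auto
      then obtain y where y: "y \<in> C" "j = idx (code y)"
        by blast
      then have "M y = 0"
        using M_0 C(2) by blast
      then show ?thesis
        using y C(2) unfolding J_def b_def by (intro bexI[of _ y]) auto
    qed
    show "if M x + 1 < l (J x) then J (T x) = J x \<and> M (T x) = M x + 1 else M (T x) = 0"
      if "x \<in> K" for x
      using T_C T_nC lJ that by (cases "T x \<in> C") auto
    show "M x0 = 0"
      using M_0 C x0_in by blast
  qed
  moreover have "lab x = lab y" if "x \<in> K" "y \<in> K" "J x = J y" "M x = M y" for x y
  proof -
    have *: "lab x = code (b x) ! M x" if "x \<in> K" for x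
    proof -
      have "M x < N (b x)"
        using NMN[OF that] N(1)[OF that] by simp
      then show ?thesis
        unfolding code_def using Tn_T'n[OF that] by (simp add: b_def)
    qed
    show ?thesis
      using J_eqD[of x y] *[of x] *[of y] that by simp
  qed
  ultimately show ?thesis
    using M_0 by blast
qed

text \<open>The towers are rebuilt over a small clopen neighbourhood \<open>C\<close> of
  \<open>x0\<close>. Labelling points by old tower, old floor and side of \<open>D n\<close> makes
  the new partition finer; all demands on the new base become conditions defining
  \<open>C\<close>.\<close>

lemma tower_refine:
  assumes tw: "tower k l J M"
  shows "\<exists>k' l' J' M'. tower k' l' J' M' \<and>
    (\<forall>x\<in>K. \<forall>y\<in>K. J' x = J' y \<and> M' x = M' y \<longrightarrow> J x = J y \<and> M x = M y \<and> (x \<in> D n \<longleftrightarrow> y \<in> D n)) \<and>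
    (\<forall>x\<in>K. M' x = 0 \<longrightarrow> M x = 0 \<and> J x = J x0 \<and> J (T' x) = J (T' x0) \<and> (x \<in> D n \<longleftrightarrow> x0 \<in> D n)) \<and>
    ((T ^^ l (J x0)) x0 \<noteq> x0 \<longrightarrow> (\<forall>x\<in>K. M' x = 0 \<longrightarrow> M' ((T ^^ l (J x0)) x) \<noteq> 0))"
proof -
  note lc_and = locally_const_apply2[of K _ _ "(\<and>)"]
  have J: "locally_const K J" and M: "locally_const K M" and M0: "M x0 = 0"
    using tw unfolding tower_def by auto
  have lc_lab: "locally_const K (\<lambda>x. (J x, M x, x \<in> D n))"
    using locally_const_apply2[OF J locally_const_apply2[OF M D_lc, of Pair], of Pair] .
  define q where "q = l (J x0)"
  \<comment> \<open>If \<open>D m\<close> separates \<open>x0\<close> from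
    \<open>(T ^^ q) x0\<close>, the last two conditions of \<open>P\<close> place a point of
    \<open>C\<close> and its image under \<open>T ^^ q\<close> on different sides of
    \<open>D m\<close>, so the image is outside \<open>C\<close>.\<close>
  obtain m where m: "(T ^^ q) x0 \<noteq> x0 \<Longrightarrow> x0 \<in> D m \<longleftrightarrow> (T ^^ q) x0 \<notin> D m"
    using D_sep[OF x0_in Tn_in[OF x0_in]] by metis
  \<comment> \<open>In order, the conditions serve the common first letter, the common last letter,
    the shrinking of the bases to \<open>x0\<close>, and the absence of a return after
    \<open>q\<close> steps.\<close>
  define P where "P x \<longleftrightarrow> (M x = 0 \<and> J x = J x0) \<and> (J ((T' ^^ 1) x) = J (T' x0) \<and>
    (x \<in> D n) = (x0 \<in> D n)) \<and> (x \<in> D m) = (x0 \<in> D m) \<and>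
    ((T ^^ q) x \<in> D m) = ((T ^^ q) x0 \<in> D m)" for x
  define C where "C = {x\<in>K. P x}"
  have "locally_const K P"
    unfolding P_def
    by (intro lc_and locally_const_apply[OF M, of "\<lambda>u. u = 0"]
        locally_const_apply[OF J, of "\<lambda>u. u = J x0"]
        locally_const_apply[OF locally_const_T'n[OF J], of "\<lambda>u. u = J (T' x0)"]
        locally_const_apply[OF D_lc, of "\<lambda>u. u = (x0 \<in> D _)"]
        locally_const_apply[OF locally_const_Tn[OF D_lc], of "\<lambda>u. u = ((T ^^ q) x0 \<in> D m)"])
  then have "locally_const K (\<lambda>x. x \<in> C)"
    unfolding C_def by (rule locally_const_mem)
  moreover have "C \<subseteq> K" "x0 \<in> C"
    using x0_in M0 unfolding C_def P_def by auto
  ultimately have "\<exists>k l J' M'. tower k l J' M' \<and> (\<forall>x\<in>K. M' x = 0 \<longleftrightarrow> x \<in> C) \<and>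
    (\<forall>x\<in>K. \<forall>y\<in>K. J' x = J' y \<and> M' x = M' y \<longrightarrow> (J x, M x, x \<in> D n) = (J y, M y, y \<in> D n))"
    by (rule tower_over[OF _ _ _ lc_lab])
  then obtain k' l' J' M' where tw': "tower k' l' J' M'"
    and C: "\<forall>x\<in>K. M' x = 0 \<longleftrightarrow> x \<in> C"
    and lab: "\<forall>x\<in>K. \<forall>y\<in>K. J' x = J' y \<and> M' x = M' y \<longrightarrow>
      (J x, M x, x \<in> D n) = (J y, M y, y \<in> D n)"
    by (elim exE conjE) (rule that)
  have "M' ((T ^^ q) x) \<noteq> 0" if "(T ^^ q) x0 \<noteq> x0" "x \<in> K" "M' x = 0" for x
    using m that C[rule_format, of x] C[rule_format, OF Tn_in[of x q]] unfolding C_def P_def by auto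
  moreover have "M x = 0 \<and> J x = J x0 \<and> J (T' x) = J (T' x0) \<and> (x \<in> D n \<longleftrightarrow> x0 \<in> D n)"
    if "x \<in> K" "M' x = 0" for x
    using that C[rule_format, of x] unfolding C_def P_def by auto
  moreover have "J x = J y \<and> M x = M y \<and> (x \<in> D n \<longleftrightarrow> y \<in> D n)"
    if "x \<in> K" "y \<in> K" "J' x = J' y \<and> M' x = M' y" for x y
    using lab[rule_format, OF that] by blast
  ultimately show ?thesis
    using tw' unfolding q_def
    by (intro exI[where x = k'] exI[where x = l'])
      (rule exI[of _ J'], rule exI[of _ M'], blast)
qed
end

subsection \<open>Paths in wedges\<close>

text \<open>One increasing parameter \<open>h\<close> serves both sides of \<open>t0\<close>, while
  the circle may change there, but only at the wedge point. The bound 1 on the oscillation of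
  \<open>h\<close> turns monotonicity into injectivity; both conditions on projections and positive
  maps follow from this one notion.\<close>

definition lifted_at :: "nat \<Rightarrow> (real \<Rightarrow> complex) \<Rightarrow> real \<Rightarrow> bool" where
  "lifted_at k c t0 \<longleftrightarrow> (\<exists>e>0. \<exists>a0<k. \<exists>a1<k. \<exists>h.
     strict_mono_on {t0-e<..<t0+e} h \<and>
     (\<forall>t\<in>{t0-e<..<t0+e}. \<forall>t'\<in>{t0-e<..<t0+e}. \<bar>h t - h t'\<bar> < 1) \<and>
     (\<forall>t\<in>{t0-e<..<t0+e}. c t = wcirc (if t < t0 then a0 else a1) (h t)) \<and>
     (c t0 \<noteq> 0 \<longrightarrow> a0 = a1))"

lemma lifted_at_inj:
  assumes "lifted_at k c t0"
  shows "\<exists>e>0. inj_on c {t0-e<..<t0+e}"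
proof -
  obtain e a0 a1 h where e: "e > 0" and h: "strict_mono_on {t0-e<..<t0+e} h"
    and b: "\<And>t t'. t \<in> {t0-e<..<t0+e} \<Longrightarrow> t' \<in> {t0-e<..<t0+e} \<Longrightarrow> \<bar>h t - h t'\<bar> < 1"
    and c: "\<And>t. t \<in> {t0-e<..<t0+e} \<Longrightarrow> c t = wcirc (if t < t0 then a0 else a1) (h t)"
    using assms unfolding lifted_at_def by blast
  have "inj_on c {t0-e<..<t0+e}"
  proof (rule inj_onI)
    fix t t' assume t: "t \<in> {t0-e<..<t0+e}" "t' \<in> {t0-e<..<t0+e}" "c t = c t'"
    then have "h t - h t' \<in> \<int>"
      using c wcirc_eq_diff_Ints by metis
    then have "h t = h t'"
      using b[OF t(1,2)] real_Ints_diff_less_1 by blast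
    then show "t = t'"
      using strict_mono_on_imp_inj_on[OF h] t by (meson inj_onD)
  qed
  then show ?thesis
    using e by blast
qed

lemma lifted_at_mono:
  assumes "lifted_at k c t0" "c t0 \<noteq> 0"
  shows "\<exists>a<k. \<exists>e>0. \<exists>h. strict_mono_on {t0-e<..<t0+e} h \<and>
    (\<forall>t\<in>{t0-e<..<t0+e}. c t = wcirc a (h t))"
proof -
  obtain e a0 a1 h where e: "e > 0" "a1 < k" and h: "strict_mono_on {t0-e<..<t0+e} h"
    and c: "\<And>t. t \<in> {t0-e<..<t0+e} \<Longrightarrow> c t = wcirc (if t < t0 then a0 else a1) (h t)"
    and "a0 = a1"
    using assms unfolding lifted_at_def by blast
  then have "\<forall>t\<in>{t0-e<..<t0+e}. c t = wcirc a1 (h t)"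
    by simp
  then show ?thesis
    using e h by blast
qed

lemma lifted_at_interior:
  fixes M l :: nat
  assumes "r > 0" "e > 0" "j < k" "0 < l"
    and c: "\<And>v. \<bar>v\<bar> < e \<Longrightarrow> c (t0 + v) = wcirc j ((real M + (u + v / r)) / real l)"
  shows "lifted_at k c t0"
proof -
  \<comment> \<open>Times in the interval then differ by less than \<open>r\<close>, so
    \<open>h\<close> varies by less than one turn even if the tower has height 1.\<close>
  define d where "d = min e (r / 2)"
  have d: "d > 0" "d \<le> e" "d \<le> r / 2"
    using assms unfolding d_def by auto
  define h where "h t = (real M + (u + (t - t0) / r)) / real l" for t
  have diff: "h t - h t' = (t - t') / r / real l" for t t'
    unfolding h_def using assms by (simp add: field_simps)
  have "strict_mono_on {t0-d<..<t0+d} h"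
  proof (rule strict_mono_onI)
    fix t t' :: real assume "t < t'"
    then have "h t' - h t > 0"
      unfolding diff using assms by simp
    then show "h t < h t'"
      by simp
  qed
  moreover have "\<bar>h t - h t'\<bar> < 1" if "t \<in> {t0-d<..<t0+d}" "t' \<in> {t0-d<..<t0+d}" for t t'
  proof -
    have "\<bar>t - t'\<bar> < r"
      using that d by auto
    then have "\<bar>t - t'\<bar> < r * real l"
      using assms by (smt (verit, best) mult_left_le of_nat_le_iff One_nat_def Suc_leI mult_le_cancel_left1 of_nat_1)
    then show ?thesis
      unfolding diff using assms by (simp add: abs_mult field_simps)
  qed
  moreover have "c t = wcirc (if t < t0 then j else j) (h t)" if "t \<in> {t0-d<..<t0+d}" for t
    using c[of "t - t0"] that d unfolding h_def by auto
  ultimately show ?thesis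
    unfolding lifted_at_def using d(1) assms(3) by blast
qed

text \<open>At \<open>t0\<close> the path passes from floor \<open>m0\<close> to floor
  \<open>m1\<close>. Inside a tower the two parameters agree at \<open>t0\<close>; after a top floor
  the incoming parameter is 1 and the outgoing one is 0, so \<open>h\<close> uses the incoming one
  lowered by a full turn.\<close>

lemma lifted_at_junction:
  fixes m0 m1 :: nat and l :: "nat \<Rightarrow> nat"
  assumes r: "r0 > 0" "r1 > 0" and j: "j0 < k" "j1 < k" and m: "m0 < l j0" "m1 < l j1"
    and succ: "if m0 + 1 < l j0 then j1 = j0 \<and> m1 = m0 + 1 else m1 = 0"
    and c1: "\<And>v. 0 \<le> v \<Longrightarrow> v < r1 \<Longrightarrow> c (t0 + v) = wcirc j1 ((real m1 + v / r1) / real (l j1))"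
    and c0: "\<And>v. 0 \<le> v \<Longrightarrow> v < r0 \<Longrightarrow> c (t0 - v) = wcirc j0 ((real m0 + (1 - v / r0)) / real (l j0))"
  shows "lifted_at k c t0"
proof -
  define d where "d = min r0 r1 / 2"
  have d: "d > 0" "d \<le> r0 / 2" "d \<le> r1 / 2"
    using r unfolding d_def by auto
  define p where "p = real m1 / real (l j1)"
  define h where "h t = (if t < t0 then p - (t0 - t) / r0 / real (l j0) else p + (t - t0) / r1 / real (l j1))" for t
  have l1: "1 \<le> real (l j0)" "1 \<le> real (l j1)"
    using m by simp_all
  have div_le: "w / L \<le> w" if "0 \<le> w" "1 \<le> L" for w L :: real
    using that mult_left_mono[of 1 L w] by (simp add: divide_le_eq)
  have h0: "c t = wcirc j0 (h t)" if "t < t0" "t0 - d < t" for t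
  proof -
    have ct: "c t = wcirc j0 ((real m0 + (1 - (t0 - t) / r0)) / real (l j0))"
      using c0[of "t0 - t"] that d r by simp
    have split: "(real m0 + (1 - w)) / real (l j0) = (real m0 + 1) / real (l j0) - w / real (l j0)" for w
      by (simp add: add_divide_distrib diff_divide_distrib)
    show ?thesis
    proof (cases "m0 + 1 < l j0")
      case True
      then have "(real m0 + 1) / real (l j0) = p"
        using succ unfolding p_def by (simp add: add.commute)
      then show ?thesis
        using ct that unfolding split h_def by simp
    next
      case False
      then have "real m0 + 1 = real (l j0)" "m1 = 0"
        using succ m by auto
      then have "(real m0 + 1) / real (l j0) = p + 1"
        using l1 unfolding p_def by simp
      then have "c t = wcirc j0 (h t + 1)"
        using ct that unfolding split h_def by (simp add: algebra_simps)
      then show ?thesis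
        using wcirc_add_int[of "h t + 1" "h t" j0] by simp
    qed
  qed
  have h1: "c t = wcirc j1 (h t)" if "t0 \<le> t" "t < t0 + d" for t
    using c1[of "t - t0"] that d r unfolding h_def p_def by (simp add: add_divide_distrib)
  have below: "h t < p \<and> p - 1 / 2 < h t" if "t < t0" "t0 - d < t" for t
  proof -
    have "(t0 - t) / r0 / real (l j0) > 0"
      using that r l1 by simp
    moreover have "(t0 - t) / r0 < 1 / 2"
      using that d r by (simp add: field_simps)
    moreover have "(t0 - t) / r0 \<ge> 0"
      using that r by simp
    then have "(t0 - t) / r0 / real (l j0) \<le> (t0 - t) / r0"
      by (rule div_le) (use l1 in auto)
    moreover have "h t = p - (t0 - t) / r0 / real (l j0)"
      using that unfolding h_def by simp
    ultimately show ?thesis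
      by linarith
  qed
  have above: "p \<le> h t \<and> h t < p + 1 / 2" if "t0 \<le> t" "t < t0 + d" for t
  proof -
    have "(t - t0) / r1 / real (l j1) \<ge> 0"
      using that r l1 by simp
    moreover have "(t - t0) / r1 < 1 / 2"
      using that d r by (simp add: field_simps)
    moreover have "(t - t0) / r1 \<ge> 0"
      using that r by simp
    then have "(t - t0) / r1 / real (l j1) \<le> (t - t0) / r1"
      by (rule div_le) (use l1 in auto)
    moreover have "h t = p + (t - t0) / r1 / real (l j1)"
      using that unfolding h_def by simp
    ultimately show ?thesis
      by linarith
  qed
  have "strict_mono_on {t0-d<..<t0+d} h"
  proof (rule strict_mono_onI)
    fix t t' assume t: "t \<in> {t0-d<..<t0+d}" "t' \<in> {t0-d<..<t0+d}" "t < t'"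
    consider "t' < t0" | "t < t0" "t0 \<le> t'" | "t0 \<le> t"
      by linarith
    then show "h t < h t'"
    proof cases
      case 1
      then have "(t0 - t') / r0 / real (l j0) < (t0 - t) / r0 / real (l j0)"
        using t r l1 by (intro divide_strict_right_mono) auto
      then show ?thesis
        using 1 t unfolding h_def by simp
    next
      case 2
      then show ?thesis
        using below[of t] above[of t'] t by auto
    next
      case 3
      then have "(t - t0) / r1 / real (l j1) < (t' - t0) / r1 / real (l j1)"
        using t r l1 by (intro divide_strict_right_mono) auto
      then show ?thesis
        using 3 t unfolding h_def by simp
    qed
  qed
  moreover have "\<bar>h t - h t'\<bar> < 1" if "t \<in> {t0-d<..<t0+d}" "t' \<in> {t0-d<..<t0+d}" for t t'
  proof -
    have "p - 1 / 2 < h t \<and> h t < p + 1 / 2" if "t \<in> {t0-d<..<t0+d}" for t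
      using below[of t] above[of t] that by (cases "t < t0") auto
    from this[OF that(1)] this[OF that(2)] show ?thesis
      by linarith
  qed
  moreover have "c t = wcirc (if t < t0 then j0 else j1) (h t)" if "t \<in> {t0-d<..<t0+d}" for t
    using h0[of t] h1[of t] that by auto
  moreover have "j0 = j1" if "c t0 \<noteq> 0"
  proof (rule ccontr)
    assume "j0 \<noteq> j1"
    then have "m1 = 0"
      using succ by (auto split: if_splits)
    then show False
      using c1[of 0] r that by simp
  qed
  ultimately show ?thesis
    unfolding lifted_at_def using d(1) j
    by (intro exI[of _ d] exI[of _ j0] exI[of _ j1] exI[of _ h] conjI ballI impI) auto
qed

text \<open>A letter starts exactly where a floor of index 0 is entered. By \<open>succ\<close> a
  circle must be climbed to its top before the next letter starts, and \<open>mL\<close> completes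
  the last circle.\<close>

lemma traversal_word_floors:
  fixes a m l :: "nat \<Rightarrow> nat" and L :: nat
  assumes g: "\<And>i u. i < L \<Longrightarrow> 0 \<le> u \<Longrightarrow> u \<le> 1 \<Longrightarrow>
      g (wcirc b ((real i + u) / real L)) = wcirc (a i) ((real (m i) + u) / real (l (a i)))"
    and ml: "\<And>i. i < L \<Longrightarrow> m i < l (a i)"
    and L: "0 < L" and m0: "m 0 = 0" and mL: "m (L - 1) + 1 = l (a (L - 1))"
    and succ: "\<And>i. Suc i < L \<Longrightarrow>
      if m i + 1 < l (a i) then a (Suc i) = a i \<and> m (Suc i) = m i + 1 else m (Suc i) = 0"
  shows "traversal_word g b (map a (filter (\<lambda>i. m i = 0) [0..<L]))"
proof -
  define zs where "zs = filter (\<lambda>i. m i = 0) [0..<L]"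
  define n where "n = length zs"
  \<comment> \<open>The default \<open>L\<close> past the end of the list supplies the closing
    subdivision point 1.\<close>
  define z where "z j = (if j < n then zs ! j else L)" for j
  have zs_set: "set zs = {i. i < L \<and> m i = 0}"
    unfolding zs_def by auto
  have z_less: "z j < L" "m (z j) = 0" if "j < n" for j
    using that zs_set nth_mem[of j zs] unfolding z_def n_def by auto
  have zs_sorted: "sorted_wrt (<) zs"
    unfolding zs_def by (rule sorted_wrt_filter) simp
  have z_mono: "z j < z (Suc j)" if "j < n" for j
  proof (cases "Suc j < n")
    case True
    then show ?thesis
      using sorted_wrt_nth_less[OF zs_sorted, of j "Suc j"] unfolding z_def n_def by simp
  next
    case False
    then show ?thesis
      using z_less[OF that] unfolding z_def by simp
  qed
  have gap: "m i \<noteq> 0" if "j < n" "z j < i" "i < z (Suc j)" for i j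
  proof
    assume mi: "m i = 0"
    have "i < L"
      using that z_less[of "Suc j"] by (cases "Suc j < n") (auto simp: z_def)
    then have "i \<in> set zs"
      using mi zs_set by auto
    then obtain j' where j': "j' < n" "zs ! j' = i"
      unfolding in_set_conv_nth n_def by auto
    have "j < j'"
    proof (rule ccontr)
      assume "\<not> j < j'"
      then have "zs ! j' \<le> zs ! j"
        using sorted_wrt_nth_less[OF zs_sorted, of j' j] that(1) unfolding n_def
        by (cases "j = j'") auto
      then show False
        using j' that unfolding z_def by simp
    qed
    have "zs ! Suc j \<le> zs ! j'"
      using sorted_wrt_nth_less[OF zs_sorted, of "Suc j" j'] \<open>j < j'\<close> j' unfolding n_def
      by (cases "Suc j = j'") auto
    then show False
      using j' \<open>j < j'\<close> that(3) unfolding z_def by (auto split: if_splits)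
  qed
  have run: "a (z j + d) = a (z j) \<and> m (z j + d) = d" if "j < n" "z j + d < z (Suc j)" for j d
    using that(2)
  proof (induction d)
    case 0
    then show ?case
      using z_less[OF that(1)] by simp
  next
    case (Suc d)
    have "z (Suc j) \<le> L"
      using z_less[of "Suc j"] by (cases "Suc j < n") (auto simp: z_def)
    then have "Suc (z j + d) < L"
      using Suc.prems by simp
    moreover have "m (Suc (z j + d)) \<noteq> 0"
      using gap[OF that(1), of "Suc (z j + d)"] Suc.prems by simp
    ultimately show ?case
      using succ[of "z j + d"] Suc by (auto split: if_splits)
  qed
  have z0: "z 0 = 0"
  proof -
    have "0 \<in> set zs"
      using zs_set L m0 by simp
    then obtain j where j: "j < n" "zs ! j = 0"
      unfolding in_set_conv_nth n_def by auto
    then have "j = 0"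
      using sorted_wrt_nth_less[OF zs_sorted, of 0 j] unfolding n_def by (cases j) auto
    then show ?thesis
      using j unfolding z_def by auto
  qed
  have zn: "z n = L"
    unfolding z_def by simp
  have "traversal_word g b (map a zs)"
    unfolding traversal_word_def
  proof (intro exI[of _ "\<lambda>j. real (z j) / real L"] conjI allI impI ballI)
    show "real (z 0) / real L = 0"
      using z0 by simp
    show "real (z (length (map a zs))) / real L = 1"
      using zn L unfolding n_def by simp
    show "real (z j) / real L < real (z (Suc j)) / real L" if "j < length (map a zs)" for j
      using z_mono[of j] that L unfolding n_def by (simp add: divide_strict_right_mono)
    show "g (wcirc b (real (z j) / real L)) = 0" if "j \<le> length (map a zs)" for j
    proof (cases "j < n")
      case True
      then show ?thesis
        using g[of "z j" 0] z_less[of j] by simp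
    next
      case False
      then have "z j = L"
        unfolding z_def by simp
      have "real (m (L - 1)) + 1 = real (l (a (L - 1)))"
        using mL by linarith
      moreover have "real (L - 1) + 1 = real L"
        using L by linarith
      moreover have "real L > 0" "l (a (L - 1)) \<noteq> 0"
        using L mL by auto
      ultimately show ?thesis
        using g[of "L - 1" 1] L \<open>z j = L\<close> by simp
    qed
    show "g (wcirc b t) \<in> wcirc (map a zs ! j) ` {0<..<1}"
      if j: "j < length (map a zs)" and t: "t \<in> {real (z j) / real L<..<real (z (Suc j)) / real L}" for j t
    proof -
      have jn: "j < n"
        using j unfolding n_def by simp
      define \<tau> where "\<tau> = t * real L"
      have \<tau>: "real (z j) < \<tau>" "\<tau> < real (z (Suc j))"
        using t L unfolding \<tau>_def by (auto simp: field_simps)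
      define i where "i = nat \<lfloor>\<tau>\<rfloor>"
      have fl: "real i \<le> \<tau>" "\<tau> < real i + 1"
        using \<tau>(1) of_nat_0_le_iff[of "z j", where 'a = real] unfolding i_def by linarith+
      have i: "z j \<le> i" "i < z (Suc j)"
        using fl \<tau> by linarith+
      then have ai: "a i = a (z j)" "m i = i - z j"
        using run[OF jn, of "i - z j"] by auto
      have iL: "i < L"
        using i z_less[of "Suc j"] by (cases "Suc j < n") (auto simp: z_def)
      have "t = (real i + (\<tau> - real i)) / real L"
        using L unfolding \<tau>_def by simp
      then have gt: "g (wcirc b t) = wcirc (a (z j)) ((real (m i) + (\<tau> - real i)) / real (l (a i)))"
        using g[OF iL, of "\<tau> - real i"] fl ai(1) by simp
      have "0 < real (m i) + (\<tau> - real i)"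
        using ai(2) i \<tau>(1) by (simp add: of_nat_diff)
      moreover have "real (m i) + (\<tau> - real i) < real (l (a i))"
        using ml[OF iL] fl by linarith
      ultimately have "(real (m i) + (\<tau> - real i)) / real (l (a i)) \<in> {0<..<1}"
        by simp
      moreover have "map a zs ! j = a (z j)"
        using jn unfolding z_def n_def by simp
      ultimately show ?thesis
        using gt by simp
    qed
  qed
  then show ?thesis
    unfolding zs_def .
qed

subsection \<open>Cross-sections\<close>

text \<open>A continuous map from a compact space to a Hausdorff space is closed. Hence continuity
  on the flow space can be tested on \<open>K \<times> {0..1}\<close>, and continuity on a wedge on
  the flow space.\<close>

lemma continuous_on_quotient:
  fixes q :: "'a::t2_space \<Rightarrow> 'b::t2_space" and g :: "'b \<Rightarrow> 'c::topological_space"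
  assumes "compact S" "continuous_on S q" "q ` S = A" "continuous_on S (\<lambda>x. g (q x))"
  shows "continuous_on A g"
  unfolding continuous_on_closed_vimage[OF compact_imp_closed[OF compact_continuous_image[OF assms(2,1), unfolded assms(3)]]]
proof (intro allI impI)
  fix B :: "'c set" assume "closed B"
  then have "closedin (top_of_set S) (S \<inter> (\<lambda>x. g (q x)) -` B)"
    using assms(4) continuous_closedin_preimage by blast
  then have "compact (S \<inter> (\<lambda>x. g (q x)) -` B)"
    using assms(1) closedin_compact by blast
  moreover have "g -` B \<inter> A = q ` (S \<inter> (\<lambda>x. g (q x)) -` B)"
    using assms(3) by auto
  moreover have "continuous_on (S \<inter> (\<lambda>x. g (q x)) -` B) q"
    using assms(2) continuous_on_subset by blast
  ultimately show "closed (g -` B \<inter> A)"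
    by (metis compact_continuous_image compact_imp_closed)
qed

lemma continuous_on_locally:
  fixes g :: "'a::topological_space \<Rightarrow> 'b::topological_space"
  assumes "\<And>z. z \<in> S \<Longrightarrow> \<exists>V. openin (top_of_set S) V \<and> z \<in> V \<and> continuous_on V g"
  shows "continuous_on S g"
  unfolding continuous_openin_preimage_eq
proof (intro allI impI)
  fix B :: "'b set" assume B: "open B"
  show "openin (top_of_set S) (S \<inter> g -` B)"
  proof (subst openin_subopen, intro ballI)
    fix z assume z: "z \<in> S \<inter> g -` B"
    then obtain V where V: "openin (top_of_set S) V" "z \<in> V" "continuous_on V g"
      using assms by blast
    have "openin (top_of_set V) (V \<inter> g -` B)"
      using V(3) B unfolding continuous_openin_preimage_eq by blast
    then have "openin (top_of_set S) (V \<inter> g -` B)"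
      using V(1) openin_trans by blast
    then show "\<exists>U. openin (top_of_set S) U \<and> z \<in> U \<and> U \<subseteq> S \<inter> g -` B"
      using V(2) z openin_imp_subset[OF V(1)] by blast
  qed
qed

locale metric_flow =
  fixes A :: "'b::{metric_space,second_countable_topology} set" and \<phi> :: "real \<Rightarrow> 'b \<Rightarrow> 'b"
  assumes compact_A: "compact A"
    and cont: "continuous_on (UNIV \<times> A) (\<lambda>(t, x). \<phi> t x)"
    and flow_in: "x \<in> A \<Longrightarrow> \<phi> t x \<in> A"
    and flow_0: "x \<in> A \<Longrightarrow> \<phi> 0 x = x"
    and flow_add: "x \<in> A \<Longrightarrow> \<phi> (s + t) x = \<phi> s (\<phi> t x)"
begin

lemma cont_flow [continuous_intros]:
  assumes "continuous_on S f" "continuous_on S g" "g ` S \<subseteq> A"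
  shows "continuous_on S (\<lambda>z. \<phi> (f z) (g z))"
proof -
  have "continuous_on S ((\<lambda>(t, x). \<phi> t x) \<circ> (\<lambda>z. (f z, g z)))"
    using assms by (intro continuous_on_compose continuous_on_Pair continuous_on_subset[OF cont]) auto
  then show ?thesis
    by (simp add: o_def)
qed

lemma flow_minus: "x \<in> A \<Longrightarrow> \<phi> (- t) (\<phi> t x) = x" "x \<in> A \<Longrightarrow> \<phi> t (\<phi> (- t) x) = x"
  using flow_add[of x "- t" t] flow_add[of x t "- t"] flow_0 by simp_all

end

locale cross_section = metric_flow +
  fixes K :: "'b::{metric_space,second_countable_topology} set" and R :: "'b \<Rightarrow> real" and D :: "nat \<Rightarrow> 'b set" and x0 :: 'b
  assumes compact_K: "compact K" and K_sub: "K \<subseteq> A" and x0_in: "x0 \<in> K"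
    and R_cont: "continuous_on K R" and R_pos: "y \<in> K \<Longrightarrow> 0 < R y"
    and R_in: "y \<in> K \<Longrightarrow> \<phi> (R y) y \<in> K"
    and R_first: "y \<in> K \<Longrightarrow> 0 < t \<Longrightarrow> t < R y \<Longrightarrow> \<phi> t y \<notin> K"
    and covers: "x \<in> A \<Longrightarrow> \<exists>y\<in>K. \<exists>t. 0 \<le> t \<and> t < R y \<and> x = \<phi> t y"
    and D_lc: "locally_const K (\<lambda>x. x \<in> D n)"
    and D_sep: "x \<in> K \<Longrightarrow> y \<in> K \<Longrightarrow> x \<noteq> y \<Longrightarrow> \<exists>n. x \<in> D n \<longleftrightarrow> y \<notin> D n"
    and hits: "openin (top_of_set K) C \<Longrightarrow> x0 \<in> C \<Longrightarrow> x \<in> A \<Longrightarrow> \<exists>t>0. \<phi> t x \<in> C"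
begin

definition T :: "'b \<Rightarrow> 'b" where
  "T y = \<phi> (R y) y"

definition T' :: "'b \<Rightarrow> 'b" where
  "T' = inv_into K T"

text \<open>\<open>q y\<close> runs through the orbit segment from \<open>y\<close> to \<open>T y\<close> as the parameter runs from 0 to 1.\<close>

definition q :: "'b \<Rightarrow> real \<Rightarrow> 'b" where
  "q y u = \<phi> (u * R y) y"

lemma in_A: "y \<in> K \<Longrightarrow> y \<in> A"
  using K_sub by blast

lemma R_lower: "\<exists>c>0. \<forall>y\<in>K. c \<le> R y"
proof -
  obtain y where "y \<in> K" "\<forall>z\<in>K. R y \<le> R z"
    using continuous_attains_inf[OF compact_K _ R_cont] x0_in by blast
  then show ?thesis
    using R_pos by blast
qed

lemma q_in: "y \<in> K \<Longrightarrow> q y u \<in> A"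
  unfolding q_def using in_A flow_in by blast

lemma q_0: "y \<in> K \<Longrightarrow> q y 0 = y"
  unfolding q_def using in_A flow_0 by simp

lemma q_1: "q y 1 = T y"
  unfolding q_def T_def by simp

lemma q_flow: "y \<in> K \<Longrightarrow> \<phi> v (q y u) = q y (u + v / R y)"
  unfolding q_def using flow_add[of y v "u * R y"] in_A R_pos[of y]
  by (simp add: distrib_right add.commute)

lemma cover_q: "x \<in> A \<Longrightarrow> \<exists>y\<in>K. \<exists>u. 0 \<le> u \<and> u < 1 \<and> x = q y u"
proof -
  assume "x \<in> A"
  then obtain y t where y: "y \<in> K" "0 \<le> t" "t < R y" "x = \<phi> t y"
    using covers by blast
  then have "0 \<le> t / R y \<and> t / R y < 1 \<and> x = q y (t / R y)"
    using R_pos[of y] unfolding q_def by simp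
  then show ?thesis
    using y(1) by blast
qed

text \<open>Flowing back by \<open>s\<close> would otherwise show \<open>z\<close> visiting
  \<open>K\<close> at time \<open>t - s\<close>, earlier than its first return.\<close>

lemma q_unique_le:
  assumes "y \<in> K" "z \<in> K" "0 \<le> s" "s \<le> t" "t < R z" "\<phi> s y = \<phi> t z"
  shows "y = z \<and> s = t"
proof -
  have "y = \<phi> (t - s) z"
    using flow_add[of z "- s" t] flow_minus(1)[of y s] assms in_A by simp
  moreover have "t - s < R z"
    using assms by linarith
  ultimately have "\<not> 0 < t - s"
    using R_first[of z "t - s"] assms(1,2) by metis
  then have "s = t"
    using assms(4) by linarith
  then show ?thesis
    using \<open>y = \<phi> (t - s) z\<close> flow_0 in_A assms by simp
qed

lemma q_unique:
  assumes "y \<in> K" "z \<in> K" "0 \<le> u" "u < 1" "0 \<le> v" "v < 1" "q y u = q z v"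
  shows "y = z \<and> u = v"
proof -
  have R: "0 < R y" "0 < R z"
    using R_pos assms by auto
  have b: "0 \<le> u * R y" "u * R y < R y" "0 \<le> v * R z" "v * R z < R z"
    using R assms(3-6) by simp_all
  have "y = z \<and> u * R y = v * R z"
  proof (cases "u * R y \<le> v * R z")
    case True
    then show ?thesis
      by (rule q_unique_le[OF assms(1,2) b(1) _ b(4) assms(7)[unfolded q_def]])
  next
    case False
    then have "v * R z \<le> u * R y"
      by simp
    then have "z = y \<and> v * R z = u * R y"
      by (rule q_unique_le[OF assms(2,1) b(3) _ b(2) assms(7)[unfolded q_def, symmetric]])
    then show ?thesis
      by metis
  qed
  then show ?thesis
    using R by (metis mult_right_cancel less_irrefl)
qed

lemma T_in: "y \<in> K \<Longrightarrow> T y \<in> K"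
  unfolding T_def by (rule R_in)

lemma T_inj: "inj_on T K"
proof -
  have *: "y = z" if "y \<in> K" "z \<in> K" "T y = T z" "R y \<le> R z" for y z
  proof -
    have "y = \<phi> (R z - R y) z"
      using flow_add[of z "- R y" "R z"] flow_minus(1)[of y "R y"] that in_A
      unfolding T_def by simp
    moreover have "R z - R y < R z"
      using R_pos[of y] that by simp
    ultimately have "\<not> 0 < R z - R y"
      using R_first[of z "R z - R y"] that(1,2) by metis
    then have "R z - R y = 0"
      using that(4) by linarith
    then show "y = z"
      using \<open>y = \<phi> (R z - R y) z\<close> that flow_0 in_A by metis
  qed
  show ?thesis
    by (rule inj_onI) (metis * linear)
qed

text \<open>Flow \<open>z\<close> back by half of a lower bound \<open>c\<close> for the return
  times. The section point \<open>y\<close> behind that position returns no later than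
  \<open>z\<close> is reached, and the time then left is below \<open>c\<close>, too short for
  another visit; so its return is \<open>z\<close>.\<close>

lemma T_surj: "T ` K = K"
proof
  show "T ` K \<subseteq> K"
    using T_in by blast
  show "K \<subseteq> T ` K"
  proof
    fix z assume z: "z \<in> K"
    obtain c where c: "c > 0" "\<forall>y\<in>K. c \<le> R y"
      using R_lower by blast
    obtain y t where y: "y \<in> K" "0 \<le> t" "t < R y" "\<phi> (- (c / 2)) z = \<phi> t y"
      using covers[OF flow_in[OF in_A[OF z]]] by metis
    have zt: "z = \<phi> (t + c / 2) y"
      using flow_add[of y "c / 2" t] flow_minus(2)[of z "c / 2"] y in_A z by (simp add: add.commute)
    have "R y \<le> t + c / 2"
      using R_first[of y "t + c / 2"] z zt y c by force
    have "z = \<phi> (t + c / 2 - R y) (T y)"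
      using zt flow_add[of y "t + c / 2 - R y" "R y"] in_A y unfolding T_def by simp
    moreover from this have "\<not> 0 < t + c / 2 - R y"
      using R_first[OF T_in[OF y(1)], of "t + c / 2 - R y"] z y c T_in[OF y(1)] by force
    ultimately have "z = T y"
      using flow_0 \<open>R y \<le> t + c / 2\<close> T_in[OF y(1)] in_A by simp
    then show "z \<in> T ` K"
      using y(1) by blast
  qed
qed

lemma cont_T: "continuous_on K T"
  unfolding T_def using K_sub by (intro continuous_intros R_cont) auto

lemma cont_q: "continuous_on (K \<times> {0..1}) (\<lambda>(y, u). q y u)"
proof -
  have "continuous_on (K \<times> {0..1}) (\<lambda>z. R (fst z))"
    by (rule continuous_on_compose2[OF R_cont]) (auto intro: continuous_intros)
  then show ?thesis
    unfolding q_def case_prod_beta using K_sub by (intro continuous_intros) auto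
qed

lemma surj_q: "(\<lambda>(y, u). q y u) ` (K \<times> {0..1}) = A"
  using q_in cover_q by (fastforce simp: image_iff)

text \<open>Return times are at least some \<open>c > 0\<close>, so removing one return at a time
  exhausts \<open>t\<close> after finitely many steps.\<close>

lemma flow_return:
  assumes "y \<in> K" "0 < t" "\<phi> t y \<in> K"
  shows "\<exists>n\<ge>1. (T ^^ n) y = \<phi> t y"
proof -
  obtain c where c: "c > 0" "\<forall>y\<in>K. c \<le> R y"
    using R_lower by blast
  obtain N :: nat where "t < real N * c"
    using c(1) reals_Archimedean3 by blast
  then show ?thesis
    using assms
  proof (induction N arbitrary: y t)
    case 0
    then show ?case
      by simp
  next
    case (Suc N)
    have "R y \<le> t"
      using R_first[of y t] Suc.prems by force
    show ?case
    proof (cases "t = R y")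
      case True
      then show ?thesis
        by (intro exI[of _ 1]) (simp add: T_def)
    next
      case False
      have eq: "\<phi> (t - R y) (T y) = \<phi> t y"
        using flow_add[of y "t - R y" "R y"] in_A Suc.prems unfolding T_def by simp
      have "c \<le> R y"
        using c Suc.prems by blast
      then have "t - R y < real N * c"
        using Suc.prems(1) by (simp add: algebra_simps)
      then obtain n where "n \<ge> 1" "(T ^^ n) (T y) = \<phi> t y"
        using Suc.IH[of "t - R y" "T y"] T_in Suc.prems eq False \<open>R y \<le> t\<close> by auto
      then show ?thesis
        by (intro exI[of _ "Suc n"]) (simp add: funpow_swap1)
    qed
  qed
qed

lemma clopen_dynamics: "clopen_dynamics K T T' D x0"
proof
  show "compact K" "continuous_on K T" "x0 \<in> K" "\<And>n. locally_const K (\<lambda>x. x \<in> D n)"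
    by (rule compact_K cont_T x0_in D_lc)+
  show "\<And>x. x \<in> K \<Longrightarrow> T x \<in> K"
    by (rule T_in)
  show "\<And>x. x \<in> K \<Longrightarrow> T' x \<in> K"
    unfolding T'_def using inv_into_into[of _ T K] T_surj by simp
  show "\<And>x. x \<in> K \<Longrightarrow> T' (T x) = x"
    unfolding T'_def using T_inj by simp
  show "\<And>x. x \<in> K \<Longrightarrow> T (T' x) = x"
    unfolding T'_def using T_surj by (simp add: f_inv_into_f)
  show "continuous_on K T'"
  proof (rule continuous_on_eq)
    show "continuous_on K (the_inv_into K T)"
      using continuous_on_inv_into[OF cont_T compact_K T_inj] T_surj by simp
    show "the_inv_into K T x = T' x" if "x \<in> K" for x
      unfolding T'_def using that T_inj T_surj by (metis f_inv_into_f inv_into_into the_inv_into_f_f)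
  qed
  show "\<And>x y. x \<in> K \<Longrightarrow> y \<in> K \<Longrightarrow> x \<noteq> y \<Longrightarrow> \<exists>n. (x \<in> D n) = (y \<notin> D n)"
    by (rule D_sep)
  show "\<exists>n\<ge>1. (T ^^ n) x \<in> C" if C: "openin (top_of_set K) C" "x0 \<in> C" and x: "x \<in> K" for C x
  proof -
    obtain t where "t > 0" "\<phi> t x \<in> C"
      using hits[OF C in_A[OF x]] by blast
    then show ?thesis
      using flow_return[OF x, of t] openin_imp_subset[OF C(1)] by force
  qed
qed

sublocale clopen_dynamics K T T' D x0
  by (rule clopen_dynamics)

text \<open>The choice is unique by \<open>q_unique\<close>. Circle \<open>j\<close> is cut into \<open>l j\<close> equal arcs, one for each floor of
  tower \<open>j\<close>; with all arcs parametrised by \<open>u\<close>, the projection of a tower factors through that of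
  any refinement.\<close>

definition proj :: "(nat \<Rightarrow> nat) \<Rightarrow> ('b \<Rightarrow> nat) \<Rightarrow> ('b \<Rightarrow> nat) \<Rightarrow> 'b \<Rightarrow> complex" where
  "proj l J M x = (let (y, u) = (SOME (y, u). y \<in> K \<and> 0 \<le> u \<and> u < 1 \<and> x = q y u)
     in wcirc (J y) ((real (M y) + u) / real (l (J y))))"

lemma proj_q_less:
  assumes "y \<in> K" "0 \<le> u" "u < 1"
  shows "proj l J M (q y u) = wcirc (J y) ((real (M y) + u) / real (l (J y)))"
proof -
  have "(SOME (z, v). z \<in> K \<and> 0 \<le> v \<and> v < 1 \<and> q y u = q z v) = (y, u)"
    by (rule some_equality) (use assms q_unique in auto)
  then show ?thesis
    unfolding proj_def by simp
qed

text \<open>At \<open>u = 1\<close> the value is computed at \<open>T y\<close>, yet the formula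
  persists: the end of an arc is the start of the next one, and the end of a top arc is the wedge
  point. The closed parameter range makes the domain compact in \<open>cont_proj\<close>.\<close>

lemma proj_q:
  assumes tw: "tower k l J M" and "y \<in> K" "0 \<le> u" "u \<le> 1"
  shows "proj l J M (q y u) = wcirc (J y) ((real (M y) + u) / real (l (J y)))"
proof (cases "u = 1")
  case True
  have "proj l J M (q y u) = wcirc (J (T y)) (real (M (T y)) / real (l (J (T y))))"
    using proj_q_less[OF T_in[OF assms(2)], of 0] q_0 T_in[OF assms(2)] True q_1 by simp
  moreover have ml: "M y < l (J y)"
    "if M y + 1 < l (J y) then J (T y) = J y \<and> M (T y) = M y + 1 else M (T y) = 0"
    using tw assms(2) unfolding tower_def by auto
  ultimately have eq: "proj l J M (q y u) = (if M y + 1 < l (J y)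
      then wcirc (J y) (real (M y + 1) / real (l (J y))) else 0)"
    by (auto split: if_splits)
  show ?thesis
  proof (cases "M y + 1 < l (J y)")
    case False
    then have "real (M y) + u = real (l (J y))" "l (J y) \<noteq> 0"
      using ml(1) True by linarith+
    then show ?thesis
      using eq False by simp
  qed (use eq \<open>u = 1\<close> in \<open>simp add: add.commute\<close>)
next
  case False
  then show ?thesis
    using proj_q_less assms by simp
qed

lemma floor_param_bounds:
  fixes m l :: nat
  assumes "m < l" "0 \<le> u" "u < 1"
  shows "0 \<le> (real m + u) / real l" "(real m + u) / real l < 1"
  using assms by (auto simp: field_simps)

lemma proj_eq_0_iff:
  assumes "tower k l J M" "y \<in> K" "0 \<le> u" "u < 1"
  shows "proj l J M (q y u) = 0 \<longleftrightarrow> M y = 0 \<and> u = 0"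
proof -
  have ml: "M y < l (J y)"
    using assms unfolding tower_def by blast
  let ?s = "(real (M y) + u) / real (l (J y))"
  have "0 \<le> ?s" "?s < 1"
    by (rule floor_param_bounds[OF ml assms(3,4)])+
  then have "wcirc (J y) ?s = 0 \<longleftrightarrow> ?s = 0"
    using not_Ints_between_0_1[of ?s] unfolding wcirc_eq_0_iff by (metis Ints_0 order_le_less)
  then show ?thesis
    using proj_q_less[OF assms(2-4)] ml assms(3) by auto
qed

lemma proj_eqD:
  assumes "tower k l J M" "y \<in> K" "0 \<le> u" "u < 1" "z \<in> K" "0 \<le> v" "v < 1"
    and eq: "proj l J M (q y u) = proj l J M (q z v)" and nz: "proj l J M (q y u) \<noteq> 0"
  shows "J y = J z \<and> M y = M z \<and> u = v"
proof -
  have ml: "M y < l (J y)" "M z < l (J z)"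
    using assms unfolding tower_def by blast+
  let ?s = "(real (M y) + u) / real (l (J y))" and ?t = "(real (M z) + v) / real (l (J z))"
  have eq': "wcirc (J y) ?s = wcirc (J z) ?t" "wcirc (J y) ?s \<noteq> 0"
    using eq nz proj_q_less[OF assms(2-4)] proj_q_less[OF assms(5-7)] by auto
  then have J: "J y = J z"
    using wcirc_eq_same_circle by blast
  have "?s = ?t"
    using wcirc_eq_diff_Ints[OF eq'(1)] real_Ints_diff_less_1[of ?s ?t]
      floor_param_bounds[OF ml(1) assms(3,4)] floor_param_bounds[OF ml(2) assms(6,7)] by auto
  then have "real (M y) + u = real (M z) + v"
    using J ml by simp
  then have "M y = M z"
    using assms(3,4,6,7) by linarith
  then show ?thesis
    using J \<open>real (M y) + u = real (M z) + v\<close> by simp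
qed

lemma cont_proj:
  assumes "tower k l J M"
  shows "continuous_on A (proj l J M)"
proof (rule continuous_on_quotient[OF _ cont_q surj_q])
  show "compact (K \<times> {0..1::real})"
    by (intro compact_Times compact_K) simp
  have "continuous_on (K \<times> {0..1}) (\<lambda>z. wcirc (J (fst z)) ((real (M (fst z)) + snd z) / real (l (J (fst z)))))"
    (is "continuous_on _ ?g")
  proof (rule continuous_on_locally)
    fix z :: "'b \<times> real" assume z: "z \<in> K \<times> {0..1}"
    have lc: "locally_const K (\<lambda>y. (J y, M y))"
      using assms locally_const_apply2[of K J M Pair] unfolding tower_def by blast
    obtain U where U: "openin (top_of_set K) U" "fst z \<in> U" "\<And>y. y \<in> U \<Longrightarrow> (J y, M y) = (J (fst z), M (fst z))"
      using locally_constE[OF lc, of "fst z"] z by (metis mem_Times_iff)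
    have "continuous_on (U \<times> {0..1}) (\<lambda>w. wcirc (J (fst z)) ((real (M (fst z)) + snd w) / real (l (J (fst z)))))"
      by (cases "l (J (fst z)) = 0") (auto intro!: continuous_intros)
    then have "continuous_on (U \<times> {0..1}) ?g"
      by (rule continuous_on_eq) (use U(3) in auto)
    moreover have "openin (top_of_set (K \<times> {0..1})) (U \<times> {0..1})"
      by (intro openin_Times U(1) openin_subtopology_self)
    ultimately show "\<exists>V. openin (top_of_set (K \<times> {0..1})) V \<and> z \<in> V \<and> continuous_on V ?g"
      using U(2) z by (intro exI[of _ "U \<times> {0..1}"]) (auto simp: mem_Times_iff)
  qed
  then show "continuous_on (K \<times> {0..1}) (\<lambda>z. proj l J M (case z of (y, u) \<Rightarrow> q y u))"
    by (rule continuous_on_eq) (auto simp: proj_q[OF assms])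
qed

end

subsection \<open>Expansions from refining towers\<close>

context clopen_dynamics
begin

lemma tower_climb:
  assumes tw: "tower k l J M" and y: "y \<in> K" "M y = 0"
  shows "i < l (J y) \<Longrightarrow> J ((T ^^ i) y) = J y \<and> M ((T ^^ i) y) = i" and "M ((T ^^ l (J y)) y) = 0"
proof -
  have step: "if M x + 1 < l (J x) then J (T x) = J x \<and> M (T x) = M x + 1 else M (T x) = 0"
    if "x \<in> K" for x
    using tw that unfolding tower_def by blast
  show *: "J ((T ^^ i) y) = J y \<and> M ((T ^^ i) y) = i" if "i < l (J y)" for i
    using that
  proof (induction i)
    case (Suc i)
    then show ?case
      using step[OF Tn_in[OF y(1), of i]] by simp
  qed (simp add: y)
  have "M y < l (J y)"
    using tw y(1) unfolding tower_def by blast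
  then obtain h where h: "l (J y) = Suc h"
    by (cases "l (J y)") auto
  then show "M ((T ^^ l (J y)) y) = 0"
    using step[OF Tn_in[OF y(1), of h]] *[of h] by simp
qed

text \<open>The first clause, iterated over the levels, separates points. The second provides common
  first and last letters and draws the bases to \<open>x0\<close>. The third, in which
  \<open>l (J x0)\<close> is the height of the old tower based at \<open>x0\<close>, ensures a
  second letter.\<close>

definition refines :: "nat \<Rightarrow> (nat \<Rightarrow> nat) \<Rightarrow> ('b \<Rightarrow> nat) \<Rightarrow> ('b \<Rightarrow> nat) \<Rightarrow> ('b \<Rightarrow> nat) \<Rightarrow> ('b \<Rightarrow> nat) \<Rightarrow> bool" where
  "refines n l J M J' M' \<longleftrightarrow>
    (\<forall>x\<in>K. \<forall>y\<in>K. J' x = J' y \<and> M' x = M' y \<longrightarrow> J x = J y \<and> M x = M y \<and> (x \<in> D n \<longleftrightarrow> y \<in> D n)) \<and>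
    (\<forall>x\<in>K. M' x = 0 \<longrightarrow> M x = 0 \<and> J x = J x0 \<and> J (T' x) = J (T' x0) \<and> (x \<in> D n \<longleftrightarrow> x0 \<in> D n)) \<and>
    ((T ^^ l (J x0)) x0 \<noteq> x0 \<longrightarrow> (\<forall>x\<in>K. M' x = 0 \<longrightarrow> M' ((T ^^ l (J x0)) x) \<noteq> 0))"

text \<open>Level 0 consists of one tower of height one, so its wedge is a single circle and every
  word over it repeats the letter 0, as the degenerate case requires.\<close>

lemma tower_sequence:
  "\<exists>k l J M. (\<forall>n. tower (k n) (l n) (J n) (M n)) \<and>
     (\<forall>n. refines n (l n) (J n) (M n) (J (Suc n)) (M (Suc n))) \<and>
     k 0 = 1 \<and> l 0 = (\<lambda>_. 1) \<and> J 0 = (\<lambda>_. 0) \<and> M 0 = (\<lambda>_. 0)"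
proof -
  define P :: "nat \<Rightarrow> nat \<times> (nat \<Rightarrow> nat) \<times> ('b \<Rightarrow> nat) \<times> ('b \<Rightarrow> nat) \<Rightarrow> bool" where
    "P n c \<longleftrightarrow> (case c of (k, l, J, M) \<Rightarrow> tower k l J M) \<and>
       (n = 0 \<longrightarrow> c = (1, \<lambda>_. 1, \<lambda>_. 0, \<lambda>_. 0))" for n c
  define Q :: "nat \<Rightarrow> nat \<times> (nat \<Rightarrow> nat) \<times> ('b \<Rightarrow> nat) \<times> ('b \<Rightarrow> nat) \<Rightarrow>
      nat \<times> (nat \<Rightarrow> nat) \<times> ('b \<Rightarrow> nat) \<times> ('b \<Rightarrow> nat) \<Rightarrow> bool" where
    "Q n c c' \<longleftrightarrow> (case (c, c') of ((k, l, J, M), (k', l', J', M')) \<Rightarrow> refines n l J M J' M')" for n c c'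
  have "tower 1 (\<lambda>_. 1) (\<lambda>_. 0) (\<lambda>_. 0)"
    unfolding tower_def using x0_in by auto
  then have "P 0 (1, \<lambda>_. 1, \<lambda>_. 0, \<lambda>_. 0)"
    unfolding P_def by simp
  moreover have "\<exists>c'. P (Suc n) c' \<and> Q n c c'" if "P n c" for n c
  proof -
    obtain k l J M where c: "c = (k, l, J, M)"
      by (cases c)
    then have "tower k l J M"
      using that unfolding P_def by simp
    from tower_refine[OF this, of n, folded refines_def] obtain k' l' J' M' where
      "tower k' l' J' M'" "refines n l J M J' M'"
      by (elim exE conjE) (rule that)
    then show ?thesis
      unfolding P_def Q_def c by (intro exI[of _ "(k', l', J', M')"]) simp
  qed
  ultimately obtain c where c: "\<And>n. P n (c n) \<and> Q n (c n) (c (Suc n))"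
    using dependent_nat_choice[of P Q] by blast
  show ?thesis
  proof (intro exI conjI allI)
    show "tower (fst (c n)) (fst (snd (c n))) (fst (snd (snd (c n)))) (snd (snd (snd (c n))))" for n
      using c[of n] unfolding P_def by (simp add: case_prod_beta)
    show "refines n (fst (snd (c n))) (fst (snd (snd (c n)))) (snd (snd (snd (c n))))
        (fst (snd (snd (c (Suc n))))) (snd (snd (snd (c (Suc n)))))" for n
      using c[of n] unfolding Q_def by (simp add: case_prod_beta)
  qed (use c[of 0] in \<open>simp_all add: P_def\<close>)
qed

end

text \<open>Letters change only at indices that the filter keeps, so the last kept letter is still
  in force at the final index.\<close>

lemma last_map_filter_run:
  fixes a m :: "nat \<Rightarrow> nat"
  assumes "m 0 = 0" "\<And>i. Suc i < L \<Longrightarrow> m (Suc i) \<noteq> 0 \<Longrightarrow> a (Suc i) = a i" "0 < L"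
  shows "filter (\<lambda>i. m i = 0) [0..<L] \<noteq> [] \<and> last (map a (filter (\<lambda>i. m i = 0) [0..<L])) = a (L - 1)"
  using assms(2,3)
proof (induction L)
  case (Suc L)
  show ?case
  proof (cases "L = 0")
    case False
    then have "filter (\<lambda>i. m i = 0) [0..<L] \<noteq> [] \<and> last (map a (filter (\<lambda>i. m i = 0) [0..<L])) = a (L - 1)"
      using Suc by simp
    moreover have "m L = 0 \<or> a L = a (L - 1)"
      using Suc.prems(1)[of "L - 1"] False by auto
    ultimately show ?thesis
      by auto
  qed (simp add: assms(1))
qed simp

text \<open>The two kept indices \<open>0\<close> and \<open>r\<close> make the first and the last
  letter distinct occurrences, as a proper word demands.\<close>

lemma word_split:
  assumes "P 0" "P r" "0 < r" "r < L"
  shows "\<exists>v. map a (filter P [0..<L]) = a 0 # v @ [last (map a (filter P [0..<L]))]"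
proof -
  have "[0..<L] = 0 # [1..<L]"
    using assms by (simp add: upt_conv_Cons)
  then have eq: "map a (filter P [0..<L]) = a 0 # map a (filter P [1..<L])"
    using assms by simp
  have "r \<in> set (filter P [1..<L])"
    using assms by simp
  then have "map a (filter P [1..<L]) \<noteq> []"
    by (metis emptyE list.map_disc_iff list.set(1))
  then show ?thesis
    unfolding eq using append_butlast_last_id[of "map a (filter P [1..<L])"]
    by (intro exI[of _ "butlast (map a (filter P [1..<L]))"]) simp
qed

section \<open>Projections along orbits and bonding maps\<close>

context cross_section
begin

lemma flow_lifted:
  assumes tw: "tower k l J M" and "x \<in> A"
  shows "lifted_at k (\<lambda>t. proj l J M (\<phi> t x)) 0"
proof -
  obtain y u where y: "y \<in> K" and u: "0 \<le> u" "u < 1" and x: "x = q y u"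
    using cover_q assms by blast
  have fl: "J z < k" "M z < l (J z)" if "z \<in> K" for z
    using tw that unfolding tower_def by auto
  show ?thesis
  proof (cases "u = 0")
    case False
    show ?thesis
    proof (rule lifted_at_interior[of "R y" "min u (1 - u) * R y" "J y" k "l (J y)" _ _ "M y" u])
      show "0 < R y" "0 < min u (1 - u) * R y" "J y < k" "0 < l (J y)"
        using R_pos[OF y] u False fl[OF y] by auto
      fix v assume v: "\<bar>v\<bar> < min u (1 - u) * R y"
      have "\<bar>v / R y\<bar> < min u (1 - u)"
        using v R_pos[OF y] by (simp add: abs_divide pos_divide_less_eq del: min_less_iff_conj)
      then have "0 \<le> u + v / R y" "u + v / R y \<le> 1"
        by linarith+
      then show "proj l J M (\<phi> (0 + v) x) = wcirc (J y) ((real (M y) + (u + v / R y)) / real (l (J y)))"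
        unfolding x using proj_q[OF tw y] q_flow[OF y] by simp
    qed
  next
    case True
    \<comment> \<open>At a point of the section the immediate past of the orbit lies on the segment
      over the preceding point, so two floors meet here.\<close>
    define z where "z = T' y"
    have z: "z \<in> K" "T z = y"
      unfolding z_def using T'_in[OF y] TT'[OF y] by auto
    show ?thesis
    proof (rule lifted_at_junction[of "R z" "R y" "J z" k "J y" "M z" l "M y"])
      show "0 < R z" "0 < R y" "J z < k" "J y < k" "M z < l (J z)" "M y < l (J y)"
        using R_pos y z fl by auto
      show "if M z + 1 < l (J z) then J y = J z \<and> M y = M z + 1 else M y = 0"
        using tw z unfolding tower_def by metis
      fix v :: real
      assume v: "0 \<le> v"
      show "proj l J M (\<phi> (0 + v) x) = wcirc (J y) ((real (M y) + v / R y) / real (l (J y)))" if "v < R y"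
        unfolding x using proj_q[OF tw y, of "v / R y"] q_flow[OF y, of v u] True v that R_pos[OF y] by simp
      have "\<phi> (0 - v) x = q z (1 - v / R z)"
        unfolding x using True q_0[OF y] q_1[of z] q_flow[OF z(1), of "- v" 1] z by simp
      then show "proj l J M (\<phi> (0 - v) x) = wcirc (J z) ((real (M z) + (1 - v / R z)) / real (l (J z)))"
        if "v < R z"
        using proj_q[OF tw z(1), of "1 - v / R z"] v that R_pos[OF z(1)] by simp
    qed
  qed
qed

lemma circle_param:
  fixes l :: nat
  assumes "0 < l" "0 \<le> s" "s < 1"
  obtains i u where "i < l" "0 \<le> u" "u < 1" "s = (real i + u) / real l"
proof
  let ?i = "nat \<lfloor>s * real l\<rfloor>"
  have nn: "0 \<le> s * real l"
    using assms by simp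
  then have fl: "real ?i \<le> s * real l" "s * real l < real ?i + 1"
    by linarith+
  have "s * real l < real l"
    using assms by simp
  then show "?i < l"
    using fl by linarith
  show "0 \<le> s * real l - real ?i" "s * real l - real ?i < 1"
    using fl by linarith+
  show "s = (real ?i + (s * real l - real ?i)) / real l"
    using assms by simp
qed

lemma proj_surj:
  assumes tw: "tower k l J M"
  shows "proj l J M ` A = wedge k"
proof
  show "proj l J M ` A \<subseteq> wedge k"
  proof
    fix z assume "z \<in> proj l J M ` A"
    then obtain y u where "y \<in> K" "0 \<le> u" "u < 1" "z = proj l J M (q y u)"
      using cover_q by blast
    then show "z \<in> wedge k"
      using proj_q_less wcirc_in_wedge tw unfolding tower_def by metis
  qed
  show "wedge k \<subseteq> proj l J M ` A"
  proof
    fix z assume "z \<in> wedge k"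
    then obtain b s where b: "b < k" "0 \<le> s" "s < 1" "z = wcirc b s"
      by (rule wedge_cases)
    then obtain y where y: "y \<in> K" "J y = b" "M y = 0"
      using tw unfolding tower_def by blast
    then have "0 < l b"
      using tw unfolding tower_def by force
    then obtain i u where i: "i < l b" "0 \<le> u" "u < 1" "s = (real i + u) / real (l b)"
      using circle_param b by blast
    then have "z = proj l J M (q ((T ^^ i) y) u)"
      using proj_q_less[OF Tn_in[OF y(1)], of u l J M i] tower_climb(1)[OF tw y(1,3), of i] b y by simp
    then show "z \<in> proj l J M ` A"
      using q_in[OF Tn_in[OF y(1)]] by blast
  qed
qed

lemma projection_proj:
  assumes tw: "tower k l J M"
  shows "projection (top_of_set A) \<phi> k (proj l J M)"
  unfolding projection_def
proof (intro conjI ballI impI)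
  show "continuous_map (top_of_set A) (W k) (proj l J M)"
    using cont_proj[OF tw] proj_surj[OF tw] by (auto simp: continuous_map_in_subtopology)
  show "proj l J M ` topspace (top_of_set A) = wedge k"
    using proj_surj[OF tw] by simp
  fix x assume "x \<in> topspace (top_of_set A)"
  then have x: "x \<in> A"
    by simp
  show "\<exists>e>0. inj_on (\<lambda>t. proj l J M (\<phi> t x)) {- e<..<e}"
    using lifted_at_inj[OF flow_lifted[OF tw x]] by simp
  assume "proj l J M x \<noteq> 0"
  then show "\<exists>a<k. \<exists>e>0. \<exists>h. strict_mono_on {- e<..<e} h \<and>
      (\<forall>t\<in>{- e<..<e}. proj l J M (\<phi> t x) = wcirc a (h t))"
    using lifted_at_mono[OF flow_lifted[OF tw x]] flow_0[OF x] by simp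
qed

text \<open>The two towers need not be consecutive, so the single bonding maps and their composites
  down to level 0 are treated alike.\<close>

context
  fixes k k' :: nat and l l' :: "nat \<Rightarrow> nat" and J J' M M' :: "'b \<Rightarrow> nat" and g :: "complex \<Rightarrow> complex"
  assumes tw: "tower k l J M" and tw': "tower k' l' J' M'"
    and ref: "\<And>x. x \<in> K \<Longrightarrow> M' x = 0 \<Longrightarrow> M x = 0"
    and g: "\<And>x. x \<in> A \<Longrightarrow> g (proj l' J' M' x) = proj l J M x"
begin

lemma floors_formula:
  assumes "y \<in> K" "M' y = 0" "i < l' (J' y)" "0 \<le> u" "u \<le> 1"
  shows "g (wcirc (J' y) ((real i + u) / real (l' (J' y)))) =
    wcirc (J ((T ^^ i) y)) ((real (M ((T ^^ i) y)) + u) / real (l (J ((T ^^ i) y))))"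
  using g[OF q_in[OF Tn_in[OF assms(1)]], of i u] proj_q[OF tw' Tn_in[OF assms(1)], of u i]
    proj_q[OF tw Tn_in[OF assms(1)], of u i] tower_climb(1)[OF tw' assms(1-3)] assms by simp

lemma column_succ:
  assumes "y \<in> K"
  shows "if M ((T ^^ i) y) + 1 < l (J ((T ^^ i) y))
    then J ((T ^^ Suc i) y) = J ((T ^^ i) y) \<and> M ((T ^^ Suc i) y) = M ((T ^^ i) y) + 1
    else M ((T ^^ Suc i) y) = 0"
  using tw Tn_in[OF assms, of i] unfolding tower_def by simp

lemma column_below: "y \<in> K \<Longrightarrow> J ((T ^^ i) y) < k \<and> M ((T ^^ i) y) < l (J ((T ^^ i) y))"
  using tw Tn_in[of y i] unfolding tower_def by blast

lemma height_pos: "y \<in> K \<Longrightarrow> 0 < l' (J' y)"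
  using tw' unfolding tower_def by force

text \<open>Moving up the column over \<open>y\<close> runs once around circle \<open>J' y\<close>.
  The coarser projection sees the same points floor by floor, and a new letter begins whenever the
  column enters an old base.\<close>

lemma sym_rep_column:
  assumes y: "y \<in> K" "M' y = 0"
  shows "sym_rep g (J' y) = map (\<lambda>i. J ((T ^^ i) y)) (filter (\<lambda>i. M ((T ^^ i) y) = 0) [0..<l' (J' y)])"
proof (rule sym_rep_eq, rule traversal_word_floors)
  let ?L = "l' (J' y)"
  show "g (wcirc (J' y) ((real i + u) / real ?L)) =
      wcirc (J ((T ^^ i) y)) ((real (M ((T ^^ i) y)) + u) / real (l (J ((T ^^ i) y))))"
    if "i < ?L" "0 \<le> u" "u \<le> 1" for i u
    by (rule floors_formula[OF y that])
  show "M ((T ^^ i) y) < l (J ((T ^^ i) y))" for i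
    using column_below[OF y(1)] by blast
  show "0 < ?L"
    by (rule height_pos[OF y(1)])
  show "M ((T ^^ 0) y) = 0"
    using ref y by simp
  \<comment> \<open>The column ends on a new base, which lies in an old one; hence its last floor is
    an old top floor and the last letter is completed.\<close>
  have "M ((T ^^ Suc (?L - 1)) y) = 0"
    using tower_climb(2)[OF tw' y] ref Tn_in[OF y(1)] height_pos[OF y(1)] by simp
  then show "M ((T ^^ (?L - 1)) y) + 1 = l (J ((T ^^ (?L - 1)) y))"
    using column_succ[OF y(1), of "?L - 1"] column_below[OF y(1), of "?L - 1"]
    by (auto split: if_splits)
  show "if M ((T ^^ i) y) + 1 < l (J ((T ^^ i) y))
    then J ((T ^^ Suc i) y) = J ((T ^^ i) y) \<and> M ((T ^^ Suc i) y) = M ((T ^^ i) y) + 1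
    else M ((T ^^ Suc i) y) = 0" for i
    by (rule column_succ[OF y(1)])
qed

lemma circle_lifted:
  assumes "b < k'" "0 < s" "s < 1"
  shows "lifted_at k (\<lambda>s. g (wcirc b s)) s"
proof -
  obtain y where y: "y \<in> K" "M' y = 0" and b: "J' y = b"
    using tw' assms(1) unfolding tower_def by blast
  define L where "L = l' b"
  have L: "0 < L"
    using height_pos[OF y(1)] b L_def by simp
  have form: "g (wcirc b ((real i + u) / real L)) =
    wcirc (J ((T ^^ i) y)) ((real (M ((T ^^ i) y)) + u) / real (l (J ((T ^^ i) y))))"
    if "i < L" "0 \<le> u" "u \<le> 1" for i u
    using floors_formula[OF y, of i u] that unfolding b L_def by simp
  obtain i u where i: "i < L" "0 \<le> u" "u < 1" and s: "s = (real i + u) / real L"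
    using circle_param[OF L, of s] assms by auto
  show ?thesis
  proof (cases "u = 0")
    case False
    show ?thesis
    proof (rule lifted_at_interior[of "1 / real L" "min u (1 - u) / real L" "J ((T ^^ i) y)" k
          "l (J ((T ^^ i) y))" _ _ "M ((T ^^ i) y)" u])
      show "0 < 1 / real L" "0 < min u (1 - u) / real L" "J ((T ^^ i) y) < k" "0 < l (J ((T ^^ i) y))"
        using L i False column_below[OF y(1), of i] by auto
      fix v assume v: "\<bar>v\<bar> < min u (1 - u) / real L"
      have "\<bar>v * real L\<bar> < min u (1 - u)"
        using v L by (simp add: abs_mult pos_less_divide_eq del: min_less_iff_conj)
      then have "0 \<le> u + v * real L" "u + v * real L \<le> 1"
        by linarith+
      moreover have "s + v = (real i + (u + v * real L)) / real L"
        unfolding s using L by (simp add: field_simps)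
      ultimately show "g (wcirc b (s + v)) = wcirc (J ((T ^^ i) y))
          ((real (M ((T ^^ i) y)) + (u + v / (1 / real L))) / real (l (J ((T ^^ i) y))))"
        using form[OF i(1)] by simp
    qed
  next
    case True
    \<comment> \<open>The node is not the wedge point, because \<open>s > 0\<close>; therefore it
      has a well-determined preceding arc, number \<open>j\<close>.\<close>
    then have "i \<noteq> 0"
      using s assms(2) by (metis add_0 div_0 less_irrefl of_nat_0)
    then obtain j where j: "i = Suc j"
      using not0_implies_Suc by blast
    show ?thesis
    proof (rule lifted_at_junction[of "1 / real L" "1 / real L" "J ((T ^^ j) y)" k "J ((T ^^ i) y)"
          "M ((T ^^ j) y)" l "M ((T ^^ i) y)"])
      show "0 < 1 / real L" "0 < 1 / real L" "J ((T ^^ j) y) < k" "J ((T ^^ i) y) < k"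
        "M ((T ^^ j) y) < l (J ((T ^^ j) y))" "M ((T ^^ i) y) < l (J ((T ^^ i) y))"
        using L column_below[OF y(1)] by auto
      show "if M ((T ^^ j) y) + 1 < l (J ((T ^^ j) y))
        then J ((T ^^ i) y) = J ((T ^^ j) y) \<and> M ((T ^^ i) y) = M ((T ^^ j) y) + 1
        else M ((T ^^ i) y) = 0"
        unfolding j by (rule column_succ[OF y(1)])
      fix v :: real
      assume v: "0 \<le> v" "v < 1 / real L"
      then have vL: "0 \<le> v * real L" "v * real L < 1"
        using L by (simp_all add: pos_less_divide_eq)
      have "s + v = (real i + v * real L) / real L"
        unfolding s True using L by (simp add: field_simps)
      then show "g (wcirc b (s + v)) = wcirc (J ((T ^^ i) y))
          ((real (M ((T ^^ i) y)) + v / (1 / real L)) / real (l (J ((T ^^ i) y))))"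
        using form[OF i(1), of "v * real L"] vL by simp
      have "s - v = (real j + (1 - v * real L)) / real L"
        unfolding s True j using L by (simp add: field_simps)
      then show "g (wcirc b (s - v)) = wcirc (J ((T ^^ j) y))
          ((real (M ((T ^^ j) y)) + (1 - v / (1 / real L))) / real (l (J ((T ^^ j) y))))"
        using form[of j "1 - v * real L"] i(1) j vL by simp
    qed
  qed
qed

lemma positive_map_bond: "positive_map k' k g"
  unfolding positive_map_def
proof (intro conjI allI impI ballI)
  have img: "g ` wedge k' = wedge k"
    unfolding proj_surj[OF tw', symmetric] proj_surj[OF tw, symmetric] image_image
    by (rule image_cong) (use g in auto)
  then show "g ` wedge k' = wedge k" .
  have "continuous_on (wedge k') g"
  proof (rule continuous_on_quotient[OF compact_A cont_proj[OF tw'] proj_surj[OF tw']])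
    show "continuous_on A (\<lambda>x. g (proj l' J' M' x))"
      by (rule continuous_on_eq[OF cont_proj[OF tw]]) (simp add: g)
  qed
  then show "continuous_map (W k') (W k) g"
    using img by (auto simp: continuous_map_in_subtopology)
  have "M' x0 = 0" "M x0 = 0"
    using tw' tw unfolding tower_def by auto
  then show g0: "g 0 = 0"
    using g[OF q_in[OF x0_in, of 0]] proj_eq_0_iff[OF tw x0_in, of 0] proj_eq_0_iff[OF tw' x0_in, of 0]
    by simp
  show "\<exists>a<k. \<exists>e>0. \<exists>h. strict_mono_on {s - e<..<s + e} h \<and>
      (\<forall>t\<in>{s - e<..<s + e}. g (wcirc b t) = wcirc a (h t))"
    if b: "b < k'" and nz: "g (wcirc b s) \<noteq> 0" for b s
  proof -
    \<comment> \<open>\<open>positive_map\<close> allows every real parameter. Integers are excluded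
      because \<open>g\<close> vanishes there, and any other parameter is shifted into the open unit
      interval.\<close>
    have "s \<notin> \<int>"
      using nz g0 wcirc_eq_0_iff[of b s] by auto
    then have "0 < frac s" "frac s < 1"
      using frac_lt_1 frac_eq_0_iff[of s] frac_ge_0[of s] by (auto simp: order_le_less)
    then have "\<exists>a<k. \<exists>e>0. \<exists>h. strict_mono_on {frac s - e<..<frac s + e} h \<and>
      (\<forall>t\<in>{frac s - e<..<frac s + e}. g (wcirc b t) = wcirc a (h t))"
      using lifted_at_mono[OF circle_lifted[OF b]] nz by (simp add: wcirc_frac)
    then obtain a e h where a: "a < k" "e > 0" and h: "strict_mono_on {frac s - e<..<frac s + e} h"
      and gh: "\<And>t. t \<in> {frac s - e<..<frac s + e} \<Longrightarrow> g (wcirc b t) = wcirc a (h t)"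
      by blast
    have sh: "t - real_of_int \<lfloor>s\<rfloor> \<in> {frac s - e<..<frac s + e}" if "t \<in> {s - e<..<s + e}" for t
      using that unfolding frac_def by auto
    show ?thesis
    proof (rule exI[of _ a], intro conjI a, rule exI[of _ e], intro conjI a,
        rule exI[of _ "\<lambda>t. h (t - of_int \<lfloor>s\<rfloor>)"], intro conjI ballI)
      show "strict_mono_on {s - e<..<s + e} (\<lambda>t. h (t - of_int \<lfloor>s\<rfloor>))"
      proof (rule strict_mono_onI)
        fix t t' assume "t \<in> {s - e<..<s + e}" "t' \<in> {s - e<..<s + e}" "t < t'"
        then show "h (t - of_int \<lfloor>s\<rfloor>) < h (t' - of_int \<lfloor>s\<rfloor>)"
          using strict_mono_onD[OF h sh[of t] sh[of t']] by simp
      qed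
      show "g (wcirc b t) = wcirc a (h (t - of_int \<lfloor>s\<rfloor>))" if "t \<in> {s - e<..<s + e}" for t
        using gh[OF sh[OF that]] wcirc_add_int[of "t - of_int \<lfloor>s\<rfloor>" t b] by simp
    qed
  qed
  show "\<exists>U. openin (W k') U \<and> z \<in> U \<and> inj_on g U" if z: "z \<in> wedge k' - {0}" for z
  proof -
    obtain b s where b: "b < k'" "0 \<le> s" "s < 1" "z = wcirc b s"
      using z wedge_cases by blast
    then have "0 < s"
      using z by (cases "s = 0") auto
    then obtain e where e: "e > 0" "inj_on (\<lambda>s. g (wcirc b s)) {s - e<..<s + e}"
      using lifted_at_inj[OF circle_lifted[OF b(1)]] b by blast
    define u v where "u = max 0 (s - e)" and "v = min 1 (s + e)"
    have uv: "0 \<le> u" "v \<le> 1" "s \<in> {u<..<v}" "{u<..<v} \<subseteq> {s - e<..<s + e}"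
      using b \<open>0 < s\<close> e(1) unfolding u_def v_def by auto
    have "inj_on g (wcirc b ` {u<..<v})"
      using inj_on_subset[OF e(2) uv(4)] unfolding inj_on_def by auto
    then show ?thesis
      using openin_wedge_arc[OF b(1) uv(1,2)] uv(3) b(4) by blast
  qed
qed

end

end

lemma bond_Suc: "n \<le> m \<Longrightarrow> bond f n (Suc m) = bond f n m \<circ> f m"
proof -
  have comp: "foldr (\<circ>) xs g = foldr (\<circ>) xs id \<circ> g" for xs :: "(complex \<Rightarrow> complex) list" and g
    by (induction xs) (auto simp: o_assoc)
  show "n \<le> m \<Longrightarrow> bond f n (Suc m) = bond f n m \<circ> f m"
    unfolding bond_def using comp[of "map f [n..<m]" "f m"] by simp
qed

lemma bond_apply:
  assumes "\<And>i x. x \<in> S \<Longrightarrow> f i (p (Suc i) x) = p i x" "n \<le> m" "x \<in> S"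
  shows "bond f n m (p m x) = p n x"
  using assms(2)
proof (induction m rule: dec_induct)
  case base
  then show ?case
    by (simp add: bond_def)
next
  case (step m)
  then show ?case
    using assms(1,3) by (simp add: bond_Suc)
qed

lemma topspace_inv_limit:
  "topspace (inv_limit k f) = {z. (\<forall>n. z n \<in> wedge (k n)) \<and> (\<forall>n. z n = f n (z (Suc n)))}"
  unfolding inv_limit_def topspace_subtopology topspace_product_topology
    topspace_euclidean_subtopology PiE_UNIV_domain Pi_def topspace_euclidean by blast

section \<open>The inverse limit of the wedges\<close>

context cross_section
begin

lemma Tn_flow: "y \<in> K \<Longrightarrow> \<exists>t. (T ^^ n) y = \<phi> t y \<and> 0 \<le> t \<and> (1 \<le> n \<longrightarrow> 0 < t)"
proof (induction n)
  case 0
  then show ?case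
    using flow_0 in_A by (intro exI[of _ 0]) simp
next
  case (Suc n)
  then obtain t where t: "(T ^^ n) y = \<phi> t y" "0 \<le> t"
    by auto
  then have "(T ^^ Suc n) y = \<phi> (R ((T ^^ n) y) + t) y"
    using flow_add[OF in_A[OF Suc.prems], of "R ((T ^^ n) y)" t] by (simp add: T_def)
  moreover have "0 < R ((T ^^ n) y) + t"
    using R_pos[OF Tn_in[OF Suc.prems], of n] t by simp
  ultimately show ?case
    by (intro exI[of _ "R ((T ^^ n) y) + t"]) simp
qed

text \<open>Off the wedge point the finer value reveals new tower, new floor and \<open>u\<close>,
  which fix the coarser data; over the wedge point all points lie in the new base, hence in the old
  one. This is the well-definedness of the bonding maps.\<close>

lemma proj_factor:
  assumes tw: "tower k l J M" and tw': "tower k' l' J' M'" and ref: "refines n l J M J' M'"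
    and x: "x \<in> A" "x' \<in> A" and eq: "proj l' J' M' x = proj l' J' M' x'"
  shows "proj l J M x = proj l J M x'"
proof -
  obtain y u where y: "y \<in> K" "0 \<le> u" "u < 1" "x = q y u"
    using cover_q x by blast
  obtain z v where z: "z \<in> K" "0 \<le> v" "v < 1" "x' = q z v"
    using cover_q x by blast
  show ?thesis
  proof (cases "proj l' J' M' x = 0")
    case True
    then have "M' y = 0" "u = 0" "M' z = 0" "v = 0"
      using proj_eq_0_iff[OF tw' y(1-3)] proj_eq_0_iff[OF tw' z(1-3)] eq y(4) z(4) by auto
    moreover from this have "M y = 0" "M z = 0"
      using ref y(1) z(1) unfolding refines_def by blast+
    ultimately have "proj l J M x = 0" "proj l J M x' = 0"
      unfolding y(4) z(4) proj_eq_0_iff[OF tw y(1-3)] proj_eq_0_iff[OF tw z(1-3)] by blast+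
    then show ?thesis
      by simp
  next
    case False
    then have "J' y = J' z" "M' y = M' z" "u = v"
      using proj_eqD[OF tw' y(1-3) z(1-3)] eq y(4) z(4) by auto
    moreover from this have "J y = J z" "M y = M z"
      using ref y(1) z(1) unfolding refines_def by blast+
    ultimately show ?thesis
      unfolding y(4) z(4) proj_q_less[OF y(1-3)] proj_q_less[OF z(1-3)] by simp
  qed
qed

lemma expansion_exists:
  "\<exists>k f p. expansion (top_of_set A) \<phi> x0 k f p \<and>
    ((\<forall>t>0. \<phi> t x0 \<noteq> x0) \<longrightarrow> (\<forall>i. proper_posmap (k (Suc i)) (f i))) \<and>
    (T x0 = x0 \<longrightarrow> (\<forall>n\<ge>1. degenerate_proper (k n) (bond f 0 n)))"
proof -
  obtain k l J M where tw: "\<And>n. tower (k n) (l n) (J n) (M n)"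
    and ref: "\<And>n. refines n (l n) (J n) (M n) (J (Suc n)) (M (Suc n))"
    and level0: "k 0 = 1" "l 0 = (\<lambda>_. 1)" "J 0 = (\<lambda>_. 0)" "M 0 = (\<lambda>_. 0)"
    using tower_sequence by blast
  define p where "p n = proj (l n) (J n) (M n)" for n
  \<comment> \<open>On the wedge this value is forced, as \<open>p (Suc n)\<close> is onto;
    \<open>proj_factor\<close> makes it independent of the chosen preimage.\<close>
  define f where "f n z = p n (inv_into A (p (Suc n)) z)" for n z
  have p_surj: "p n ` A = wedge (k n)" for n
    unfolding p_def by (rule proj_surj[OF tw])
  have fp: "f n (p (Suc n) x) = p n x" if "x \<in> A" for n x
  proof -
    let ?x' = "inv_into A (p (Suc n)) (p (Suc n) x)"
    have "?x' \<in> A" "p (Suc n) ?x' = p (Suc n) x"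
      using that by (auto intro: inv_into_into f_inv_into_f)
    then show ?thesis
      using proj_factor[OF tw tw ref, of ?x' x] that unfolding f_def p_def by blast
  qed
  note bond_p = bond_apply[of A f p, OF fp]
  have M0: "M n x0 = 0" for n
    using tw[of n] unfolding tower_def by blast
  have ref0: "M n x = 0" if "x \<in> K" "M (Suc n) x = 0" for n x
    using ref[of n] that unfolding refines_def by blast
  have pos: "positive_map (k (Suc n)) (k n) (f n)" for n
    by (rule positive_map_bond[OF tw[of n] tw[of "Suc n"]]) (auto simp: ref0 fp[unfolded p_def])
  have p_x0: "p n x0 = 0" for n
    using proj_eq_0_iff[OF tw x0_in, of 0 n] q_0[OF x0_in] M0 unfolding p_def by simp
  have f0: "f n 0 = 0" for n
    using pos[of n] unfolding positive_map_def by blast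
  have k1: "1 \<le> k n" for n
    using tw[of n] x0_in unfolding tower_def by force
  have p_up: "p m x \<noteq> 0" if "p n x \<noteq> 0" "n \<le> m" "x \<in> A" for n m x
    using that(2)
  proof (induction m rule: dec_induct)
    case (step m)
    then show ?case
      using fp[OF that(3), of m] f0[of m] by metis
  qed (rule that(1))
  have floors_down: "J n y = J n z \<and> M n y = M n z"
    if "y \<in> K" "z \<in> K" "J m y = J m z \<and> M m y = M m z" "n \<le> m" for n m y z
    using that(4)
  proof (induction n rule: inc_induct)
    case (step n)
    then show ?case
      using ref[of n] that(1,2) unfolding refines_def by blast
  qed (rule that(3))
  have inj: "x = x'" if x: "x \<in> A" "x' \<in> A" and eq: "\<And>n. p n x = p n x'" for x x'
  proof -
    obtain y u where y: "y \<in> K" "0 \<le> u" "u < 1" "x = q y u"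
      using cover_q x by blast
    obtain z v where z: "z \<in> K" "0 \<le> v" "v < 1" "x' = q z v"
      using cover_q x by blast
    show ?thesis
    \<comment> \<open>A point off the wedge point at one level stays off it at all later levels,
      where its image reveals tower and floor, hence its side of every \<open>D i\<close>. A point
      over the wedge point at every level lies in all bases, and these are on the side of
      \<open>x0\<close> for every \<open>D i\<close>.\<close>
    proof (cases "\<exists>n. p n x \<noteq> 0")
      case True
      then obtain n where n: "p n x \<noteq> 0"
        by blast
      have fl: "J m y = J m z \<and> M m y = M m z \<and> u = v" if "n \<le> m" for m
        using proj_eqD[OF tw y(1-3) z(1-3), of m] eq[of m] p_up[OF n that x(1)] y(4) z(4)
        unfolding p_def by simp
      have "y = z"
      proof (rule ccontr)
        assume "y \<noteq> z"
        then obtain i where i: "y \<in> D i \<longleftrightarrow> z \<notin> D i"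
          using D_sep[OF y(1) z(1)] by blast
        have "J (Suc i) y = J (Suc i) z \<and> M (Suc i) y = M (Suc i) z"
          by (rule floors_down[OF y(1) z(1), of "max n (Suc i)"]) (use fl in auto)
        then have "y \<in> D i \<longleftrightarrow> z \<in> D i"
          using ref[of i] y(1) z(1) unfolding refines_def by blast
        then show False
          using i by blast
      qed
      then show ?thesis
        using fl[of n] y(4) z(4) by simp
    next
      case False
      have *: "q y u = x0" if y: "y \<in> K" "0 \<le> u" "u < 1" and "\<And>n. p n (q y u) = 0" for y u
      proof -
        have "M n y = 0" "u = 0" for n
          using proj_eq_0_iff[OF tw y, of n] that(4)[of n] unfolding p_def by auto
        moreover have "y = x0"
        proof (rule ccontr)
          assume "y \<noteq> x0"
          then obtain i where "y \<in> D i \<longleftrightarrow> x0 \<notin> D i"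
            using D_sep[OF y(1) x0_in] by blast
          then show False
            using ref[of i] y(1) \<open>\<And>n. M n y = 0\<close>[of "Suc i"] unfolding refines_def by blast
        qed
        ultimately show ?thesis
          using q_0[OF x0_in] by simp
      qed
      show ?thesis
        using *[OF y(1-3)] *[OF z(1-3)] False eq y(4) z(4) by metis
    qed
  qed
  have surj: "\<exists>x\<in>A. \<forall>n. p n x = z n" if z: "\<And>n. z n \<in> wedge (k n)" "\<And>n. z n = f n (z (Suc n))" for z
  proof -
    \<comment> \<open>A thread is hit because the fibres over its coordinates are nonempty, compact
      and decreasing.\<close>
    let ?E = "\<lambda>n. {x\<in>A. p n x = z n}"
    have dec: "?E (Suc n) \<subseteq> ?E n" for n
    proof
      fix x assume "x \<in> ?E (Suc n)"
      then have "x \<in> A" "p (Suc n) x = z (Suc n)"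
        by blast+
      then show "x \<in> ?E n"
        using fp[of x n] z(2)[of n] by simp
    qed
    have clos: "compact (?E n)" for n
    proof -
      have "closedin (top_of_set A) (A \<inter> p n -` {z n})"
        using cont_proj[OF tw] unfolding p_def by (intro continuous_closedin_preimage) auto
      moreover have "A \<inter> p n -` {z n} = ?E n"
        by auto
      ultimately show ?thesis
        using closedin_compact[OF compact_A] by metis
    qed
    have ne: "?E n \<noteq> {}" for n
      using z(1)[of n] p_surj[of n] by force
    have "A \<inter> (\<Inter>n\<in>UNIV. ?E n) \<noteq> {}"
    proof (rule compact_imp_fip_image[OF compact_A])
      show "closed (?E n)" for n
        using clos by (rule compact_imp_closed)
      fix I :: "nat set" assume "finite I"
      then have "i \<le> Max (insert 0 I)" if "i \<in> I" for i
        using that by simp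
      then have "?E (Max (insert 0 I)) \<subseteq> ?E i" if "i \<in> I" for i
        using lift_Suc_antimono_le[of ?E, OF dec] that by blast
      then have "?E (Max (insert 0 I)) \<subseteq> A \<inter> (\<Inter>i\<in>I. ?E i)"
        by blast
      then show "A \<inter> (\<Inter>i\<in>I. ?E i) \<noteq> {}"
        using ne by blast
    qed
    then show ?thesis
      by auto
  qed
  have "homeomorphic_map (top_of_set A) (inv_limit k f) (\<lambda>x i. p i x)"
  proof (rule continuous_imp_homeomorphic_map)
    show "compact_space (top_of_set A)"
      using compact_A by (simp add: compact_space_subtopology)
    show "Hausdorff_space (inv_limit k f)"
      unfolding inv_limit_def
      by (intro Hausdorff_space_subtopology) (simp add: Hausdorff_space_product_topology Hausdorff_space_subtopology)
    show "continuous_map (top_of_set A) (inv_limit k f) (\<lambda>x i. p i x)"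
      unfolding inv_limit_def continuous_map_in_subtopology continuous_map_componentwise_UNIV
      using cont_proj[OF tw] p_surj fp unfolding p_def
      by (auto simp: continuous_map_in_subtopology)
    show "(\<lambda>x i. p i x) ` topspace (top_of_set A) = topspace (inv_limit k f)"
    proof
      show "(\<lambda>x i. p i x) ` topspace (top_of_set A) \<subseteq> topspace (inv_limit k f)"
      proof
        fix z assume "z \<in> (\<lambda>x i. p i x) ` topspace (top_of_set A)"
        then obtain x where "x \<in> A" "z = (\<lambda>i. p i x)"
          by auto
        then show "z \<in> topspace (inv_limit k f)"
          unfolding topspace_inv_limit mem_Collect_eq using p_surj fp by (metis imageI)
      qed
      show "topspace (inv_limit k f) \<subseteq> (\<lambda>x i. p i x) ` topspace (top_of_set A)"
      proof
        fix z assume "z \<in> topspace (inv_limit k f)"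
        then have "\<And>n. z n \<in> wedge (k n)" "\<And>n. z n = f n (z (Suc n))"
          unfolding topspace_inv_limit by blast+
        then obtain x where "x \<in> A" "\<forall>n. p n x = z n"
          using surj[of z] by blast
        then show "z \<in> (\<lambda>x i. p i x) ` topspace (top_of_set A)"
          by (intro image_eqI[of _ _ x]) auto
      qed
    qed
    show "inj_on (\<lambda>x i. p i x) (topspace (top_of_set A))"
      using inj by (intro inj_onI) (simp add: fun_eq_iff)
  qed
  then have "expansion (top_of_set A) \<phi> x0 k f p"
    unfolding expansion_def
    using k1 pos p_x0 bond_p projection_proj[OF tw] unfolding p_def by auto
  moreover have "proper_posmap (k (Suc n)) (f n)" if ap: "\<forall>t>0. \<phi> t x0 \<noteq> x0" for n
    unfolding proper_posmap_def
  proof (rule exI[of _ "J n x0"], rule exI[of _ "J n (T' x0)"], intro allI impI)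
    fix b assume "b < k (Suc n)"
    then obtain y where y: "y \<in> K" "M (Suc n) y = 0" and b: "J (Suc n) y = b"
      using tw[of "Suc n"] unfolding tower_def by blast
    define L where "L = l (Suc n) b"
    \<comment> \<open>After \<open>h\<close> steps the first old column crossed by the new one is
      complete; floor \<open>h\<close> will supply the second old base in the word.\<close>
    define h where "h = l n (J n x0)"
    let ?a = "\<lambda>i. J n ((T ^^ i) y)" and ?m = "\<lambda>i. M n ((T ^^ i) y)"
    note sub = ref[of n, unfolded refines_def]
    have word: "sym_rep (f n) b = map ?a (filter (\<lambda>i. ?m i = 0) [0..<L])"
      unfolding b[symmetric] L_def
      by (rule sym_rep_column[OF tw[of n] tw[of "Suc n"] _ _ y]) (auto simp: ref0 fp[unfolded p_def])
    have L: "0 < L"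
      using tw[of "Suc n"] y(1) unfolding tower_def b[symmetric] L_def by force
    have top': "M (Suc n) ((T ^^ L) y) = 0"
      using tower_climb(2)[OF tw y] unfolding b L_def .
    have Jy: "J n y = J n x0" "M n y = 0"
      using sub y by blast+
    have h: "0 < h"
      using tw[of n] x0_in M0[of n] unfolding tower_def h_def by force
    then have "(T ^^ h) x0 \<noteq> x0"
      using Tn_flow[OF x0_in, of h] ap by auto
    then have nh: "M (Suc n) ((T ^^ h) y) \<noteq> 0"
      using sub y unfolding h_def by blast
    \<comment> \<open>The new column ends on a new base, hence on an old one, and so cannot stop
      inside its first old column. That it does not stop exactly at \<open>h\<close> is the third
      clause of \<open>refines\<close>, recorded in \<open>nh\<close>.\<close>
    have "h \<le> L"
    proof (rule ccontr)
      assume "\<not> h \<le> L"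
      then have "M n ((T ^^ L) y) = L"
        using tower_climb(1)[OF tw y(1) Jy(2), of L] Jy(1) unfolding h_def by simp
      then show False
        using ref0[OF Tn_in[OF y(1)] top'] L by simp
    qed
    then have hL: "h < L"
      using nh top' by (cases "h = L") auto
    have mh: "?m h = 0"
      using tower_climb(2)[OF tw y(1) Jy(2)] Jy(1) unfolding h_def by simp
    have last: "last (map ?a (filter (\<lambda>i. ?m i = 0) [0..<L])) = ?a (L - 1)"
    proof (rule conjunct2[OF last_map_filter_run])
      show "?m 0 = 0" "0 < L"
        using Jy(2) L by simp_all
      show "?a (Suc i) = ?a i" if "?m (Suc i) \<noteq> 0" for i
        using tw[of n] Tn_in[OF y(1), of i] that unfolding tower_def by (auto split: if_splits)
    qed
    have "T' ((T ^^ L) y) = (T ^^ (L - 1)) y"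
      using T'T[OF Tn_in[OF y(1), of "L - 1"]] L by (cases L) auto
    moreover have "J n (T' ((T ^^ L) y)) = J n (T' x0)"
      using sub top' Tn_in[OF y(1), of L] by blast
    ultimately have aL: "?a (L - 1) = J n (T' x0)"
      by simp
    have "?m 0 = 0" "?a 0 = J n x0"
      using Jy by simp_all
    then show "\<exists>v. sym_rep (f n) b = J n x0 # v @ [J n (T' x0)]"
      using word_split[of "\<lambda>i. ?m i = 0" h L ?a] mh h hL unfolding word last aL by metis
  qed
  moreover have "degenerate_proper (k n) (bond f 0 n)" if fx: "T x0 = x0" for n
  proof -
    have bp: "bond f 0 n (proj (l n) (J n) (M n) x) = proj (l 0) (J 0) (M 0) x" if "x \<in> A" for x
      using bond_p[of 0 n x] that unfolding p_def by simp
    have r0: "M 0 x = 0" for x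
      using level0 by simp
    have word: "sym_rep (bond f 0 n) (J n y) = replicate (l n (J n y)) 0 \<and> 0 < l n (J n y)"
      if "y \<in> K" "M n y = 0" for y
    proof -
      have "sym_rep (bond f 0 n) (J n y) =
        map (\<lambda>i. J 0 ((T ^^ i) y)) (filter (\<lambda>i. M 0 ((T ^^ i) y) = 0) [0..<l n (J n y)])"
        by (rule sym_rep_column[OF tw[of 0] tw[of n] _ _ that]) (auto simp: r0 bp)
      moreover have "0 < l n (J n y)"
        using tw[of n] that(1) unfolding tower_def by force
      ultimately show ?thesis
        using level0 by (simp add: map_replicate_const)
    qed
    \<comment> \<open>In a taller tower \<open>T x0\<close> would be on floor 1, but
      \<open>T x0 = x0\<close> is on floor 0.\<close>
    have "l n (J n x0) = 1"
    proof -
      have "0 < l n (J n x0)"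
        using word[OF x0_in M0] by blast
      moreover have "\<not> 1 < l n (J n x0)"
        using tower_climb(1)[OF tw x0_in M0, of 1 n] fx M0[of n] by auto
      ultimately show ?thesis
        by linarith
    qed
    then have x0_word: "sym_rep (bond f 0 n) (J n x0) = [0]" "J n x0 < k n"
      using word[OF x0_in M0] tw[of n] x0_in unfolding tower_def by auto
    have all: "sym_rep (bond f 0 n) b \<noteq> [] \<and> hd (sym_rep (bond f 0 n) b) = 0 \<and> last (sym_rep (bond f 0 n) b) = 0"
      if b: "b < k n" for b
    proof -
      obtain y where "y \<in> K" "M n y = 0" "J n y = b"
        using tw[of n] b unfolding tower_def by blast
      then show ?thesis
        using word[of y] by (auto simp: hd_replicate)
    qed
    show ?thesis
      unfolding degenerate_proper_def using x0_word all by blast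
  qed
  ultimately show ?thesis
    by blast
qed

end

subsection \<open>Existence of cross-sections\<close>

text \<open>Total separatedness; for compact sets it yields clopen neighbourhood bases, that is,
  zero-dimensionality.\<close>

definition clopen_separated :: "'b::topological_space set \<Rightarrow> bool" where
  "clopen_separated S \<longleftrightarrow> (\<forall>a\<in>S. \<forall>b\<in>S. a \<noteq> b \<longrightarrow>
     (\<exists>D. openin (top_of_set S) D \<and> closedin (top_of_set S) D \<and> a \<in> D \<and> b \<notin> D))"

lemma openin_Int_subset:
  assumes "K \<subseteq> A" "openin (top_of_set A) V"
  shows "openin (top_of_set K) (K \<inter> V)"
proof -
  obtain U where "open U" "V = A \<inter> U"
    using assms(2) unfolding openin_open by blast
  then have "K \<inter> V = K \<inter> U" "open U"
    using assms(1) by auto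
  then show ?thesis
    unfolding openin_open by blast
qed

lemma clopen_separated_subset:
  assumes "clopen_separated S" "K \<subseteq> S"
  shows "clopen_separated K"
  unfolding clopen_separated_def
proof (intro ballI impI)
  fix a b assume ab: "a \<in> K" "b \<in> K" "a \<noteq> b"
  then obtain D where D: "openin (top_of_set S) D" "closedin (top_of_set S) D" "a \<in> D" "b \<notin> D"
    using assms unfolding clopen_separated_def by blast
  obtain U V where "open U" "D = S \<inter> U" "closed V" "D = S \<inter> V"
    using D(1,2) unfolding openin_open closedin_closed by blast
  then have "openin (top_of_set K) (K \<inter> D)" "closedin (top_of_set K) (K \<inter> D)"
    using assms(2) unfolding openin_open closedin_closed by (metis Int_assoc inf.absorb1)+
  then show "\<exists>D. openin (top_of_set K) D \<and> closedin (top_of_set K) D \<and> a \<in> D \<and> b \<notin> D"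
    using ab D(3,4) by blast
qed

text \<open>By compactness \<open>U\<close> and finitely many clopen sets that avoid
  \<open>x\<close> cover \<open>S\<close>; the complement of the union of these sets is the required
  neighbourhood.\<close>

lemma clopen_separated_nbhd:
  assumes "compact S" "clopen_separated S" "openin (top_of_set S) U" "x \<in> U"
  obtains K where "openin (top_of_set S) K" "closedin (top_of_set S) K" "x \<in> K" "K \<subseteq> U"
proof -
  have x: "x \<in> S"
    using assms openin_imp_subset by blast
  define \<D> where "\<D> = {D. openin (top_of_set S) D \<and> closedin (top_of_set S) D \<and> x \<notin> D}"
  have "\<forall>D\<in>insert U \<D>. openin (top_of_set S) D"
    using assms(3) unfolding \<D>_def by blast
  moreover have "S \<subseteq> \<Union>(insert U \<D>)"
  proof
    fix y assume y: "y \<in> S"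
    show "y \<in> \<Union>(insert U \<D>)"
    proof (cases "y = x")
      case False
      then obtain D where "openin (top_of_set S) D" "closedin (top_of_set S) D" "y \<in> D" "x \<notin> D"
        using assms(2) x y unfolding clopen_separated_def by blast
      then show ?thesis
        unfolding \<D>_def by blast
    qed (use assms in auto)
  qed
  ultimately obtain F where F: "F \<subseteq> insert U \<D>" "finite F" "S \<subseteq> \<Union>F"
    using assms(1) unfolding compact_eq_openin_cover by metis
  define E where "E = \<Union>(F - {U})"
  have "finite (F - {U})" "\<And>D. D \<in> F - {U} \<Longrightarrow> D \<in> \<D>"
    using F by auto
  then have E: "openin (top_of_set S) E" "closedin (top_of_set S) E" "x \<notin> E"
    unfolding E_def \<D>_def by (auto intro!: openin_Union closedin_Union)
  show thesis
  proof (rule that[of "S - E"])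
    show "openin (top_of_set S) (S - E)" "closedin (top_of_set S) (S - E)"
      using E(1,2) by (auto intro: openin_diff closedin_diff)
    show "x \<in> S - E" "S - E \<subseteq> U"
      using x E F(3) unfolding E_def by auto
  qed
qed

text \<open>For every pair of basic open sets whose traces on \<open>K\<close> can be separated by a
  clopen set, one such set is chosen. Any two distinct points lie in such a pair, because a clopen
  set and its complement are both open.\<close>

lemma clopen_separated_countable:
  fixes K :: "'b::second_countable_topology set"
  assumes "clopen_separated K"
  obtains D :: "nat \<Rightarrow> 'b set" where
    "\<And>n. openin (top_of_set K) (D n)" "\<And>n. closedin (top_of_set K) (D n)"
    "\<And>x y. x \<in> K \<Longrightarrow> y \<in> K \<Longrightarrow> x \<noteq> y \<Longrightarrow> \<exists>n. x \<in> D n \<longleftrightarrow> y \<notin> D n"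
proof -
  obtain B :: "'b set set" where B: "countable B" "topological_basis B"
    using ex_countable_basis by blast
  define P where "P U V D \<longleftrightarrow> openin (top_of_set K) D \<and> closedin (top_of_set K) D \<and>
    K \<inter> U \<subseteq> D \<and> K \<inter> V \<inter> D = {}" for U V D
  define h where "h c = (if \<exists>D. P (fst c) (snd c) D then SOME D. P (fst c) (snd c) D else {})" for c
  have hP: "P (fst c) (snd c) (h c)" if "\<exists>D. P (fst c) (snd c) D" for c
    using someI_ex[OF that] that unfolding h_def by simp
  have hc: "openin (top_of_set K) (h c)" "closedin (top_of_set K) (h c)" for c
    using hP[of c] unfolding P_def h_def by (cases "\<exists>D. P (fst c) (snd c) D"; auto simp: P_def)+
  have "\<exists>n. x \<in> h (from_nat_into (B \<times> B) n) \<longleftrightarrow> y \<notin> h (from_nat_into (B \<times> B) n)"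
    if xy: "x \<in> K" "y \<in> K" "x \<noteq> y" for x y
  proof -
    obtain D where D: "openin (top_of_set K) D" "closedin (top_of_set K) D" "x \<in> D" "y \<notin> D"
      using assms xy unfolding clopen_separated_def by blast
    obtain U where U: "open U" "D = K \<inter> U"
      using D(1) unfolding openin_open by blast
    have "openin (top_of_set K) (K - D)"
      using D(2) by (intro openin_diff) auto
    then obtain V where V: "open V" "K - D = K \<inter> V"
      unfolding openin_open by blast
    obtain U' where U': "U' \<in> B" "x \<in> U'" "U' \<subseteq> U"
      using topological_basisE[OF B(2) U(1)] D(3) U(2) by blast
    obtain V' where V': "V' \<in> B" "y \<in> V'" "V' \<subseteq> V"
      using topological_basisE[OF B(2) V(1)] D(4) V(2) xy(2) by blast
    have "P U' V' D"
      unfolding P_def using D U V U' V' by blast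
    then have P: "P U' V' (h (U', V'))"
      using hP[of "(U', V')"] by auto
    obtain n where n: "from_nat_into (B \<times> B) n = (U', V')"
      using from_nat_into_surj[of "B \<times> B" "(U', V')"] B(1) U'(1) V'(1) by auto
    have "x \<in> h (U', V')" "y \<notin> h (U', V')"
      using P xy U'(2) V'(2) unfolding P_def by blast+
    then show ?thesis
      using n by metis
  qed
  then show thesis
    by (intro that[of "\<lambda>n. h (from_nat_into (B \<times> B) n)"] hc)
qed

text \<open>The hypothesis \<open>thin\<close> is all that is used of the dimension of the flow space.\<close>

locale dense_flow = metric_flow +
  fixes x0 :: "'b::{metric_space,second_countable_topology}"
  assumes x0: "x0 \<in> A" and nofix: "\<exists>t. \<phi> t x0 \<noteq> x0"
    and thin: "compact S \<Longrightarrow> S \<subseteq> A \<Longrightarrow> 0 < e \<Longrightarrow>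
      inj_on (\<lambda>(x, t). \<phi> t x) (S \<times> {-e..e}) \<Longrightarrow> clopen_separated S"
    and dense: "openin (top_of_set A) U \<Longrightarrow> x0 \<in> U \<Longrightarrow> x \<in> A \<Longrightarrow> \<exists>t>0. \<phi> t x \<in> U"
begin

text \<open>The average over \<open>[0, \<tau>]\<close> of the distance to \<open>x0\<close> increases along the flow near \<open>x0\<close>,
  because its derivative at \<open>x\<close> is \<open>dist (\<phi> \<tau> x) x0 - dist x x0\<close>.\<close>

lemma increasing_function:
  "\<exists>F r \<epsilon>. continuous_on A F \<and> 0 < r \<and> 0 < \<epsilon> \<and>
     (\<forall>x\<in>A. dist x x0 \<le> r \<longrightarrow> (\<forall>a b. -\<epsilon> \<le> a \<and> a < b \<and> b \<le> \<epsilon> \<longrightarrow> F (\<phi> a x) < (F (\<phi> b x) :: real)))"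
proof -
  obtain \<tau> where \<tau>: "\<tau> > 0" "\<phi> \<tau> x0 \<noteq> x0"
  proof -
    obtain t where t: "\<phi> t x0 \<noteq> x0"
      using nofix by blast
    then have "t \<noteq> 0"
      using flow_0[OF x0] by auto
    moreover have "\<phi> (- t) x0 \<noteq> x0"
      using t flow_minus(2)[OF x0, of t] by auto
    ultimately show thesis
      using t that[of t] that[of "- t"] by linarith
  qed
  define F where "F x = integral {0..\<tau>} (\<lambda>s. dist (\<phi> s x) x0)" for x
  define G where "G x = dist (\<phi> \<tau> x) x0 - dist x x0" for x
  have "continuous_on (A \<times> cbox 0 \<tau>) (\<lambda>z. dist (\<phi> (snd z) (fst z)) x0)"
    by (intro continuous_intros) auto
  then have F_cont: "continuous_on A F"
    unfolding F_def using integral_continuous_on_param[of A 0 \<tau> "\<lambda>x s. dist (\<phi> s x) x0"]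
    by (simp add: case_prod_beta)
  have "continuous_on (UNIV \<times> A) (\<lambda>z. G (\<phi> (fst z) (snd z)))"
    unfolding G_def using flow_in by (intro continuous_intros) auto
  moreover have G0: "0 < G (\<phi> 0 x0)"
    unfolding G_def using \<tau> flow_0[OF x0] by simp
  ultimately obtain \<delta> where \<delta>: "\<delta> > 0" "\<And>z. z \<in> UNIV \<times> A \<Longrightarrow> dist z (0, x0) < \<delta> \<Longrightarrow>
      dist (G (\<phi> (fst z) (snd z))) (G (\<phi> 0 x0)) < G (\<phi> 0 x0)"
    unfolding continuous_on_iff using x0
    by (metis (no_types, lifting) UNIV_I fst_conv mem_Sigma_iff snd_conv)
  define r where "r = \<delta> / 3"
  define \<epsilon> where "\<epsilon> = min (\<delta> / 3) (1 / 2)"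
  have r: "0 < r" "0 < \<epsilon>" "\<epsilon> \<le> \<delta> / 3" "\<epsilon> \<le> 1 / 2"
    using \<delta>(1) unfolding r_def \<epsilon>_def by auto
  have G_pos: "0 < G (\<phi> t x)" if "x \<in> A" "dist x x0 \<le> r" "\<bar>t\<bar> \<le> \<epsilon>" for t x
  proof -
    have "dist (t, x) (0, x0) \<le> \<bar>t\<bar> + dist x x0"
      unfolding dist_prod_def using sqrt_sum_squares_le_sum[of "\<bar>t\<bar>" "dist x x0"] by simp
    also have "\<dots> < \<delta>"
      using that r \<delta>(1) unfolding r_def by linarith
    finally have "dist (G (\<phi> t x)) (G (\<phi> 0 x0)) < G (\<phi> 0 x0)"
      using \<delta>(2)[of "(t, x)"] that(1) by simp
    then show ?thesis
      by (simp add: dist_real_def)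
  qed
  have "F (\<phi> a x) < F (\<phi> b x)" if x: "x \<in> A" "dist x x0 \<le> r" and ab: "-\<epsilon> \<le> a" "a < b" "b \<le> \<epsilon>" for x a b
  proof -
    define u where "u s = dist (\<phi> s x) x0" for s
    have u_cont: "continuous_on S u" for S
      unfolding u_def using x(1) by (intro continuous_intros) auto
    \<comment> \<open>Integration from -1 leaves room for negative times; since
      \<open>\<epsilon>\<close> is at most 1/2, all times that occur stay inside the interval of
      differentiability.\<close>
    define P where "P t = integral {-1..t} u" for t
    have P_deriv: "(P has_real_derivative u t) (at t)" if "-1 < t" "t < \<tau> + 1" for t
    proof -
      have "((\<lambda>t. integral {-1..t} u) has_real_derivative u t) (at t within {-1..\<tau> + 1})"
        using that by (intro integral_has_real_derivative u_cont) auto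
      moreover have "at t within {-1..\<tau> + 1} = at t"
        using that by (intro at_within_interior) auto
      ultimately show ?thesis
        unfolding P_def by simp
    qed
    have FP: "F (\<phi> t x) = P (t + \<tau>) - P t" if "-1 \<le> t" for t
    proof -
      have "F (\<phi> t x) = integral {0..\<tau>} (u \<circ> (+) t)"
        unfolding F_def u_def o_def using flow_add[OF x(1)] by (simp add: add.commute)
      also have "\<dots> = integral {t..t + \<tau>} u"
        using integral_shift_Icc_real[of 0 \<tau> u t] by (simp add: add.commute)
      also have "\<dots> = P (t + \<tau>) - P t"
        unfolding P_def using Henstock_Kurzweil_Integration.integral_combine[of "-1" t "t + \<tau>" u] that \<tau>(1)
          integrable_continuous_interval[OF u_cont] by simp
      finally show ?thesis .
    qed
    have "P (a + \<tau>) - P a < P (b + \<tau>) - P b"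
    proof (rule DERIV_pos_imp_increasing[OF ab(2)])
      fix t assume t: "a \<le> t" "t \<le> b"
      then have "((\<lambda>t. P (t + \<tau>)) has_real_derivative u (t + \<tau>)) (at t)"
        using iffD1[OF DERIV_shift P_deriv[of "t + \<tau>"]] ab r \<tau>(1) by auto
      moreover have "(P has_real_derivative u t) (at t)"
        using P_deriv[of t] t ab r \<tau>(1) by auto
      ultimately have "((\<lambda>t. P (t + \<tau>) - P t) has_real_derivative u (t + \<tau>) - u t) (at t)"
        by (rule DERIV_diff)
      moreover have "0 < u (t + \<tau>) - u t"
        using G_pos[OF x, of t] t ab flow_add[OF x(1), of \<tau> t] unfolding G_def u_def
        by (simp add: add.commute)
      ultimately show "\<exists>y. ((\<lambda>t. P (t + \<tau>) - P t) has_real_derivative y) (at t) \<and> 0 < y"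
        by blast
    qed
    then show ?thesis
      using FP[of a] FP[of b] ab r by simp
  qed
  then show ?thesis
    using F_cont r by blast
qed
end

text \<open>A local cross-section whose return times are still to be constructed:
  \<open>isolated_hit\<close> keeps successive visits apart, and \<open>flow_box\<close> makes a
  visit persist, at nearly the same time, for all nearby orbits.\<close>

locale transversal = dense_flow +
  fixes K :: "'b::{metric_space,second_countable_topology} set" and \<epsilon> :: real
  assumes compact_K: "compact K" and K_sub: "K \<subseteq> A" and x0_in: "x0 \<in> K" and \<epsilon>_pos: "0 < \<epsilon>"
    and isolated_hit: "y \<in> K \<Longrightarrow> \<phi> t y \<in> K \<Longrightarrow> \<bar>t\<bar> \<le> \<epsilon> \<Longrightarrow> t = 0"
    and flow_box: "openin (top_of_set K) C \<Longrightarrow>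
      openin (top_of_set A) {z\<in>A. \<exists>t. \<bar>t\<bar> < \<delta> \<and> \<phi> t z \<in> C}"
    and separated: "clopen_separated K"
begin

lemma in_A: "y \<in> K \<Longrightarrow> y \<in> A"
  using K_sub by blast

lemma flow_openin:
  assumes "openin (top_of_set A) V"
  shows "openin (top_of_set A) {z\<in>A. \<phi> s z \<in> V}"
proof -
  have "continuous_on A (\<phi> s)"
    by (rule cont_flow) (auto intro: continuous_intros)
  then have "openin (top_of_set A) (A \<inter> \<phi> s -` V)"
    using flow_in by (intro continuous_openin_preimage[OF _ _ assms]) auto
  then show ?thesis
    by (simp add: vimage_def Collect_conj_eq)
qed

text \<open>Flowing to the midpoint of the time window reduces it to the symmetric window of
  \<open>flow_box\<close>.\<close>

lemma hit_openin:
  assumes "openin (top_of_set K) C"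
  shows "openin (top_of_set A) {z\<in>A. \<exists>t. a < t \<and> t < b \<and> \<phi> t z \<in> C}"
proof -
  define m where "m = (a + b) / 2"
  have "{z\<in>A. \<exists>t. a < t \<and> t < b \<and> \<phi> t z \<in> C} =
    {z\<in>A. \<phi> m z \<in> {z\<in>A. \<exists>t. \<bar>t\<bar> < (b - a) / 2 \<and> \<phi> t z \<in> C}}"
  proof (intro Collect_cong conj_cong refl)
    fix z assume z: "z \<in> A"
    show "(\<exists>t. a < t \<and> t < b \<and> \<phi> t z \<in> C) \<longleftrightarrow>
      \<phi> m z \<in> {z\<in>A. \<exists>t. \<bar>t\<bar> < (b - a) / 2 \<and> \<phi> t z \<in> C}"
    proof
      assume "\<exists>t. a < t \<and> t < b \<and> \<phi> t z \<in> C"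
      then obtain t where t: "a < t" "t < b" "\<phi> t z \<in> C"
        by blast
      then have "\<bar>t - m\<bar> < (b - a) / 2" "\<phi> (t - m) (\<phi> m z) \<in> C"
        using flow_add[OF z, of "t - m" m] unfolding m_def by (auto simp: abs_less_iff field_simps)
      then show "\<phi> m z \<in> {z\<in>A. \<exists>t. \<bar>t\<bar> < (b - a) / 2 \<and> \<phi> t z \<in> C}"
        using flow_in[OF z] by blast
    next
      assume "\<phi> m z \<in> {z\<in>A. \<exists>t. \<bar>t\<bar> < (b - a) / 2 \<and> \<phi> t z \<in> C}"
      then obtain t where t: "\<bar>t\<bar> < (b - a) / 2" "\<phi> t (\<phi> m z) \<in> C"
        by blast
      then have "a < t + m" "t + m < b" "\<phi> (t + m) z \<in> C"
        using flow_add[OF z, of t m] unfolding m_def by (auto simp: abs_less_iff field_simps)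
      then show "\<exists>t. a < t \<and> t < b \<and> \<phi> t z \<in> C"
        by blast
    qed
  qed
  then show ?thesis
    using flow_openin[OF flow_box[OF assms]] by (simp only:)
qed

lemma hits:
  assumes "openin (top_of_set K) C" "x0 \<in> C" "x \<in> A"
  shows "\<exists>t>0. \<phi> t x \<in> C"
proof -
  let ?U = "{z\<in>A. \<exists>t. \<bar>t\<bar> < 1 \<and> \<phi> t z \<in> C}"
  have "x0 \<in> ?U"
    using x0 assms flow_0[OF x0] by (auto intro!: exI[of _ 0])
  \<comment> \<open>Starting from \<open>\<phi> 1 x\<close> compensates for the window
    \<open>\<bar>s\<bar> < 1\<close>, so the total time stays positive.\<close>
  then obtain t where t: "t > 0" "\<phi> t (\<phi> 1 x) \<in> ?U"
    using dense[OF flow_box[OF assms(1)] _ flow_in[OF assms(3)]] by blast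
  then obtain s where s: "\<bar>s\<bar> < 1" "\<phi> s (\<phi> t (\<phi> 1 x)) \<in> C"
    by blast
  then have "\<phi> (s + (t + 1)) x \<in> C"
    using flow_add[OF assms(3)] by simp
  moreover have "0 < s + (t + 1)"
    using s(1) t(1) by linarith
  ultimately show ?thesis
    by blast
qed

lemma hits_bounded: "\<exists>N>0. \<forall>x\<in>A. \<exists>t. 0 < t \<and> t < N \<and> \<phi> t x \<in> K"
proof -
  define U where "U n = {x\<in>A. \<exists>t. 0 < t \<and> t < real n \<and> \<phi> t x \<in> K}" for n
  have "\<forall>V\<in>range U. openin (top_of_set A) V"
    unfolding U_def using hit_openin[OF openin_subtopology_self] by auto
  moreover have "A \<subseteq> \<Union>(range U)"
  proof
    fix x assume x: "x \<in> A"
    obtain t where t: "t > 0" "\<phi> t x \<in> K"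
      using hits[OF openin_subtopology_self x0_in x] by blast
    obtain n where "t < real n"
      using reals_Archimedean2 by blast
    then show "x \<in> \<Union>(range U)"
      using t x unfolding U_def by blast
  qed
  ultimately obtain F where F: "F \<subseteq> range U" "finite F" "A \<subseteq> \<Union>F"
    using compact_A unfolding compact_eq_openin_cover by metis
  then obtain I where I: "finite I" "F = U ` I"
    using finite_subset_image[OF F(2,1)] by blast
  define N where "N = real (Max (insert 1 I))"
  have "\<exists>t. 0 < t \<and> t < N \<and> \<phi> t x \<in> K" if x: "x \<in> A" for x
  proof -
    obtain i where i: "i \<in> I" "x \<in> U i"
      using F(3) x unfolding I(2) by blast
    then have "real i \<le> N"
      unfolding N_def using I(1) by simp
    then show ?thesis
      using i(2) unfolding U_def by force
  qed
  moreover have "1 \<le> Max (insert 1 I)"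
    using I(1) by simp
  then have "0 < N"
    unfolding N_def by simp
  ultimately show ?thesis
    by blast
qed

text \<open>The bound \<open>\<epsilon>\<close> in place of 0 makes the set of times closed, so the
  infimum is attained; by \<open>hit_gt\<close> no positive visit is lost.\<close>

definition R :: "'b \<Rightarrow> real" where
  "R y = Inf {t. \<epsilon> \<le> t \<and> \<phi> t y \<in> K}"

lemma closed_hits: "x \<in> A \<Longrightarrow> closed {t. \<phi> t x \<in> K}"
proof -
  assume "x \<in> A"
  then have "continuous_on UNIV (\<lambda>t. \<phi> t x)"
    by (intro cont_flow continuous_intros) auto
  then have "closed ((\<lambda>t. \<phi> t x) -` K)"
    using compact_imp_closed[OF compact_K] by (rule closed_vimage[rotated])
  then show ?thesis
    by (simp add: vimage_def)
qed

lemma hit_gt: "y \<in> K \<Longrightarrow> 0 < t \<Longrightarrow> \<phi> t y \<in> K \<Longrightarrow> \<epsilon> < t"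
  using isolated_hit[of y t] by (cases "t \<le> \<epsilon>") auto

lemma R_props:
  assumes y: "y \<in> K"
  shows "\<epsilon> \<le> R y" "\<phi> (R y) y \<in> K" "0 < t \<Longrightarrow> \<phi> t y \<in> K \<Longrightarrow> R y \<le> t"
proof -
  let ?H = "{t. \<epsilon> \<le> t \<and> \<phi> t y \<in> K}"
  have bdd: "bdd_below ?H"
    by (rule bdd_belowI[of _ \<epsilon>]) auto
  obtain s where "s > 0" "\<phi> s y \<in> K"
    using hits[OF openin_subtopology_self x0_in in_A[OF y]] by blast
  then have "s \<in> ?H"
    using hit_gt[OF y, of s] by simp
  moreover have "closed ?H"
    using closed_Int[OF closed_atLeast[of \<epsilon>] closed_hits[OF in_A[OF y]]] by (simp add: atLeast_def Collect_conj_eq)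
  ultimately have "Inf ?H \<in> ?H"
    using closed_contains_Inf[OF _ bdd] by blast
  then show "\<epsilon> \<le> R y" "\<phi> (R y) y \<in> K"
    unfolding R_def by auto
  show "R y \<le> t" if "0 < t" "\<phi> t y \<in> K"
    unfolding R_def using hit_gt[OF y, of t] that by (intro cInf_lower[OF _ bdd]) auto
qed

text \<open>An early visit persists nearby, which gives upper semicontinuity. The visits during a
  compact time interval form a compact set, which gives lower semicontinuity.\<close>

lemma R_cont: "continuous_on K R"
proof -
  have "openin (top_of_set K) {y\<in>K. R y < a}" for a
  proof -
    have "{y\<in>K. R y < a} = K \<inter> {z\<in>A. \<exists>t. 0 < t \<and> t < a \<and> \<phi> t z \<in> K}"
    proof (intro equalityI subsetI)
      fix y assume y: "y \<in> {y\<in>K. R y < a}"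
      then have "0 < R y" "R y < a" "\<phi> (R y) y \<in> K" "y \<in> A" "y \<in> K"
        using R_props[of y] \<epsilon>_pos in_A by auto
      then show "y \<in> K \<inter> {z\<in>A. \<exists>t. 0 < t \<and> t < a \<and> \<phi> t z \<in> K}"
        by blast
    next
      fix y assume "y \<in> K \<inter> {z\<in>A. \<exists>t. 0 < t \<and> t < a \<and> \<phi> t z \<in> K}"
      then obtain t where "y \<in> K" "0 < t" "t < a" "\<phi> t y \<in> K"
        by blast
      then show "y \<in> {y\<in>K. R y < a}"
        using R_props(3)[of y t] by simp
    qed
    moreover have "openin (top_of_set K) (K \<inter> {z\<in>A. \<exists>t. 0 < t \<and> t < a \<and> \<phi> t z \<in> K})"
      by (rule openin_Int_subset[OF K_sub hit_openin[OF openin_subtopology_self]])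
    ultimately show ?thesis
      by simp
  qed
  moreover have "openin (top_of_set K) {y\<in>K. R y > a}" for a
  proof -
    let ?Z = "({\<epsilon>..a} \<times> K) \<inter> (\<lambda>z. \<phi> (fst z) (snd z)) -` K"
    have "continuous_on ({\<epsilon>..a} \<times> K) (\<lambda>z. \<phi> (fst z) (snd z))"
      using K_sub by (intro continuous_intros) auto
    then have "closedin (top_of_set ({\<epsilon>..a} \<times> K)) ?Z"
      using compact_imp_closed[OF compact_K] by (rule continuous_closedin_preimage)
    then have "compact ?Z"
      using closedin_compact[of "{\<epsilon>..a} \<times> K"] compact_Times[OF compact_Icc compact_K] by blast
    then have "closed (snd ` ?Z)"
      by (intro compact_imp_closed compact_continuous_image continuous_on_snd continuous_on_id)
    moreover have "{y\<in>K. R y > a} = K - snd ` ?Z"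
    proof -
      have "R y \<le> a \<longleftrightarrow> y \<in> snd ` ?Z" if y: "y \<in> K" for y
      proof
        assume "R y \<le> a"
        then have "(R y, y) \<in> ?Z"
          using R_props(1,2)[OF y] y by auto
        then show "y \<in> snd ` ?Z"
          by force
      next
        assume "y \<in> snd ` ?Z"
        then obtain t where "\<epsilon> \<le> t" "t \<le> a" "\<phi> t y \<in> K"
          by auto
        then show "R y \<le> a"
          using R_props(3)[OF y, of t] \<epsilon>_pos by linarith
      qed
      then show ?thesis
        by (auto simp: not_le[symmetric])
    qed
    ultimately show ?thesis
      by (simp add: Diff_eq openin_open_Int open_Compl)
  qed
  ultimately have "continuous_map (top_of_set K) euclidean R"
    unfolding continuous_map_upper_lower_semicontinuous_lt by simp
  then show ?thesis
    by simp
qed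

lemma covers:
  assumes x: "x \<in> A"
  shows "\<exists>y\<in>K. \<exists>t. 0 \<le> t \<and> t < R y \<and> x = \<phi> t y"
proof -
  obtain N where N: "N > 0" "\<forall>x\<in>A. \<exists>t. 0 < t \<and> t < N \<and> \<phi> t x \<in> K"
    using hits_bounded by blast
  let ?H = "{t. 0 \<le> t \<and> \<phi> (- t) x \<in> K}"
  \<comment> \<open>Flowing forward from the point \<open>N\<close> units back produces a visit
    before time 0, so the set of past visits is nonempty; its latest member is the required section
    point.\<close>
  obtain t where t: "0 < t" "t < N" "\<phi> t (\<phi> (- N) x) \<in> K"
    using N flow_in[OF x] by blast
  then have ne: "N - t \<in> ?H"
    using flow_add[OF x, of t "- N"] by simp
  have bdd: "bdd_below ?H"
    by (rule bdd_belowI[of _ 0]) auto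
  have clo: "closed ?H"
  proof -
    have "closed (uminus ` {t. \<phi> t x \<in> K})"
      using closed_negations[OF closed_hits[OF x]] by (simp add: image_def)
    moreover have "uminus ` {t. \<phi> t x \<in> K} = {t. \<phi> (- t) x \<in> K}"
      by (force simp: image_iff intro: exI[of _ "- _"])
    ultimately show ?thesis
      using closed_Int[OF closed_atLeast[of 0]] by (simp add: atLeast_def Collect_conj_eq)
  qed
  have Inf: "Inf ?H \<in> ?H"
    by (rule closed_contains_Inf[OF _ bdd clo]) (use ne in blast)
  define s where "s = Inf ?H"
  define y where "y = \<phi> (- s) x"
  have s: "0 \<le> s" "y \<in> K"
    using Inf unfolding s_def y_def by auto
  have xy: "x = \<phi> s y"
    unfolding y_def using flow_minus(2)[OF x] by simp
  moreover have "s < R y"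
  proof (rule ccontr)
    assume "\<not> s < R y"
    then have "s - R y \<in> ?H"
      using R_props(2)[OF s(2)] flow_add[OF x, of "R y" "- s"] unfolding y_def by simp
    then have "s \<le> s - R y"
      unfolding s_def using cInf_lower[OF _ bdd] by blast
    then show False
      using R_props(1)[OF s(2)] \<epsilon>_pos by linarith
  qed
  ultimately show ?thesis
    using s by blast
qed

lemma cross_section_exists: "\<exists>D. cross_section A \<phi> K R D x0"
proof -
  obtain D :: "nat \<Rightarrow> 'b set" where D: "\<And>n. openin (top_of_set K) (D n)" "\<And>n. closedin (top_of_set K) (D n)"
    "\<And>x y. x \<in> K \<Longrightarrow> y \<in> K \<Longrightarrow> x \<noteq> y \<Longrightarrow> \<exists>n. x \<in> D n \<longleftrightarrow> y \<notin> D n"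
    using clopen_separated_countable[OF separated] by blast
  have "cross_section A \<phi> K R D x0"
  proof
    show "locally_const K (\<lambda>x. x \<in> D n)" for n
      using locally_const_clopen D(1,2) by blast
    show "\<phi> t y \<notin> K" if "y \<in> K" "0 < t" "t < R y" for t y
      using R_props(3)[OF that(1,2)] that(3) by auto
    show "0 < R y" if "y \<in> K" for y
      using R_props(1)[OF that] \<epsilon>_pos by linarith
  qed (use compact_K K_sub x0_in R_cont R_props(2) covers D(3) hits in auto)
  then show ?thesis
    by blast
qed

end

section \<open>A transversal through the base point\<close>

context dense_flow
begin

lemma transversal_exists:
  "\<exists>K \<epsilon>. transversal A \<phi> x0 K \<epsilon> \<and>
    ((\<exists>P>0. \<phi> P x0 = x0) \<longrightarrow> (\<exists>P>0. \<phi> P x0 = x0 \<and> (\<forall>t. 0 < t \<and> t < P \<longrightarrow> \<phi> t x0 \<notin> K)))"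
proof -
  obtain F :: "'b \<Rightarrow> real" and r \<epsilon> where F: "continuous_on A F" and r: "0 < r" and \<epsilon>: "0 < \<epsilon>"
    and inc: "\<And>x a b. x \<in> A \<Longrightarrow> dist x x0 \<le> r \<Longrightarrow> -\<epsilon> \<le> a \<Longrightarrow> a < b \<Longrightarrow> b \<le> \<epsilon> \<Longrightarrow> F (\<phi> a x) < F (\<phi> b x)"
    using increasing_function by blast
  \<comment> \<open>The closed ball makes \<open>S\<close> compact, but an orbit may leave the ball
    near its rim without meeting \<open>S\<close>. Hence only a clopen piece of \<open>S\<close>
    inside the open ball is kept later.\<close>
  define S where "S = {x\<in>A. dist x x0 \<le> r \<and> F x = F x0}"
  have S_sub: "S \<subseteq> A"
    unfolding S_def by blast
  have x0S: "x0 \<in> S"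
    unfolding S_def using x0 r by simp
  have "closedin (top_of_set A) (A \<inter> F -` {F x0})"
    using F by (intro continuous_closedin_preimage) auto
  then have "compact (A \<inter> F -` {F x0})"
    using closedin_compact[OF compact_A] by blast
  then have "compact (A \<inter> F -` {F x0} \<inter> cball x0 r)"
    by (rule compact_Int_closed[OF _ closed_cball])
  moreover have "A \<inter> F -` {F x0} \<inter> cball x0 r = S"
    unfolding S_def by (auto simp: dist_commute)
  ultimately have S_compact: "compact S"
    by simp
  have S_hit: "t = 0" if "y \<in> S" "\<phi> t y \<in> S" "\<bar>t\<bar> \<le> \<epsilon>" for t y
  proof -
    have "\<not> 0 < t" "\<not> t < 0"
      using inc[of y 0 t] inc[of y t 0] that flow_0[of y] \<epsilon> unfolding S_def by auto
    then show ?thesis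
      by simp
  qed
  have "inj_on (\<lambda>(x, t). \<phi> t x) (S \<times> {-(\<epsilon> / 2)..\<epsilon> / 2})"
  proof (rule inj_onI, clarify)
    fix x s y t assume x: "x \<in> S" "y \<in> S" and st: "s \<in> {-(\<epsilon> / 2)..\<epsilon> / 2}" "t \<in> {-(\<epsilon> / 2)..\<epsilon> / 2}"
      and eq: "\<phi> s x = \<phi> t y"
    have y: "\<phi> (s - t) x = y"
      using flow_add[of x "- t" s] flow_minus(1)[of y t] eq subsetD[OF S_sub x(1)] subsetD[OF S_sub x(2)]
      by simp
    then have "s - t = 0"
      using S_hit[OF x(1), of "s - t"] x(2) st by auto
    then show "x = y \<and> s = t"
      using y flow_0[of x] x(1) S_sub by auto
  qed
  then have sep: "clopen_separated S"
    using thin[OF S_compact S_sub, of "\<epsilon> / 2"] \<epsilon> by simp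
  \<comment> \<open>For periodic \<open>x0\<close> the set \<open>W\<close> removes all further
    points where the orbit meets \<open>S\<close> during a period, so that the first return of
    \<open>x0\<close> will be \<open>x0\<close> itself.\<close>
  obtain W where W: "open W" "x0 \<in> W" and per: "(\<exists>P>0. \<phi> P x0 = x0) \<Longrightarrow>
      (\<exists>P>0. \<phi> P x0 = x0 \<and> (\<forall>t. 0 < t \<and> t < P \<longrightarrow> \<phi> t x0 \<notin> S \<inter> W))"
  proof (cases "\<exists>P>0. \<phi> P x0 = x0")
    case False
    then show thesis
      using that[of UNIV] by blast
  next
    case True
    let ?H = "{t. \<epsilon> \<le> t \<and> \<phi> t x0 = x0}"
    define P where "P = Inf ?H"
    have gt: "\<epsilon> < t" if "0 < t" "\<phi> t x0 \<in> S" for t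
      using S_hit[OF x0S that(2)] that(1) by (cases "t \<le> \<epsilon>") auto
    have cont0: "continuous_on T (\<lambda>t. \<phi> t x0)" for T
      using x0 by (intro cont_flow continuous_intros) auto
    have bdd: "bdd_below ?H"
      by (rule bdd_belowI[of _ \<epsilon>]) auto
    have "closed ((\<lambda>t. \<phi> t x0) -` {x0})"
      by (rule closed_vimage[OF closed_singleton cont0])
    then have "closed ({\<epsilon>..} \<inter> (\<lambda>t. \<phi> t x0) -` {x0})"
      by (intro closed_Int) auto
    moreover have "{\<epsilon>..} \<inter> (\<lambda>t. \<phi> t x0) -` {x0} = ?H"
      by auto
    ultimately have clo: "closed ?H"
      by simp
    obtain Q where Q: "0 < Q" "\<phi> Q x0 = x0"
      using True by blast
    then have "Q \<in> ?H"
      using gt[of Q] x0S by simp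
    then have P: "P \<in> ?H"
      unfolding P_def by (intro closed_contains_Inf[OF _ bdd clo]) blast
    have P_min: "P \<le> t" if "0 < t" "\<phi> t x0 = x0" for t
      unfolding P_def using gt[of t] x0S that by (intro cInf_lower[OF _ bdd]) simp
    \<comment> \<open>Visits to \<open>S\<close> are more than \<open>\<epsilon>\<close> apart in
      time, so any visit strictly within a period lies on this compact arc, which misses
      \<open>x0\<close> by minimality of \<open>P\<close>.\<close>
    let ?Z = "(\<lambda>t. \<phi> t x0) ` {\<epsilon>..P - \<epsilon>}"
    have "compact ?Z"
      by (intro compact_continuous_image cont0 compact_Icc)
    then have "open (- ?Z)"
      using compact_imp_closed by blast
    moreover have "x0 \<in> - ?Z"
    proof
      assume "x0 \<in> ?Z"
      then obtain t where "t \<in> {\<epsilon>..P - \<epsilon>}" "x0 = \<phi> t x0"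
        by blast
      then show False
        using P_min[of t] \<epsilon> by simp
    qed
    moreover have "\<phi> t x0 \<notin> S \<inter> (- ?Z)" if t: "0 < t" "t < P" for t
    proof
      assume *: "\<phi> t x0 \<in> S \<inter> (- ?Z)"
      have "\<phi> (P - t) (\<phi> t x0) = x0"
        using flow_add[OF x0, of "P - t" t] P by simp
      then have "\<not> \<bar>P - t\<bar> \<le> \<epsilon>"
        using S_hit[of "\<phi> t x0" "P - t"] * x0S t by auto
      then have "t \<in> {\<epsilon>..P - \<epsilon>}"
        using gt[of t] * t by auto
      then show False
        using * by blast
    qed
    moreover have "0 < P" "\<phi> P x0 = x0"
      using P \<epsilon> by auto
    ultimately show thesis
      by (intro that[of "- ?Z"] exI[of _ P] conjI allI impI) blast+
  qed
  have "openin (top_of_set S) (S \<inter> (ball x0 r \<inter> W))"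
    using W(1) by (intro openin_open_Int open_Int) auto
  then obtain K where K: "openin (top_of_set S) K" "closedin (top_of_set S) K" "x0 \<in> K"
    "K \<subseteq> S \<inter> (ball x0 r \<inter> W)"
    using clopen_separated_nbhd[OF S_compact sep, of _ x0] x0S r W(2) by (metis IntI centre_in_ball)
  \<comment> \<open>Shortly before and after meeting \<open>C\<close> at \<open>y\<close>, the
    function \<open>F\<close> is below and above the level of \<open>S\<close>. Both inequalities
    persist nearby, and the intermediate value theorem yields a crossing of the level; closeness to
    \<open>y\<close> places it in \<open>Q\<close>, hence in \<open>C\<close>.\<close>
  have box: "openin (top_of_set A) {z\<in>A. \<exists>t. \<bar>t\<bar> < \<delta> \<and> \<phi> t z \<in> C}"
    if C: "openin (top_of_set K) C" for C \<delta>
  proof -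
    have "openin (top_of_set S) C"
      using C K(1) openin_trans by blast
    then obtain Q' where Q': "open Q'" "C = S \<inter> Q'"
      unfolding openin_open by blast
    define Q where "Q = Q' \<inter> ball x0 r"
    have Q: "open Q" "C = S \<inter> Q"
      using Q' K(4) openin_imp_subset[OF C] unfolding Q_def by auto
    have Q_r: "dist w x0 \<le> r" if "w \<in> Q" for w
      using that unfolding Q_def by (simp add: dist_commute)
    show ?thesis
    proof (subst openin_subopen, intro ballI)
      fix z assume "z \<in> {z\<in>A. \<exists>t. \<bar>t\<bar> < \<delta> \<and> \<phi> t z \<in> C}"
      then obtain s where z: "z \<in> A" and s: "\<bar>s\<bar> < \<delta>" "\<phi> s z \<in> C"
        by blast
      define y where "y = \<phi> s z"
      have y: "y \<in> A" "y \<in> S" "y \<in> Q"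
        using s Q(2) S_sub unfolding y_def by auto
      obtain e where e: "e > 0" "ball y e \<subseteq> Q"
        using Q(1) y(3) open_contains_ball by blast
      have "\<exists>d>0. \<forall>p\<in>UNIV \<times> A. dist p (0, y) < d \<longrightarrow>
          dist (case p of (t, x) \<Rightarrow> \<phi> t x) (case (0, y) of (t, x) \<Rightarrow> \<phi> t x) < e"
        using cont e(1) y(1) unfolding continuous_on_iff by (metis SigmaI UNIV_I)
      then obtain d where d: "d > 0" "\<And>p. p \<in> UNIV \<times> A \<Longrightarrow> dist p (0, y) < d \<Longrightarrow>
          dist (case p of (t, x) \<Rightarrow> \<phi> t x) y < e"
        using flow_0[OF y(1)] by auto
      have in_Q: "\<phi> t w \<in> Q" if "w \<in> A" "\<bar>t\<bar> < d / 2" "dist w y < d / 2" for t w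
      proof -
        have "dist (t, w) (0, y) \<le> \<bar>t\<bar> + dist w y"
          unfolding dist_prod_def using sqrt_sum_squares_le_sum[of "\<bar>t\<bar>" "dist w y"] by simp
        then have "dist (\<phi> t w) y < e"
          using d(2)[of "(t, w)"] that by simp
        then show ?thesis
          using e(2) by (auto simp: dist_commute)
      qed
      define \<eta> where "\<eta> = min (min (\<delta> - \<bar>s\<bar>) \<epsilon>) (d / 2) / 2"
      have \<eta>: "0 < \<eta>" "\<eta> < \<delta> - \<bar>s\<bar>" "\<eta> \<le> \<epsilon>" "\<eta> < d / 2"
        using s(1) \<epsilon> d(1) unfolding \<eta>_def by auto
      have Fc: "continuous_on A (\<lambda>w. F (\<phi> t w))" for t
        by (rule continuous_on_compose2[OF F cont_flow]) (use flow_in in \<open>auto intro: continuous_intros\<close>)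
      define V1 where "V1 = (A \<inter> (\<lambda>w. F (\<phi> (- \<eta>) w)) -` {..<F x0}) \<inter>
        ((A \<inter> (\<lambda>w. F (\<phi> \<eta> w)) -` {F x0<..}) \<inter> (A \<inter> ball y (d / 2)))"
      have "openin (top_of_set A) V1"
        unfolding V1_def
        by (intro openin_Int continuous_openin_preimage_gen Fc openin_open_Int) auto
      moreover have "continuous_on A (\<phi> s)"
        by (rule cont_flow) (auto intro: continuous_intros)
      ultimately have V: "openin (top_of_set A) (A \<inter> \<phi> s -` V1)"
        using flow_in by (intro continuous_openin_preimage[of A "\<phi> s" A]) auto
      have "F (\<phi> (- \<eta>) y) < F x0" "F x0 < F (\<phi> \<eta> y)"
        using inc[of y "- \<eta>" 0] inc[of y 0 \<eta>] \<eta> \<epsilon> y flow_0[of y] unfolding S_def by auto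
      then have "y \<in> V1"
        unfolding V1_def using y(1) d(1) by simp
      then have zV: "z \<in> A \<inter> \<phi> s -` V1"
        using z unfolding y_def by simp
      have "\<exists>t. \<bar>t\<bar> < \<delta> \<and> \<phi> t z' \<in> C" if z': "z' \<in> A" "\<phi> s z' \<in> V1" for z'
      proof -
        define w where "w = \<phi> s z'"
        have w: "w \<in> A" "F (\<phi> (- \<eta>) w) < F x0" "F x0 < F (\<phi> \<eta> w)" "dist w y < d / 2"
          using z'(2) unfolding w_def[symmetric] V1_def by (auto simp: dist_commute)
        have "continuous_on {- \<eta>..\<eta>} (\<lambda>t. F (\<phi> t w))"
          by (rule continuous_on_compose2[OF F cont_flow])
            (use w(1) flow_in in \<open>auto intro: continuous_intros\<close>)
        then obtain t where t: "- \<eta> \<le> t" "t \<le> \<eta>" "F (\<phi> t w) = F x0"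
          using IVT'[of "\<lambda>t. F (\<phi> t w)" "- \<eta>" "F x0" \<eta>] w(2,3) \<eta>(1) by auto
        then have "\<phi> t w \<in> Q"
          using in_Q[OF w(1), of t] w(4) \<eta>(4) by auto
        then have "\<phi> t w \<in> C"
          using Q(2) Q_r[of "\<phi> t w"] t(3) flow_in[OF w(1)] unfolding S_def by auto
        then have "\<phi> (t + s) z' \<in> C"
          using flow_add[OF z'(1), of t s] unfolding w_def by simp
        moreover have "\<bar>t + s\<bar> < \<delta>"
          using t \<eta>(2) by linarith
        ultimately show ?thesis
          by blast
      qed
      then show "\<exists>U. openin (top_of_set A) U \<and> z \<in> U \<and> U \<subseteq> {z\<in>A. \<exists>t. \<bar>t\<bar> < \<delta> \<and> \<phi> t z \<in> C}"
        using V zV by (intro exI[of _ "A \<inter> \<phi> s -` V1"]) auto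
    qed
  qed
  have K_S: "K \<subseteq> S" "K \<subseteq> W"
    using K(4) by auto
  have "transversal A \<phi> x0 K \<epsilon>"
  proof
    show "compact K"
      using closedin_compact[OF S_compact K(2)] .
    show "clopen_separated K"
      by (rule clopen_separated_subset[OF sep K_S(1)])
    show "t = 0" if "y \<in> K" "\<phi> t y \<in> K" "\<bar>t\<bar> \<le> \<epsilon>" for y t
      using S_hit[of y t] K_S that by blast
  qed (use K_S S_sub K(3) \<epsilon> box in auto)
  moreover have "(\<exists>P>0. \<phi> P x0 = x0) \<longrightarrow>
      (\<exists>P>0. \<phi> P x0 = x0 \<and> (\<forall>t. 0 < t \<and> t < P \<longrightarrow> \<phi> t x0 \<notin> K))"
  proof
    assume periodic: "\<exists>P>0. \<phi> P x0 = x0"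
    obtain P where P: "P > 0" "\<phi> P x0 = x0" "\<forall>t. 0 < t \<and> t < P \<longrightarrow> \<phi> t x0 \<notin> S \<inter> W"
      using per[OF periodic] by (elim exE conjE) (rule that)
    then have "\<forall>t. 0 < t \<and> t < P \<longrightarrow> \<phi> t x0 \<notin> K"
      using K_S by (metis IntI subsetD)
    then show "\<exists>P>0. \<phi> P x0 = x0 \<and> (\<forall>t. 0 < t \<and> t < P \<longrightarrow> \<phi> t x0 \<notin> K)"
      using P(1,2) by (intro exI[of _ P] conjI)
  qed
  ultimately show ?thesis
    by (intro exI[of "\<lambda>K. \<exists>\<epsilon>. _ K \<epsilon>" K]) (rule exI[of _ \<epsilon>], rule conjI)
qed

lemma section_exists:
  "\<exists>K R D. cross_section A \<phi> K R D x0 \<and> ((\<exists>P>0. \<phi> P x0 = x0) \<longrightarrow> \<phi> (R x0) x0 = x0)"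
proof -
  obtain K \<epsilon> where tr: "transversal A \<phi> x0 K \<epsilon>" and per: "(\<exists>P>0. \<phi> P x0 = x0) \<longrightarrow>
      (\<exists>P>0. \<phi> P x0 = x0 \<and> (\<forall>t. 0 < t \<and> t < P \<longrightarrow> \<phi> t x0 \<notin> K))"
    using transversal_exists by blast
  interpret transversal A \<phi> x0 K \<epsilon>
    by (rule tr)
  obtain D where "cross_section A \<phi> K R D x0"
    using cross_section_exists by blast
  moreover have "\<phi> (R x0) x0 = x0" if periodic: "\<exists>P>0. \<phi> P x0 = x0"
  proof -
    obtain P where P: "P > 0" "\<phi> P x0 = x0" "\<forall>t. 0 < t \<and> t < P \<longrightarrow> \<phi> t x0 \<notin> K"
      using mp[OF per periodic] by (elim exE conjE) (rule that)
    have "R x0 \<le> P"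
      using R_props(3)[OF x0_in P(1)] P(2) x0_in by simp
    moreover have "\<not> R x0 < P"
      using P(3) R_props(1,2)[OF x0_in] \<epsilon>_pos by (meson less_le_trans)
    ultimately show ?thesis
      using P(2) by simp
  qed
  ultimately show ?thesis
    by blast
qed

end

subsection \<open>One-dimensional spaces contain no thick products\<close>

lemma clamp_fixpoint_zero:
  fixes a b s f :: real
  assumes "a \<le> b" "s = max a (min b (s - f))" "s = a \<Longrightarrow> f < 0" "s = b \<Longrightarrow> 0 < f"
  shows "f = 0"
  using assms by (auto simp: max_def min_def split: if_splits)

text \<open>Brouwer's theorem is applied to \<open>z - F z\<close> clamped to the rectangle. On each
  side the sign of \<open>F\<close> points the move inwards, so clamping creates no fixed point and
  the one found is a zero of \<open>F\<close>.\<close>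

lemma poincare_miranda:
  fixes F :: "real \<times> real \<Rightarrow> real \<times> real"
  assumes n: "0 \<le> n" and cont: "continuous_on ({0..n} \<times> {-1..1}) F"
    and left: "\<And>t. -1 \<le> t \<Longrightarrow> t \<le> 1 \<Longrightarrow> fst (F (0, t)) < 0"
    and right: "\<And>t. -1 \<le> t \<Longrightarrow> t \<le> 1 \<Longrightarrow> 0 < fst (F (n, t))"
    and bottom: "\<And>s. 0 \<le> s \<Longrightarrow> s \<le> n \<Longrightarrow> snd (F (s, -1)) < 0"
    and top: "\<And>s. 0 \<le> s \<Longrightarrow> s \<le> n \<Longrightarrow> 0 < snd (F (s, 1))"
  obtains z where "z \<in> {0..n} \<times> {-1..1}" "F z = 0"
proof -
  let ?B = "{0..n} \<times> {-1..1::real}"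
  define g where "g z = (max 0 (min n (fst z - fst (F z))), max (-1) (min 1 (snd z - snd (F z))))" for z
  have "continuous_on ?B g"
    unfolding g_def using cont by (intro continuous_intros)
  moreover have "g \<in> ?B \<rightarrow> ?B"
    unfolding g_def using n by auto
  moreover have "compact ?B" "convex ?B" "?B \<noteq> {}"
    using n by (auto intro: compact_Times convex_Times)
  ultimately obtain z where z: "z \<in> ?B" "g z = z"
    using brouwer[of ?B g] by blast
  obtain s t where st: "z = (s, t)"
    by (cases z)
  have b: "0 \<le> s" "s \<le> n" "-1 \<le> t" "t \<le> 1"
    using z(1) st by auto
  have "fst (F z) = 0"
  proof (rule clamp_fixpoint_zero[of 0 n s])
    show "s = max 0 (min n (s - fst (F z)))"
      using z(2) unfolding st g_def by simp
    show "s = 0 \<Longrightarrow> fst (F z) < 0" "s = n \<Longrightarrow> 0 < fst (F z)"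
      using left[of t] right[of t] b unfolding st by auto
  qed (rule n)
  moreover have "snd (F z) = 0"
  proof (rule clamp_fixpoint_zero[of "-1" 1 t])
    show "t = max (-1) (min 1 (t - snd (F z)))"
      using z(2) unfolding st g_def by simp
    show "t = -1 \<Longrightarrow> snd (F z) < 0" "t = 1 \<Longrightarrow> 0 < snd (F z)"
      using bottom[of s] top[of s] b unfolding st by auto
  qed simp
  ultimately have "F z = 0"
    by (simp add: prod_eq_iff)
  then show thesis
    using that z(1) by blast
qed

text \<open>A chain of small steps from \<open>a\<close> to \<open>b\<close> in \<open>S\<close> would produce, by interpolation, a map of a
  rectangle contradicting the Poincare--Miranda theorem; hence the points reachable from \<open>a\<close> by
  such chains form a clopen set without \<open>b\<close>.\<close>

lemma nonvanishing_imp_separated: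
  fixes S :: "'b::metric_space set" and f :: "'b \<times> real \<Rightarrow> real \<times> real"
  assumes S: "compact S" and ab: "a \<in> S" "b \<in> S"
    and f: "continuous_on (S \<times> {-1..1}) f" "\<And>p. p \<in> S \<times> {-1..1} \<Longrightarrow> f p \<noteq> 0"
    and left: "\<And>t. -1 \<le> t \<Longrightarrow> t \<le> 1 \<Longrightarrow> fst (f (a, t)) < 0"
    and right: "\<And>t. -1 \<le> t \<Longrightarrow> t \<le> 1 \<Longrightarrow> 0 < fst (f (b, t))"
    and bottom: "\<And>x. x \<in> S \<Longrightarrow> snd (f (x, -1)) < 0"
    and top: "\<And>x. x \<in> S \<Longrightarrow> 0 < snd (f (x, 1))"
  shows "\<exists>D. openin (top_of_set S) D \<and> closedin (top_of_set S) D \<and> a \<in> D \<and> b \<notin> D"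
proof -
  have SI: "compact (S \<times> {-1..1::real})"
    by (intro compact_Times S compact_Icc)
  obtain p0 where p0: "p0 \<in> S \<times> {-1..1}" "\<forall>p\<in>S \<times> {-1..1}. norm (f p0) \<le> norm (f p)"
    using continuous_attains_inf[OF SI _ continuous_on_norm[OF f(1)]] ab(1) by fastforce
  define \<eta> where "\<eta> = norm (f p0)"
  have \<eta>: "0 < \<eta>" "\<And>p. p \<in> S \<times> {-1..1} \<Longrightarrow> \<eta> \<le> norm (f p)"
    using f(2)[OF p0(1)] p0(2) unfolding \<eta>_def by auto
  obtain \<delta> where \<delta>: "\<delta> > 0" "\<And>p p'. p \<in> S \<times> {-1..1} \<Longrightarrow> p' \<in> S \<times> {-1..1} \<Longrightarrow> dist p' p < \<delta> \<Longrightarrow>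
      dist (f p') (f p) < \<eta> / 2"
    using compact_uniformly_continuous[OF f(1) SI] \<eta>(1) half_gt_zero[OF \<eta>(1)]
    unfolding uniformly_continuous_on_def by metis
  define r where "r = {(x, y). x \<in> S \<and> y \<in> S \<and> dist x y < \<delta>}"
  have no_chain: "(a, b) \<notin> r\<^sup>*"
  proof
    assume "(a, b) \<in> r\<^sup>*"
    then obtain n where "(a, b) \<in> r ^^ n"
      using rtrancl_imp_relpow by blast
    then obtain c where c: "c 0 = a" "c n = b" "\<And>i. i < n \<Longrightarrow> (c i, c (Suc i)) \<in> r"
      unfolding relpow_fun_conv by blast
    have cS: "c i \<in> S" if "i \<le> n" for i
      using that ab c(1,2) c(3)[of i] unfolding r_def by (cases "i = n") auto
    define w :: "nat \<Rightarrow> real \<Rightarrow> real" where "w i s = max 0 (1 - \<bar>s - real i\<bar>)" for i s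
    define F where "F z = (\<Sum>i\<le>n. w i (fst z) *\<^sub>R f (c i, snd z))" for z
    have w_nn: "0 \<le> w i s" for i s
      unfolding w_def by simp
    have W_pos: "\<exists>i\<le>n. 0 < w i s" if "0 \<le> s" "s \<le> real n" for s
    proof -
      have "real (nat \<lfloor>s\<rfloor>) \<le> s" "s < real (nat \<lfloor>s\<rfloor>) + 1"
        using that by linarith+
      then have "nat \<lfloor>s\<rfloor> \<le> n" "0 < w (nat \<lfloor>s\<rfloor>) s"
        using that unfolding w_def by linarith+
      then show ?thesis
        by blast
    qed
    have F_node: "F (real j, t) = f (c j, t)" if "j \<le> n" for j t
    proof -
      have "w i (real j) = (if i = j then 1 else 0)" for i
      proof (cases "i = j")
        case False
        then have "1 \<le> \<bar>real j - real i\<bar>"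
          by linarith
        then show ?thesis
          using False unfolding w_def by simp
      qed (simp add: w_def)
      then have "F (real j, t) = (\<Sum>i\<le>n. if i = j then f (c i, t) else 0)"
        unfolding F_def by (intro sum.cong) auto
      then show ?thesis
        using that by simp
    qed
    obtain z where z: "z \<in> {0..real n} \<times> {-1..1}" "F z = 0"
    proof (rule poincare_miranda[of "real n" F])
      show "continuous_on ({0..real n} \<times> {-1..1}) F"
        unfolding F_def w_def
      proof (intro continuous_on_sum continuous_on_scaleR)
        fix i assume "i \<in> {..n}"
        then show "continuous_on ({0..real n} \<times> {-1..1}) (\<lambda>z. f (c i, snd z))"
          using cS by (intro continuous_on_compose2[OF f(1)] continuous_intros) auto
      qed (intro continuous_intros)
      show "fst (F (0, t)) < 0" if "-1 \<le> t" "t \<le> 1" for t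
        using F_node[of 0 t] left[OF that] c(1) by simp
      show "0 < fst (F (real n, t))" if "-1 \<le> t" "t \<le> 1" for t
        using F_node[of n t] right[OF that] c(2) by simp
      show "snd (F (s, -1)) < 0" if s: "0 \<le> s" "s \<le> real n" for s
      proof -
        obtain i where i: "i \<le> n" "0 < w i s"
          using W_pos[OF s] by blast
        have "0 < (\<Sum>i\<le>n. w i s * - snd (f (c i, -1)))"
        proof (rule sum_pos2[of _ i])
          show "0 < w i s * - snd (f (c i, -1))"
            using i(2) bottom[OF cS[OF i(1)]] by (intro mult_pos_pos) auto
          show "0 \<le> w j s * - snd (f (c j, -1))" if "j \<in> {..n}" for j
            using bottom[OF cS[of j]] that by (intro mult_nonneg_nonneg w_nn) auto
        qed (use i in auto)
        then show ?thesis
          unfolding F_def by (simp add: snd_sum sum_negf)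
      qed
      show "0 < snd (F (s, 1))" if s: "0 \<le> s" "s \<le> real n" for s
      proof -
        obtain i where i: "i \<le> n" "0 < w i s"
          using W_pos[OF s] by blast
        have "0 < (\<Sum>i\<le>n. w i s * snd (f (c i, 1)))"
        proof (rule sum_pos2[of _ i])
          show "0 < w i s * snd (f (c i, 1))"
            using i(2) top[OF cS[OF i(1)]] by (intro mult_pos_pos) auto
          show "0 \<le> w j s * snd (f (c j, 1))" if "j \<in> {..n}" for j
            using top[OF cS[of j]] that by (intro mult_nonneg_nonneg w_nn) auto
        qed (use i in auto)
        then show ?thesis
          unfolding F_def by (simp add: snd_sum)
      qed
    qed (simp_all)
    obtain s t where st: "z = (s, t)" "0 \<le> s" "s \<le> real n" "-1 \<le> t" "t \<le> 1"
      using z(1) by (cases z) auto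
    \<comment> \<open>At \<open>s\<close> only the nodes \<open>k\<close> and \<open>k + 1\<close>
      can carry weight, and \<open>f\<close> differs there by less than \<open>\<eta> / 2\<close>. A
      zero of \<open>F\<close> would thus force \<open>f (c k, t)\<close> below its minimal norm
      \<open>\<eta>\<close>.\<close>
    define k where "k = nat \<lfloor>s\<rfloor>"
    have k: "real k \<le> s" "s < real k + 1" "k \<le> n"
      using st(2,3) unfolding k_def by linarith+
    have near: "norm (w i s *\<^sub>R (f (c k, t) - f (c i, t))) \<le> w i s * (\<eta> / 2)" if "i \<le> n" for i
    proof (cases "w i s = 0")
      case False
      then have "\<bar>s - real i\<bar> < 1"
        unfolding w_def by (auto simp: max_def split: if_splits)
      then have ik: "i = k \<or> i = Suc k"
        using k by linarith
      have "dist (c k) (c i) < \<delta>"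
      proof (cases "i = k")
        case False
        then show ?thesis
          using c(3)[of k] ik that unfolding r_def by auto
      qed (use \<delta>(1) in simp)
      then have "dist (f (c k, t)) (f (c i, t)) < \<eta> / 2"
        using \<delta>(2)[of "(c i, t)" "(c k, t)"] cS that k(3) st by (simp add: dist_Pair_Pair)
      then have "w i s * norm (f (c k, t) - f (c i, t)) \<le> w i s * (\<eta> / 2)"
        by (intro mult_left_mono w_nn) (simp add: dist_norm)
      then show ?thesis
        using w_nn[of i s] by simp
    qed simp
    define Wt where "Wt = (\<Sum>i\<le>n. w i s)"
    obtain i where "i \<le> n" "0 < w i s"
      using W_pos st(2,3) by blast
    then have Wt: "0 < Wt"
      unfolding Wt_def by (intro sum_pos2[of _ i]) (use w_nn in auto)
    have "Wt *\<^sub>R f (c k, t) = (\<Sum>i\<le>n. w i s *\<^sub>R (f (c k, t) - f (c i, t)))"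
      using z(2) unfolding F_def st(1) Wt_def
      by (simp add: scaleR_diff_right sum_subtractf scaleR_sum_left)
    moreover have "norm (\<Sum>i\<le>n. w i s *\<^sub>R (f (c k, t) - f (c i, t))) \<le> (\<Sum>i\<le>n. w i s * (\<eta> / 2))"
      by (rule sum_norm_le) (rule near, simp)
    ultimately have "norm (Wt *\<^sub>R f (c k, t)) \<le> (\<Sum>i\<le>n. w i s * (\<eta> / 2))"
      by (simp only:)
    also have "\<dots> = Wt * (\<eta> / 2)"
      unfolding Wt_def by (simp add: sum_distrib_right)
    finally have "Wt * norm (f (c k, t)) \<le> Wt * (\<eta> / 2)"
      using Wt by simp
    then have "norm (f (c k, t)) \<le> \<eta> / 2"
      using Wt mult_le_cancel_left_pos by blast
    then show False
      using \<eta>(2)[of "(c k, t)"] cS[OF k(3)] st \<eta>(1) by simp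
  qed
  define D where "D = {z\<in>S. (a, z) \<in> r\<^sup>*}"
  have step: "y \<in> D \<longleftrightarrow> x \<in> D" if "x \<in> S" "y \<in> S" "dist x y < \<delta>" for x y
  proof -
    have "(x, y) \<in> r" "(y, x) \<in> r"
      using that unfolding r_def by (auto simp: dist_commute)
    then show ?thesis
      using that unfolding D_def by (auto intro: rtrancl_into_rtrancl)
  qed
  have "openin (top_of_set S) E" if "E \<subseteq> S" "\<And>x y. x \<in> E \<Longrightarrow> y \<in> S \<Longrightarrow> dist x y < \<delta> \<Longrightarrow> y \<in> E" for E
    unfolding openin_euclidean_subtopology_iff using that \<delta>(1) by (metis dist_commute)
  from this[of D] this[of "S - D"] have "openin (top_of_set S) D" "openin (top_of_set S) (S - D)"
    using step unfolding D_def by blast+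
  moreover have "D \<subseteq> S"
    unfolding D_def by blast
  ultimately have "openin (top_of_set S) D" "closedin (top_of_set S) D"
    by (auto simp: closedin_def)
  moreover have "a \<in> D" "b \<notin> D"
    using ab no_chain unfolding D_def by auto
  ultimately show ?thesis
    by blast
qed

text \<open>A finite union of segments has empty interior in the plane. The point is taken near 0 so
  that using it as the origin does not disturb signs on the sides of the square.\<close>

lemma segments_miss_point:
  fixes Z :: "(real \<times> real) set"
  assumes "finite Z"
  obtains c where "norm c < 1 / 4" "\<And>x y. x \<in> Z \<Longrightarrow> y \<in> Z \<Longrightarrow> c \<notin> closed_segment x y"
proof -
  have "interior (\<Union>((\<lambda>(x, y). closed_segment x y) ` P)) = {}" if "finite P"
    for P :: "((real \<times> real) \<times> (real \<times> real)) set"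
    using that
  proof (induction P)
    case (insert p P)
    have "closed (\<Union>((\<lambda>(x, y). closed_segment x y) ` P))"
      using insert.hyps by (intro closed_UN) (auto simp: case_prod_beta)
    moreover have "interior (case p of (x, y) \<Rightarrow> closed_segment x y) = {}"
      by (cases p) (simp add: interior_closed_segment)
    ultimately have "interior (\<Union>((\<lambda>(x, y). closed_segment x y) ` P) \<union> (case p of (x, y) \<Rightarrow> closed_segment x y)) = {}"
      using interior_closed_Un_empty_interior insert.IH by metis
    then show ?case
      by (simp add: Un_commute)
  qed simp
  from this[of "Z \<times> Z"] have "interior (\<Union>((\<lambda>(x, y). closed_segment x y) ` (Z \<times> Z))) = {}"
    using assms by simp
  moreover have "interior (ball (0::real \<times> real) (1 / 4)) \<noteq> {}"
    by simp
  ultimately have "\<not> ball 0 (1 / 4) \<subseteq> \<Union>((\<lambda>(x, y). closed_segment x y) ` (Z \<times> Z))"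
    using interior_mono by (metis subset_empty)
  then obtain c where "c \<in> ball 0 (1 / 4)" "c \<notin> \<Union>((\<lambda>(x, y). closed_segment x y) ` (Z \<times> Z))"
    by blast
  then show thesis
    using that[of c] by auto
qed
text \<open>A cover in which at most two members meet has a graph as its nerve. Drawn in the plane
  with straight edges, the nerve yields a map of the product that stays near \<open>g\<close>, so
  keeps its signs on the four sides, and misses a point \<open>c\<close> off all edges. With
  \<open>c\<close> as origin, \<open>nonvanishing_imp_separated\<close> applies.\<close>

lemma cov_dim_1_imp_separated:
  fixes A :: "'c::metric_space set" and S :: "'b::metric_space set" and h :: "'b \<times> real \<Rightarrow> 'c"
  assumes dim: "cov_dim_le (top_of_set A) 1" and A: "compact A" and S: "compact S"
    and h: "continuous_on (S \<times> {-1..1}) h" "h ` (S \<times> {-1..1}) \<subseteq> A" "inj_on h (S \<times> {-1..1})"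
  shows "clopen_separated S"
  unfolding clopen_separated_def
proof (intro ballI impI)
  fix a b assume ab: "a \<in> S" "b \<in> S" "a \<noteq> b"
  let ?P = "S \<times> {-1..1::real}"
  define \<Sigma> where "\<Sigma> = h ` ?P"
  \<comment> \<open>A map to the square whose first coordinate is -1 over \<open>a\<close> and 1
    over \<open>b\<close>, and lies between them by the triangle inequality.\<close>
  define g where "g p = ((dist (fst p) a - dist (fst p) b) / dist a b, snd p)" for p :: "'b \<times> real"
  define G where "G = g \<circ> the_inv_into ?P h"
  have d: "0 < dist a b"
    using ab by simp
  have P: "compact ?P"
    by (intro compact_Times S compact_Icc)
  have g_cont: "continuous_on T g" for T
    unfolding g_def using d by (intro continuous_intros) auto
  have G_cont: "continuous_on \<Sigma> G"
    unfolding G_def \<Sigma>_def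
    by (intro continuous_on_compose continuous_on_inv_into[OF h(1) P h(3)] g_cont)
  have Gh: "G (h p) = g p" if "p \<in> ?P" for p
    unfolding G_def using the_inv_into_f_f[OF h(3) that] by simp
  have g_square: "g p \<in> {-1..1} \<times> {-1..1}" if "p \<in> ?P" for p
  proof -
    have "\<bar>dist (fst p) a - dist (fst p) b\<bar> \<le> dist a b"
      by (metis abs_dist_diff_le dist_commute)
    then have "\<bar>(dist (fst p) a - dist (fst p) b) / dist a b\<bar> \<le> 1"
      using d by (simp add: abs_divide)
    then have "-1 \<le> (dist (fst p) a - dist (fst p) b) / dist a b"
      "(dist (fst p) a - dist (fst p) b) / dist a b \<le> 1"
      by linarith+
    then show ?thesis
      using that unfolding g_def by auto
  qed
  have "compact ({-1..1::real} \<times> {-1..1::real})"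
    by (intro compact_Times compact_Icc)
  moreover have "{-1..1::real} \<times> {-1..1::real} \<subseteq> (\<Union>c\<in>UNIV. ball c (1 / 4))"
  proof
    fix z :: "real \<times> real"
    have "z \<in> ball z (1 / 4)"
      by simp
    then show "z \<in> (\<Union>c\<in>UNIV. ball c (1 / 4))"
      by blast
  qed
  ultimately obtain C :: "(real \<times> real) set" where C: "finite C"
    "{-1..1} \<times> {-1..1} \<subseteq> (\<Union>c\<in>C. ball c (1 / 4))"
    using compactE_image[of "{-1..1::real} \<times> {-1..1::real}" UNIV "\<lambda>c. ball c (1 / 4)"]
    by (metis open_ball)
  \<comment> \<open>The part of the preimage of a ball inside \<open>\<Sigma>\<close>, together with
    everything off \<open>\<Sigma>\<close>: this makes the set open in \<open>A\<close> and not
    merely in \<open>\<Sigma>\<close>.\<close>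
  define U where "U c = A - (\<Sigma> \<inter> G -` (- ball c (1 / 4)))" for c
  have \<Sigma>: "compact \<Sigma>" "\<Sigma> \<subseteq> A"
    unfolding \<Sigma>_def using compact_continuous_image[OF h(1) P] h(2) by auto
  have U_open: "openin (top_of_set A) (U c)" for c
  proof -
    have "closedin (top_of_set \<Sigma>) (\<Sigma> \<inter> G -` (- ball c (1 / 4)))"
      by (intro continuous_closedin_preimage G_cont) auto
    then have "closed (\<Sigma> \<inter> G -` (- ball c (1 / 4)))"
      using closedin_compact[OF \<Sigma>(1)] compact_imp_closed by blast
    then show ?thesis
      unfolding U_def Diff_eq by (intro openin_open_Int open_Compl)
  qed
  have U_ball: "g p \<in> ball c (1 / 4)" if "p \<in> ?P" "h p \<in> U c" for p c
    using that Gh[OF that(1)] unfolding U_def \<Sigma>_def by auto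
  have U_cover: "\<Union>(U ` C) = A"
  proof
    show "\<Union>(U ` C) \<subseteq> A"
      unfolding U_def by blast
    show "A \<subseteq> \<Union>(U ` C)"
    proof
      fix y assume y: "y \<in> A"
      obtain c where "c \<in> C" "y \<in> \<Sigma> \<longrightarrow> G y \<in> ball c (1 / 4)"
      proof (cases "y \<in> \<Sigma>")
        case True
        then obtain p where "p \<in> ?P" "y = h p"
          unfolding \<Sigma>_def by blast
        then have "G y \<in> {-1..1} \<times> {-1..1}"
          using Gh g_square by simp
        then have "G y \<in> (\<Union>c\<in>C. ball c (1 / 4))"
          by (rule subsetD[OF C(2)])
        then obtain c where "c \<in> C" "G y \<in> ball c (1 / 4)"
          by (rule UN_E)
        then show thesis
          by (intro that[of c] impI)
      next
        case False
        have "(0, 0) \<in> {-1..1::real} \<times> {-1..1::real}"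
          by simp
        then have "(0, 0) \<in> (\<Union>c\<in>C. ball c (1 / 4))"
          by (rule subsetD[OF C(2)])
        then obtain c where "c \<in> C"
          by (rule UN_E)
        then show thesis
          by (intro that[of c] impI) (use False in \<open>blast+\<close>)
      qed
      then show "y \<in> \<Union>(U ` C)"
        using y unfolding U_def by blast
    qed
  qed
  have "finite (U ` C) \<and> (\<forall>V\<in>U ` C. openin (top_of_set A) V) \<and> \<Union>(U ` C) = topspace (top_of_set A)"
    using C(1) U_open U_cover by simp
  from dim[unfolded cov_dim_le_def, rule_format, OF this]
  obtain \<V> where V: "finite \<V>" "\<forall>V\<in>\<V>. openin (top_of_set A) V" "\<Union>\<V> = A"
    "\<forall>V\<in>\<V>. \<exists>W\<in>U ` C. V \<subseteq> W" "\<forall>x\<in>A. card {V\<in>\<V>. x \<in> V} \<le> 1 + 1"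
    by (simp only: topspace_euclidean_subtopology) (elim exE conjE, rule that)
  have "\<forall>V\<in>\<V>. \<exists>c\<in>C. V \<subseteq> U c"
    using V(4) by blast
  then obtain q where q: "\<And>V. V \<in> \<V> \<Longrightarrow> q V \<in> C \<and> V \<subseteq> U (q V)"
    by metis
  \<comment> \<open>For \<open>V = A\<close> the complement is empty and \<open>infdist\<close>
    would be 0 everywhere, so a positive constant takes its place.\<close>
  define \<rho> where "\<rho> V y = (if V = A then 1 else infdist y (A - V))" for V y
  have \<rho>_cont: "continuous_on T (\<rho> V)" for T V
    unfolding \<rho>_def by (cases "V = A") (auto intro!: continuous_intros)
  have \<rho>_nn: "0 \<le> \<rho> V y" for V y
    unfolding \<rho>_def by (simp add: infdist_nonneg)
  have \<rho>_pos: "0 < \<rho> V y \<longleftrightarrow> y \<in> V" if "V \<in> \<V>" "y \<in> A" for V y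
  proof (cases "V = A")
    case False
    have "V \<subseteq> A"
      using V(2) that(1) openin_imp_subset by blast
    then have ne: "A - V \<noteq> {}"
      using False by blast
    have "closedin (top_of_set A) (A - V)"
      using V(2) that(1) by (intro closedin_diff) auto
    then have "closed (A - V)"
      using closedin_compact[OF A] compact_imp_closed by blast
    then have "infdist y (A - V) = 0 \<longleftrightarrow> y \<in> A - V"
      using in_closed_iff_infdist_zero[OF _ ne] by blast
    then show ?thesis
      using False that(2) infdist_nonneg[of y "A - V"] unfolding \<rho>_def by auto
  qed (use that in \<open>simp add: \<rho>_def\<close>)
  have \<rho>_0: "\<rho> V y = 0" if "V \<in> \<V>" "y \<in> A" "y \<notin> V" for V y
    using \<rho>_pos[OF that(1,2)] \<rho>_nn[of V y] that(3) by force
  obtain c where c: "norm c < 1 / 4" "\<And>x y. x \<in> C \<Longrightarrow> y \<in> C \<Longrightarrow> c \<notin> closed_segment x y"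
    using segments_miss_point[OF C(1)] by blast
  \<comment> \<open>The nerve map minus \<open>c\<close>, multiplied by the total weight; this
    positive factor affects neither zeros nor signs.\<close>
  define f where "f p = (\<Sum>V\<in>\<V>. \<rho> V (h p) *\<^sub>R (q V - c))" for p
  \<comment> \<open>The ball radius 1/4 and the bound 1/4 on \<open>c\<close> add up to 1/2, too
    little to change the sign of a coordinate equal to 1 or -1.\<close>
  have close: "norm ((q V - c) - g p) < 1 / 2" if "p \<in> ?P" "V \<in> \<V>" "h p \<in> V" for p V
  proof -
    have "g p \<in> ball (q V) (1 / 4)"
      using U_ball[OF that(1)] q[OF that(2)] that(3) by blast
    then have "norm (q V - g p) < 1 / 4"
      by (simp add: dist_norm)
    moreover have "norm ((q V - c) - g p) \<le> norm (q V - g p) + norm c"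
      using norm_triangle_ineq4[of "q V - g p" c] by (simp add: algebra_simps)
    ultimately show ?thesis
      using c(1) by simp
  qed
  text \<open>On each face of the square the terms of \<open>f\<close> all have the sign of the coordinate of \<open>g\<close>.\<close>
  have sign: "0 < e * \<pi> (f p)"
    if lin: "linear \<pi>" "\<And>v. \<bar>\<pi> v\<bar> \<le> norm v" and e: "e = 1 \<or> e = -1" and p: "p \<in> ?P" and gp: "\<pi> (g p) = e"
    for \<pi> :: "real \<times> real \<Rightarrow> real" and e p
  proof -
    have hp: "h p \<in> A"
      using h(2) p by blast
    have summand: "0 < e * \<pi> (q V - c)" if "V \<in> \<V>" "h p \<in> V" for V
    proof -
      have "\<bar>\<pi> (q V - c) - e\<bar> < 1 / 2"
        using close[OF p that] lin(2)[of "(q V - c) - g p"] linear_diff[OF lin(1), of "q V - c" "g p"] gp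
        by simp
      then have "\<pi> (q V - c) < e + 1 / 2" "e - 1 / 2 < \<pi> (q V - c)"
        by linarith+
      then show ?thesis
        using e by auto
    qed
    obtain V0 where V0: "V0 \<in> \<V>" "h p \<in> V0"
      using V(3) hp by blast
    have "e * \<pi> (f p) = (\<Sum>V\<in>\<V>. \<rho> V (h p) * (e * \<pi> (q V - c)))"
      unfolding f_def by (simp add: linear_sum[OF lin(1)] linear_cmul[OF lin(1)] sum_distrib_left mult.left_commute)
    also have "\<dots> > 0"
    proof (rule sum_pos2[OF V(1) V0(1)])
      show "0 < \<rho> V0 (h p) * (e * \<pi> (q V0 - c))"
        using summand[OF V0] \<rho>_pos[OF V0(1) hp] V0(2) by simp
      show "0 \<le> \<rho> V (h p) * (e * \<pi> (q V - c))" if "V \<in> \<V>" for V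
        using summand[OF that] \<rho>_0[OF that hp] \<rho>_nn[of V "h p"] by (cases "h p \<in> V") (auto intro: less_imp_le)
    qed
    finally show ?thesis .
  qed
  have nz: "f p \<noteq> 0" if p: "p \<in> ?P" for p
  proof
    assume f0: "f p = 0"
    have hp: "h p \<in> A"
      using h(2) p by blast
    \<comment> \<open>At most two terms of \<open>f p\<close> survive. If they cancelled,
      \<open>c\<close> would be a convex combination of at most two of the chosen centres.\<close>
    define N where "N = {V\<in>\<V>. h p \<in> V}"
    have fN: "f p = (\<Sum>V\<in>N. \<rho> V (h p) *\<^sub>R (q V - c))"
      unfolding f_def N_def using V(1) \<rho>_0[OF _ hp] by (intro sum.mono_neutral_right) auto
    have N: "finite N" "N \<noteq> {}" "card N \<le> 2"
      using V(1) V(3)[symmetric] hp V(5)[rule_format, OF hp] unfolding N_def by auto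
    have "card N = 1 \<or> card N = 2"
      using N card_gt_0_iff[of N] by linarith
    then obtain V W where VW: "N = {V, W}"
      by (metis card_1_singletonE card_2_iff insert_absorb2)
    define \<alpha> \<beta> where "\<alpha> = \<rho> V (h p)" and "\<beta> = (if V = W then 0 else \<rho> W (h p))"
    have in_N: "V \<in> \<V>" "h p \<in> V" "W \<in> \<V>"
      using VW unfolding N_def by auto
    have \<alpha>: "0 < \<alpha>" "0 \<le> \<beta>"
      using \<rho>_pos[OF in_N(1) hp] in_N(2) \<rho>_nn unfolding \<alpha>_def \<beta>_def by auto
    have "\<alpha> *\<^sub>R (q V - c) + \<beta> *\<^sub>R (q W - c) = 0"
      using f0 unfolding fN VW \<alpha>_def \<beta>_def by (cases "V = W") auto
    then have "\<alpha> *\<^sub>R q V + \<beta> *\<^sub>R q W = (\<alpha> + \<beta>) *\<^sub>R c"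
      by (simp add: algebra_simps)
    then have "c = (1 / (\<alpha> + \<beta>)) *\<^sub>R (\<alpha> *\<^sub>R q V + \<beta> *\<^sub>R q W)"
      using \<alpha> by simp
    also have "\<dots> = (1 - \<beta> / (\<alpha> + \<beta>)) *\<^sub>R q V + (\<beta> / (\<alpha> + \<beta>)) *\<^sub>R q W"
    proof -
      have "1 - \<beta> / (\<alpha> + \<beta>) = \<alpha> / (\<alpha> + \<beta>)"
        using \<alpha> by (simp add: field_simps)
      then show ?thesis
        by (simp add: scaleR_add_right)
    qed
    finally have "c \<in> closed_segment (q V) (q W)"
      unfolding closed_segment_def using \<alpha> by auto
    then show False
      using c(2) q in_N by blast
  qed
  have pi: "linear (fst :: real \<times> real \<Rightarrow> real)" "linear (snd :: real \<times> real \<Rightarrow> real)"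
    by (auto intro: bounded_linear.linear bounded_linear_fst bounded_linear_snd)
  have pi_le: "\<bar>fst v\<bar> \<le> norm v" "\<bar>snd v\<bar> \<le> norm v" for v :: "real \<times> real"
    using norm_fst_le[of "fst v" "snd v"] norm_snd_le[of "snd v" "fst v"] by auto
  show "\<exists>D. openin (top_of_set S) D \<and> closedin (top_of_set S) D \<and> a \<in> D \<and> b \<notin> D"
  proof (rule nonvanishing_imp_separated[OF S ab(1,2), of f])
    show "continuous_on ?P f"
      unfolding f_def
      by (intro continuous_on_sum continuous_on_scaleR continuous_on_const continuous_on_compose2[OF \<rho>_cont[of UNIV] h(1)] subset_UNIV)
    show "fst (f (a, t)) < 0" if "-1 \<le> t" "t \<le> 1" for t
      using sign[OF pi(1) pi_le(1), of "-1" "(a, t)"] ab d that unfolding g_def by (simp add: dist_commute)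
    show "0 < fst (f (b, t))" if "-1 \<le> t" "t \<le> 1" for t
      using sign[OF pi(1) pi_le(1), of 1 "(b, t)"] ab d that unfolding g_def by (simp add: dist_commute)
    show "snd (f (x, -1)) < 0" if "x \<in> S" for x
      using sign[OF pi(2) pi_le(2), of "-1" "(x, -1)"] that unfolding g_def by simp
    show "0 < snd (f (x, 1))" if "x \<in> S" for x
      using sign[OF pi(2) pi_le(2), of 1 "(x, 1)"] that unfolding g_def by simp
  qed (use nz in blast)
qed

subsection \<open>Periodic points\<close>

lemma homeomorphic_imp_space:
  assumes "S homeomorphic T"
  shows "top_of_set S homeomorphic_space top_of_set T"
proof -
  obtain f g where "homeomorphism S T f g"
    using assms unfolding homeomorphic_def by blast
  then have "homeomorphic_maps (top_of_set S) (top_of_set T) f g"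
    unfolding homeomorphic_maps_def homeomorphism_def
    by (auto simp: continuous_map_in_subtopology)
  then show ?thesis
    unfolding homeomorphic_space_def by blast
qed

context dense_flow
begin

text \<open>The transversal meets the orbit once per period, so \<open>P\<close> is the least
  positive period and one period is a simple closed path.\<close>

lemma periodic_orbit_circle:
  assumes "0 < Q" "\<phi> Q x0 = x0"
  shows "top_of_set (orbit \<phi> x0) homeomorphic_space top_of_set (sphere (0::complex) 1)"
proof -
  obtain K \<epsilon> where tr: "transversal A \<phi> x0 K \<epsilon>" and per: "(\<exists>P>0. \<phi> P x0 = x0) \<longrightarrow>
      (\<exists>P>0. \<phi> P x0 = x0 \<and> (\<forall>t. 0 < t \<and> t < P \<longrightarrow> \<phi> t x0 \<notin> K))"
    using transversal_exists by blast
  have periodic: "\<exists>P>0. \<phi> P x0 = x0"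
    using assms by (intro exI[of _ Q] conjI)
  obtain P where P: "P > 0" "\<phi> P x0 = x0" "\<forall>t. 0 < t \<and> t < P \<longrightarrow> \<phi> t x0 \<notin> K"
    using mp[OF per periodic] by (elim exE conjE) (rule that)
  have "x0 \<in> K"
    using tr by (rule transversal.x0_in)
  then have min: "\<phi> t x0 \<noteq> x0" if "0 < t" "t < P" for t
    using P(3) that by metis
  have mult_nat: "\<phi> (real n * P) x0 = x0" for n
  proof (induction n)
    case (Suc n)
    then show ?case
      using flow_add[OF x0, of P "real n * P"] P(2) by (simp add: algebra_simps)
  qed (simp add: flow_0[OF x0])
  have mult: "\<phi> (of_int m * P) x0 = x0" for m :: int
  proof (cases "0 \<le> m")
    case True
    then show ?thesis
      using mult_nat[of "nat m"] by simp
  next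
    case False
    then show ?thesis
      using mult_nat[of "nat (- m)"] flow_minus(1)[OF x0, of "real (nat (- m)) * P"] by simp
  qed
  define \<gamma> where "\<gamma> s = \<phi> (s * P) x0" for s
  have "path \<gamma>"
    unfolding path_def \<gamma>_def using x0 by (intro cont_flow continuous_intros) auto
  moreover have loop: "pathfinish \<gamma> = pathstart \<gamma>"
    unfolding \<gamma>_def pathfinish_def pathstart_def using P(2) flow_0[OF x0] by simp
  moreover have "loop_free \<gamma>"
  proof -
    have *: "s = 0 \<and> t = 1" if "0 \<le> s" "s < t" "t \<le> 1" "\<gamma> s = \<gamma> t" for s t
    proof -
      have "\<phi> ((t - s) * P) x0 = \<phi> (- (s * P)) (\<phi> (t * P) x0)"
        using flow_add[OF x0, of "- (s * P)" "t * P"] by (simp add: algebra_simps)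
      also have "\<dots> = x0"
        using that(4) flow_minus(1)[OF x0, of "s * P"] unfolding \<gamma>_def by simp
      finally have "\<not> (t - s) * P < P"
        using min[of "(t - s) * P"] that(2) P(1) by auto
      then have "\<not> t - s < 1"
        using P(1) by simp
      then show ?thesis
        using that by linarith
    qed
    show ?thesis
      unfolding loop_free_def using * by (metis atLeastAtMost_iff linorder_neqE_linordered_idom)
  qed
  ultimately have "path_image \<gamma> homeomorphic sphere (0::complex) 1"
    by (intro homeomorphic_simple_path_image_circle) (auto simp: simple_path_def)
  moreover have "path_image \<gamma> = orbit \<phi> x0"
  proof
    show "path_image \<gamma> \<subseteq> orbit \<phi> x0"
      unfolding path_image_def \<gamma>_def orbit_def by blast
    show "orbit \<phi> x0 \<subseteq> path_image \<gamma>"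
    proof
      fix y assume "y \<in> orbit \<phi> x0"
      then obtain t where t: "y = \<phi> t x0"
        unfolding orbit_def by blast
      have "t = frac (t / P) * P + of_int \<lfloor>t / P\<rfloor> * P"
        using P(1) by (simp add: frac_def field_simps)
      then have "y = \<gamma> (frac (t / P))"
        using t flow_add[OF x0, of "frac (t / P) * P" "of_int \<lfloor>t / P\<rfloor> * P"] mult
        unfolding \<gamma>_def by metis
      then show "y \<in> path_image \<gamma>"
        unfolding path_image_def by (simp add: frac_lt_1 less_imp_le)
    qed
  qed
  ultimately show ?thesis
    using homeomorphic_imp_space by metis
qed

text \<open>By Baire, some compact piece of an injective compact orbit has interior, but the orbit
  returns to it from arbitrarily far.\<close>

lemma compact_orbit_periodic:
  assumes "compact (orbit \<phi> x0)"
  shows "\<exists>P>0. \<phi> P x0 = x0"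
proof (rule ccontr)
  assume not_per: "\<not> (\<exists>P>0. \<phi> P x0 = x0)"
  have inj: "s = t" if "\<phi> s x0 = \<phi> t x0" for s t
  proof (rule ccontr)
    assume "s \<noteq> t"
    have "\<phi> (s - t) x0 = x0" "\<phi> (t - s) x0 = x0"
      using flow_add[OF x0, of "- t" s] flow_add[OF x0, of "- s" t] that
        flow_minus(1)[OF x0, of t] flow_minus(1)[OF x0, of s] by simp_all
    then show False
      using not_per \<open>s \<noteq> t\<close> by (metis diff_gt_0_iff_gt linorder_neqE_linordered_idom)
  qed
  let ?O = "orbit \<phi> x0"
  define B where "B n = (\<lambda>t. \<phi> t x0) ` {- real n..real n}" for n
  have B_closed: "closedin (top_of_set ?O) (B n)" for n
  proof -
    have "continuous_on {- real n..real n} (\<lambda>t. \<phi> t x0)"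
      using x0 by (intro cont_flow continuous_intros) auto
    then have "compact (B n)"
      unfolding B_def by (intro compact_continuous_image compact_Icc)
    moreover have "B n \<subseteq> ?O"
      unfolding B_def orbit_def by blast
    ultimately show ?thesis
      by (simp add: closed_subset compact_imp_closed)
  qed
  have "\<Union>(range B) = ?O"
  proof
    show "\<Union>(range B) \<subseteq> ?O"
      unfolding B_def orbit_def by blast
    show "?O \<subseteq> \<Union>(range B)"
    proof
      fix y assume "y \<in> ?O"
      then obtain t where t: "y = \<phi> t x0"
        unfolding orbit_def by blast
      obtain n where "\<bar>t\<bar> < real n"
        using reals_Archimedean2 by blast
      then show "y \<in> \<Union>(range B)"
        unfolding B_def t by (intro UN_I[of n] imageI) auto
    qed
  qed
  moreover have "top_of_set ?O interior_of ?O = ?O"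
    by (metis interior_of_topspace topspace_euclidean_subtopology)
  moreover have "?O \<noteq> {}"
    unfolding orbit_def by blast
  moreover have "locally_compact_space (top_of_set ?O) \<and> regular_space (top_of_set ?O)"
  proof -
    have "compact_space (top_of_set ?O)" "Hausdorff_space (top_of_set ?O)"
      using assms by (auto simp: compact_space_subtopology Hausdorff_space_subtopology)
    then show ?thesis
      by (simp add: compact_Hausdorff_imp_regular_space compact_imp_locally_compact_space)
  qed
  moreover have "top_of_set ?O interior_of \<Union>(range B) = {}"
    if "locally_compact_space (top_of_set ?O) \<and> regular_space (top_of_set ?O)"
      "\<And>n. top_of_set ?O interior_of (B n) = {}"
    by (rule Baire_category_alt) (use that B_closed in auto)
  ultimately obtain n where n: "top_of_set ?O interior_of (B n) \<noteq> {}"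
    by metis
  then obtain y U where "openin (top_of_set ?O) U" "y \<in> U" "U \<subseteq> B n"
    unfolding interior_of_def by blast
  then obtain V where V: "open V" "y \<in> ?O \<inter> V" "?O \<inter> V \<subseteq> B n"
    unfolding openin_open by blast
  then obtain t where t: "y = \<phi> t x0"
    unfolding orbit_def by blast
  have "continuous_on A (\<phi> t)"
    by (rule cont_flow) (auto intro: continuous_intros)
  then have "openin (top_of_set A) (A \<inter> \<phi> t -` V)"
    using V(1) continuous_openin_preimage_gen by blast
  moreover have "x0 \<in> A \<inter> \<phi> t -` V"
    using V(2) t x0 by simp
  \<comment> \<open>Starting at time \<open>real n + \<bar>t\<bar>\<close> makes the total time
    exceed \<open>n\<close>, while every point of the orbit in \<open>V\<close> lies in
    \<open>B n\<close>; injectivity of the orbit forbids this.\<close>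
  ultimately obtain s where s: "s > 0" "\<phi> s (\<phi> (real n + \<bar>t\<bar>) x0) \<in> A \<inter> \<phi> t -` V"
    using dense flow_in[OF x0] by blast
  then have "\<phi> (t + (s + (real n + \<bar>t\<bar>))) x0 \<in> V"
    using flow_add[OF x0] by simp
  then have "\<phi> (t + (s + (real n + \<bar>t\<bar>))) x0 \<in> B n"
    using V(3) unfolding orbit_def by blast
  then obtain r where "r \<le> real n" "\<phi> (t + (s + (real n + \<bar>t\<bar>))) x0 = \<phi> r x0"
    unfolding B_def by auto
  then have "t + (s + (real n + \<bar>t\<bar>)) \<le> real n"
    using inj by metis
  then show False
    using s(1) by linarith
qed

lemma dense_flow_expansion:
  "\<exists>k f p. expansion (top_of_set A) \<phi> x0 k f p \<and>
    ((\<forall>t>0. \<phi> t x0 \<noteq> x0) \<longrightarrow> (\<forall>i. proper_posmap (k (Suc i)) (f i))) \<and>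
    ((\<exists>t>0. \<phi> t x0 = x0) \<longrightarrow> (\<forall>n\<ge>1. degenerate_proper (k n) (bond f 0 n)))"
proof -
  obtain K R D where cs: "cross_section A \<phi> K R D x0" and per: "(\<exists>P>0. \<phi> P x0 = x0) \<longrightarrow> \<phi> (R x0) x0 = x0"
    using section_exists by blast
  interpret cs: cross_section A \<phi> K R D x0
    by (rule cs)
  obtain k f p where "expansion (top_of_set A) \<phi> x0 k f p"
    "(\<forall>t>0. \<phi> t x0 \<noteq> x0) \<longrightarrow> (\<forall>i. proper_posmap (k (Suc i)) (f i))"
    and deg: "cs.T x0 = x0 \<longrightarrow> (\<forall>n\<ge>1. degenerate_proper (k n) (bond f 0 n))"
    using cs.expansion_exists by blast
  moreover have "(\<exists>t>0. \<phi> t x0 = x0) \<longrightarrow> (\<forall>n\<ge>1. degenerate_proper (k n) (bond f 0 n))"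
    using per deg unfolding cs.T_def by blast
  ultimately show ?thesis
    by blast
qed

end

text \<open>Two-sided density is applied to an omega-limit point \<open>z\<close> of
  \<open>x\<close>. Even if the time \<open>s\<close> leading from \<open>z\<close> into
  \<open>U\<close> is negative, \<open>x\<close> comes close to \<open>z\<close> arbitrarily late,
  so following \<open>z\<close> leads it into \<open>U\<close> at a positive time.\<close>

lemma (in metric_flow) two_sided_imp_forward_dense:
  assumes dense: "\<And>U x. openin (top_of_set A) U \<Longrightarrow> U \<noteq> {} \<Longrightarrow> x \<in> A \<Longrightarrow> \<exists>t. \<phi> t x \<in> U"
    and U: "openin (top_of_set A) U" "U \<noteq> {}" and x: "x \<in> A"
  shows "\<exists>t>0. \<phi> t x \<in> U"
proof -
  obtain V where V: "open V" "U = A \<inter> V"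
    using U(1) unfolding openin_open by blast
  have "\<forall>n. \<phi> (real n) x \<in> A"
    using flow_in[OF x] by blast
  then obtain z r where z: "z \<in> A" and r: "strict_mono r" "((\<lambda>n. \<phi> (real n) x) \<circ> r) \<longlonglongrightarrow> z"
    using compact_A unfolding compact_def by meson
  obtain s where s: "\<phi> s z \<in> U"
    using dense[OF U z] by blast
  have "continuous_on A (\<phi> s)"
    by (rule cont_flow) (auto intro: continuous_intros)
  then have "(\<lambda>n. \<phi> s (((\<lambda>n. \<phi> (real n) x) \<circ> r) n)) \<longlonglongrightarrow> \<phi> s z"
    using continuous_on_tendsto_compose[OF _ r(2) z] flow_in[OF x] by (simp add: o_def)
  then have "eventually (\<lambda>n. \<phi> s (((\<lambda>n. \<phi> (real n) x) \<circ> r) n) \<in> V) sequentially"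
    using topological_tendstoD[OF _ V(1)] s V(2) by blast
  then obtain N where N: "\<And>n. n \<ge> N \<Longrightarrow> \<phi> s (\<phi> (real (r n)) x) \<in> V"
    unfolding eventually_sequentially by auto
  obtain m :: nat where m: "- s < real m"
    using reals_Archimedean2 by blast
  define n where "n = max N m"
  have "m \<le> r n"
    using seq_suble[OF r(1), of n] unfolding n_def by linarith
  then have "0 < s + real (r n)"
    using m by linarith
  moreover have "\<phi> (s + real (r n)) x \<in> U"
    using N[of n] flow_add[OF x, of s "real (r n)"] flow_in[OF x, of "s + real (r n)"] V(2)
    unfolding n_def by simp
  ultimately show ?thesis
    by blast
qed

subsection \<open>Metrizable spaces as sets of real sequences\<close>

text \<open>The distances to a countable dense set separate points, and compactness makes the
  resulting injection an embedding. The target type is metric and second countable, as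
  \<open>metric_flow\<close> demands.\<close>

lemma compact_metrizable_embedding:
  assumes "compact_space X" "metrizable_space X" "topspace X \<noteq> {}"
  shows "\<exists>e::'a \<Rightarrow> nat \<Rightarrow> real. homeomorphic_map X (top_of_set (e ` topspace X)) e"
proof -
  obtain M d where "Metric_space M d" and X: "X = Metric_space.mtopology M d"
    using assms(2) unfolding metrizable_space_def by blast
  interpret Metric_space M d
    by fact
  have top: "topspace X = M"
    using X by simp
  have "mtotally_bounded M"
    using assms(1) X compactin_imp_mtotally_bounded[of M] unfolding compact_space_def by simp
  then have "\<exists>F. finite F \<and> F \<subseteq> M \<and> M \<subseteq> (\<Union>x\<in>F. mball x (1 / real (Suc n)))" for n
    unfolding mtotally_bounded_def by simp
  then obtain F where F: "\<And>n. finite (F n) \<and> F n \<subseteq> M \<and> M \<subseteq> (\<Union>x\<in>F n. mball x (1 / real (Suc n)))"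
    by metis
  define C where "C = (\<Union>n. F n)"
  have C: "countable C" "C \<subseteq> M"
    unfolding C_def using F by (auto intro: countable_finite)
  have dense: "\<exists>c\<in>C. d x c < \<epsilon>" if x: "x \<in> M" and \<epsilon>: "0 < \<epsilon>" for x \<epsilon>
  proof -
    obtain n where n: "1 / real (Suc n) < \<epsilon>"
      using \<epsilon> nat_approx_posE by blast
    obtain c where "c \<in> F n" "x \<in> mball c (1 / real (Suc n))"
      using F[of n] x by blast
    then show ?thesis
      using n unfolding C_def by (auto simp: commute intro!: bexI[of _ c])
  qed
  have "C \<noteq> {}"
    using dense[of _ 1] assms(3) top by fastforce
  define s where "s = from_nat_into C"
  have s_M: "s n \<in> M" for n
    using from_nat_into[OF \<open>C \<noteq> {}\<close>] C(2) unfolding s_def by blast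
  define e where "e x = (\<lambda>n. d x (s n))" for x
  have "continuous_map X euclideanreal (\<lambda>x. d x (s n))" for n
  proof -
    have "openin mtopology {x\<in>M. d x (s n) \<in> U}" if U: "open U" for U
      unfolding openin_mtopology
    proof (intro conjI allI impI)
      fix x assume "x \<in> {x\<in>M. d x (s n) \<in> U}"
      then obtain \<epsilon> where x: "x \<in> M" and \<epsilon>: "\<epsilon> > 0" "ball (d x (s n)) \<epsilon> \<subseteq> U"
        using U open_contains_ball by blast
      have "d y (s n) \<in> ball (d x (s n)) \<epsilon>" if "y \<in> mball x \<epsilon>" for y
        using that triangle[of x y "s n"] triangle[of y x "s n"] s_M[of n] commute[of x y]
        by (auto simp: dist_real_def)
      then have "mball x \<epsilon> \<subseteq> {x\<in>M. d x (s n) \<in> U}"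
        using \<epsilon>(2) by auto
      then show "\<exists>r>0. mball x r \<subseteq> {x\<in>M. d x (s n) \<in> U}"
        using \<epsilon>(1) by blast
    qed blast
    then have "continuous_map mtopology euclideanreal (\<lambda>x. d x (s n))"
      unfolding continuous_map_def by simp
    then show ?thesis
      using X by simp
  qed
  then have "continuous_map X euclidean e"
    unfolding e_def euclidean_product_topology[symmetric] continuous_map_componentwise_UNIV by blast
  moreover have "inj_on e (topspace X)"
  proof (rule inj_onI, rule ccontr)
    fix x y assume xy: "x \<in> topspace X" "y \<in> topspace X" "e x = e y" "x \<noteq> y"
    then have "0 < d x y / 2"
      using top mdist_pos_less[of x y] by simp
    then obtain c where c: "c \<in> C" "d x c < d x y / 2"
      using dense[of x] xy top by blast
    then obtain n where "s n = c"
      using from_nat_into_surj[OF C(1)] unfolding s_def by blast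
    then have "d y c = d x c"
      using fun_cong[OF xy(3), of n] unfolding e_def by simp
    then show False
      using triangle[of x c y] c xy top C(2) commute[of c y] by auto
  qed
  ultimately have "embedding_map X euclidean e"
    by (intro continuous_imp_embedding_map assms(1)) auto
  then show ?thesis
    unfolding embedding_map_def by blast
qed

lemma cov_dim_le_homeomorphic:
  assumes "cov_dim_le X n" "homeomorphic_maps X Y e e'"
  shows "cov_dim_le Y n"
  unfolding cov_dim_le_def
proof (intro allI impI)
  fix \<U> assume \<U>: "finite \<U> \<and> (\<forall>U\<in>\<U>. openin Y U) \<and> \<Union>\<U> = topspace Y"
  have e: "continuous_map X Y e" "\<And>x. x \<in> topspace X \<Longrightarrow> e' (e x) = x" "\<And>y. y \<in> topspace Y \<Longrightarrow> e (e' y) = y"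
    and e': "continuous_map Y X e'"
    using assms(2) unfolding homeomorphic_maps_def by auto
  have in_X: "e' y \<in> topspace X" if "y \<in> topspace Y" for y
    using e' that unfolding continuous_map_def by blast
  have in_Y: "e x \<in> topspace Y" if "x \<in> topspace X" for x
    using e(1) that unfolding continuous_map_def by blast
  define pre where "pre U = {x\<in>topspace X. e x \<in> U}" for U
  have "finite (pre ` \<U>) \<and> (\<forall>U\<in>pre ` \<U>. openin X U) \<and> \<Union>(pre ` \<U>) = topspace X"
  proof (intro conjI)
    show "\<forall>U\<in>pre ` \<U>. openin X U"
      using \<U> e(1) unfolding pre_def continuous_map_def by auto
    have "\<Union>\<U> = topspace Y"
      using \<U> by blast
    then show "\<Union>(pre ` \<U>) = topspace X"
      using in_Y unfolding pre_def by auto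
  qed (use \<U> in simp)
  from assms(1)[unfolded cov_dim_le_def, rule_format, OF this]
  obtain \<V> where V: "finite \<V>" "\<forall>V\<in>\<V>. openin X V" "\<Union>\<V> = topspace X"
    "\<forall>V\<in>\<V>. \<exists>W\<in>pre ` \<U>. V \<subseteq> W" "\<forall>x\<in>topspace X. card {V\<in>\<V>. x \<in> V} \<le> n + 1"
    by (elim exE conjE) (rule that)
  show "\<exists>\<V>. finite \<V> \<and> (\<forall>V\<in>\<V>. openin Y V) \<and> \<Union>\<V> = topspace Y \<and> (\<forall>V\<in>\<V>. \<exists>U\<in>\<U>. V \<subseteq> U) \<and>
      (\<forall>x\<in>topspace Y. card {V\<in>\<V>. x \<in> V} \<le> n + 1)"
  proof (intro exI[of _ "(`) e ` \<V>"] conjI ballI)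
    show "finite ((`) e ` \<V>)"
      using V(1) by blast
    show "openin Y W" if "W \<in> (`) e ` \<V>" for W
      using that V(2) homeomorphic_imp_open_map[of X Y e] assms(2)
      unfolding open_map_def by (auto simp: homeomorphic_map_maps)
    show "\<Union>((`) e ` \<V>) = topspace Y"
    proof
      show "\<Union>((`) e ` \<V>) \<subseteq> topspace Y"
        using V(3) in_Y by blast
      show "topspace Y \<subseteq> \<Union>((`) e ` \<V>)"
      proof
        fix y assume y: "y \<in> topspace Y"
        then have "e' y \<in> \<Union>\<V>"
          using in_X V(3) by simp
        then obtain V0 where "V0 \<in> \<V>" "e' y \<in> V0"
          by blast
        then show "y \<in> \<Union>((`) e ` \<V>)"
          using e(3)[OF y] by (metis UN_I image_eqI)
      qed
    qed
    show "\<exists>U\<in>\<U>. W \<subseteq> U" if "W \<in> (`) e ` \<V>" for W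
    proof -
      obtain V0 where V0: "V0 \<in> \<V>" "W = e ` V0"
        using \<open>W \<in> (`) e ` \<V>\<close> by (elim imageE) (rule that)
      have "\<exists>W\<in>pre ` \<U>. V0 \<subseteq> W"
        using V(4) V0(1) by (rule bspec)
      then obtain U where "U \<in> \<U>" "V0 \<subseteq> pre U"
        by auto
      moreover from this have "W \<subseteq> U"
        unfolding V0(2) pre_def by auto
      ultimately show ?thesis
        by (intro bexI[of _ U])
    qed
    show "card {W \<in> (`) e ` \<V>. y \<in> W} \<le> n + 1" if y: "y \<in> topspace Y" for y
    proof -
      have "{W \<in> (`) e ` \<V>. y \<in> W} \<subseteq> (`) e ` {V\<in>\<V>. e' y \<in> V}"
      proof
        fix W assume "W \<in> {W \<in> (`) e ` \<V>. y \<in> W}"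
        then have "W \<in> (`) e ` \<V>" "y \<in> W"
          by simp_all
        then obtain V0 where V0: "V0 \<in> \<V>" "W = e ` V0" "y \<in> e ` V0"
          by (elim imageE) (rule that, auto)
        then obtain x where x: "x \<in> V0" "y = e x"
          by (elim imageE) (rule that)
        then have "x \<in> topspace X"
          using V(3) V0(1) by auto
        then have "e' y \<in> V0"
          using e(2) x by simp
        then show "W \<in> (`) e ` {V\<in>\<V>. e' y \<in> V}"
          unfolding V0(2) by (intro imageI) (simp add: V0(1))
      qed
      then have "card {W \<in> (`) e ` \<V>. y \<in> W} \<le> card ((`) e ` {V\<in>\<V>. e' y \<in> V})"
        using V(1) by (intro card_mono) auto
      also have "\<dots> \<le> card {V\<in>\<V>. e' y \<in> V}"
        using V(1) by (intro card_image_le) auto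
      also have "\<dots> \<le> n + 1"
        using V(5) in_X[OF y] by blast
      finally show ?thesis .
    qed
  qed
qed
subsection \<open>Transport to a space of sequences\<close>

lemma expansion_transport:
  assumes "expansion Y \<psi> (e x0) k f p" and e: "homeomorphic_map X Y e" and x0: "x0 \<in> topspace X"
    and flow: "\<And>x t. x \<in> topspace X \<Longrightarrow> \<phi> t x \<in> topspace X \<and> e (\<phi> t x) = \<psi> t (e x)"
  shows "expansion X \<phi> x0 k f (\<lambda>i x. p i (e x))"
proof -
  have e_top: "e ` topspace X = topspace Y"
    by (rule homeomorphic_imp_surjective_map[OF e])
  have e_in: "e x \<in> topspace Y" if "x \<in> topspace X" for x
    using that e_top by blast
  have e_cont: "continuous_map X Y e"
    by (rule homeomorphic_imp_continuous_map[OF e])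
  have ex: "\<forall>i. 1 \<le> k i" "\<forall>i. positive_map (k (Suc i)) (k i) (f i)"
    "\<forall>i. projection Y \<psi> (k i) (p i)" "\<forall>i. p i (e x0) = 0"
    "\<forall>n m. n < m \<longrightarrow> (\<forall>x\<in>topspace Y. p n x = bond f n m (p m x))"
    "homeomorphic_map Y (inv_limit k f) (\<lambda>x i. p i x)"
    using assms(1) unfolding expansion_def by blast+
  have "projection X \<phi> (k i) (\<lambda>x. p i (e x))" for i
  proof -
    have pr: "continuous_map Y (W (k i)) (p i)" "p i ` topspace Y = wedge (k i)"
      "\<And>x. x \<in> topspace Y \<Longrightarrow> \<exists>d>0. inj_on (\<lambda>t. p i (\<psi> t x)) {- d<..<d}"
      "\<And>x. x \<in> topspace Y \<Longrightarrow> p i x \<noteq> 0 \<Longrightarrow> \<exists>a<k i. \<exists>d>0. \<exists>h. strict_mono_on {- d<..<d} h \<and>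
          (\<forall>t\<in>{- d<..<d}. p i (\<psi> t x) = wcirc a (h t))"
      using ex(3) unfolding projection_def by blast+
    show ?thesis
      unfolding projection_def
    proof (intro conjI ballI impI)
      show "continuous_map X (W (k i)) (\<lambda>x. p i (e x))"
        using continuous_map_compose[OF e_cont pr(1)] by (simp add: o_def)
      show "(\<lambda>x. p i (e x)) ` topspace X = wedge (k i)"
        using pr(2) e_top by (metis image_image)
      show "\<exists>d>0. inj_on (\<lambda>t. p i (e (\<phi> t x))) {- d<..<d}" if "x \<in> topspace X" for x
        using pr(3)[OF e_in[OF that]] flow[OF that] by simp
      show "\<exists>a<k i. \<exists>d>0. \<exists>h. strict_mono_on {- d<..<d} h \<and>
          (\<forall>t\<in>{- d<..<d}. p i (e (\<phi> t x)) = wcirc a (h t))" if "x \<in> topspace X" "p i (e x) \<noteq> 0" for x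
        using pr(4)[OF e_in[OF that(1)] that(2)] flow[OF that(1)] by simp
    qed
  qed
  moreover have "homeomorphic_map X (inv_limit k f) (\<lambda>x i. p i (e x))"
    using homeomorphic_map_compose[OF e ex(6)] by (simp add: o_def)
  ultimately show ?thesis
    unfolding expansion_def using ex(1,2,4,5) e_in by blast
qed

lemma flow_space_model:
  fixes X :: "'a topology"
  assumes fs: "flow_space X \<phi>" and ne: "topspace X \<noteq> {}"
  obtains A :: "(nat \<Rightarrow> real) set" and \<psi> e where "metric_flow A \<psi>" "homeomorphic_map X (top_of_set A) e"
    "\<And>x t. x \<in> topspace X \<Longrightarrow> \<phi> t x \<in> topspace X \<and> e (\<phi> t x) = \<psi> t (e x)"
    "cov_dim_le (top_of_set A) 1"
proof -
  have X: "compact_space X" "metrizable_space X" "cov_dim_le X 1"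
    "continuous_map (prod_topology euclideanreal X) X (\<lambda>(t, x). \<phi> t x)"
    "\<And>x. x \<in> topspace X \<Longrightarrow> \<phi> 0 x = x"
    "\<And>s t x. x \<in> topspace X \<Longrightarrow> \<phi> (s + t) x = \<phi> s (\<phi> t x)"
    using fs unfolding flow_space_def top_dim_one_def by blast+
  obtain e :: "'a \<Rightarrow> nat \<Rightarrow> real" where e: "homeomorphic_map X (top_of_set (e ` topspace X)) e"
    using compact_metrizable_embedding[OF X(1,2) ne] by blast
  define A where "A = e ` topspace X"
  have eA: "homeomorphic_map X (top_of_set A) e"
    using e unfolding A_def .
  then obtain e' where maps: "homeomorphic_maps X (top_of_set A) e e'"
    unfolding homeomorphic_map_maps by blast
  then have e': "continuous_map (top_of_set A) X e'" and e_cont: "continuous_map X (top_of_set A) e"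
    and ee: "\<And>x. x \<in> topspace X \<Longrightarrow> e' (e x) = x"
    unfolding homeomorphic_maps_def by auto
  have e_in: "e x \<in> A" if "x \<in> topspace X" for x
    using that unfolding A_def by blast
  have e'_in: "e' y \<in> topspace X" "e (e' y) = y" if "y \<in> A" for y
    using that ee unfolding A_def by auto
  have \<phi>_in: "\<phi> t x \<in> topspace X" if "x \<in> topspace X" for t x
    using funcset_mem[OF continuous_map_funspace[OF X(4)], of "(t, x)"] that by simp
  define \<psi> where "\<psi> t y = e (\<phi> t (e' y))" for t y
  have "metric_flow A \<psi>"
  proof
    have "compactin X (topspace X)"
      using X(1) by (simp add: compact_space_def)
    then have "compactin (top_of_set A) A"
      using image_compactin[OF _ e_cont] unfolding A_def by blast
    then show "compact A"
      by (simp add: compactin_subtopology)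
    have "continuous_map (prod_topology euclideanreal (top_of_set A)) (prod_topology euclideanreal X)
        (\<lambda>z. (fst z, e' (snd z)))"
      unfolding continuous_map_pairwise o_def
      using continuous_map_compose[OF continuous_map_snd e'] by (simp add: o_def continuous_map_fst)
    then have "continuous_map (prod_topology euclideanreal (top_of_set A)) (top_of_set A)
        (e \<circ> ((\<lambda>(t, x). \<phi> t x) \<circ> (\<lambda>z. (fst z, e' (snd z)))))"
      by (rule continuous_map_compose[OF continuous_map_compose[OF _ X(4)] e_cont])
    moreover have "prod_topology euclideanreal (top_of_set A) = top_of_set (UNIV \<times> A)"
      using prod_topology_subtopology_eu[of UNIV A] by simp
    ultimately show "continuous_on (UNIV \<times> A) (\<lambda>(t, y). \<psi> t y)"
      unfolding \<psi>_def by (auto simp: continuous_map_in_subtopology o_def case_prod_beta)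
    show "\<psi> t y \<in> A" if "y \<in> A" for t y
      unfolding \<psi>_def using that e_in \<phi>_in e'_in by blast
    show "\<psi> 0 y = y" if "y \<in> A" for y
      unfolding \<psi>_def using that X(5) e'_in by simp
    show "\<psi> (s + t) y = \<psi> s (\<psi> t y)" if "y \<in> A" for s t y
      unfolding \<psi>_def using that X(6) e'_in ee \<phi>_in by simp
  qed
  moreover have "\<phi> t x \<in> topspace X \<and> e (\<phi> t x) = \<psi> t (e x)" if "x \<in> topspace X" for x t
    unfolding \<psi>_def using that \<phi>_in ee by simp
  moreover have "cov_dim_le (top_of_set A) 1"
    by (rule cov_dim_le_homeomorphic[OF X(3) maps])
  ultimately show thesis
    using that eA by blast
qed

lemma metric_flow_thin:
  assumes "metric_flow A \<psi>" "cov_dim_le (top_of_set A) 1" "compact S" "S \<subseteq> A" "0 < e"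
    and inj: "inj_on (\<lambda>(x, t). \<psi> t x) (S \<times> {-e..e})"
  shows "clopen_separated S"
proof (rule cov_dim_1_imp_separated[OF assms(2) metric_flow.compact_A[OF assms(1)] assms(3),
      of "\<lambda>z. \<psi> (e * snd z) (fst z)"])
  show "continuous_on (S \<times> {-1..1}) (\<lambda>z. \<psi> (e * snd z) (fst z))"
    using assms(4) by (intro metric_flow.cont_flow[OF assms(1)] continuous_intros) auto
  show "(\<lambda>z. \<psi> (e * snd z) (fst z)) ` (S \<times> {-1..1}) \<subseteq> A"
    using assms(4) metric_flow.flow_in[OF assms(1)] by auto
  show "inj_on (\<lambda>z. \<psi> (e * snd z) (fst z)) (S \<times> {-1..1})"
  proof (rule inj_onI, clarify)
    fix x y :: 'a and s t :: real
    assume x: "x \<in> S" "y \<in> S" and st: "s \<in> {-1..1}" "t \<in> {-1..1}"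
      and eq: "\<psi> (e * snd (x, s)) (fst (x, s)) = \<psi> (e * snd (y, t)) (fst (y, t))"
    have "e * s \<in> {-e..e}" "e * t \<in> {-e..e}"
      using st assms(5) mult_left_mono[of s 1 e] mult_left_mono[of t 1 e]
        mult_left_mono[of "-1" s e] mult_left_mono[of "-1" t e] by auto
    then have "(x, e * s) = (y, e * t)"
      using inj_onD[OF inj, of "(x, e * s)" "(y, e * t)"] x eq by simp
    then show "x = y \<and> s = t"
      using assms(5) by simp
  qed
qed

section \<open>Expansions of flow spaces\<close>

lemma dense_at_expansion:
  fixes X :: "'a topology"
  assumes fs: "flow_space X \<phi>" and x0X: "x0 \<in> topspace X" and denseX: "dense_at X \<phi> x0"
  shows "\<exists>k f p. expansion X \<phi> x0 k f p \<and>
    (aperiodic_flow X \<phi> \<longrightarrow> (\<forall>i. proper_posmap (k (Suc i)) (f i))) \<and>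
    (\<not> aperiodic_flow X \<phi> \<longrightarrow> (\<forall>n\<ge>1. degenerate_proper (k n) (bond f 0 n)))"
proof -
  have ne: "topspace X \<noteq> {}"
    using x0X by blast
  obtain A :: "(nat \<Rightarrow> real) set" and \<psi> e where A: "metric_flow A \<psi>"
    and e: "homeomorphic_map X (top_of_set A) e"
    and conj: "\<And>x t. x \<in> topspace X \<Longrightarrow> \<phi> t x \<in> topspace X \<and> e (\<phi> t x) = \<psi> t (e x)"
    and dim: "cov_dim_le (top_of_set A) 1"
    by (rule flow_space_model[OF fs ne]) (rule that)
  interpret metric_flow A \<psi>
    by (rule A)
  have e_top: "e ` topspace X = A"
    using homeomorphic_imp_surjective_map[OF e] by simp
  have e_inj: "inj_on e (topspace X)"
    using e homeomorphic_eq_everything_map by blast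
  have e_cont: "continuous_map X (top_of_set A) e"
    by (rule homeomorphic_imp_continuous_map[OF e])
  have "dense_flow A \<psi> (e x0)"
  proof
    show "e x0 \<in> A"
      using x0X e_top by blast
    obtain t where "\<phi> t x0 \<noteq> x0"
      using fs x0X unfolding flow_space_def by blast
    then show "\<exists>t. \<psi> t (e x0) \<noteq> e x0"
      using conj[OF x0X] inj_onD[OF e_inj, of "\<phi> t x0" x0] x0X by metis
    show "clopen_separated S" if "compact S" "S \<subseteq> A" "0 < d" "inj_on (\<lambda>(x, t). \<psi> t x) (S \<times> {-d..d})"
      for S d
      using metric_flow_thin[OF A dim that] .
    show "\<exists>t>0. \<psi> t y \<in> U" if U: "openin (top_of_set A) U" "e x0 \<in> U" and y: "y \<in> A" for U y
    proof -
      obtain x where x: "x \<in> topspace X" "y = e x"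
        using y e_top by blast
      have "openin X {x\<in>topspace X. e x \<in> U}"
        using e_cont U(1) unfolding continuous_map_def by blast
      then obtain t where "t > 0" "\<phi> t x \<in> {x\<in>topspace X. e x \<in> U}"
        using denseX x0X U(2) x(1) unfolding dense_at_def by blast
      then show ?thesis
        using conj[OF x(1)] x(2) by auto
    qed
  qed
  then interpret dense_flow A \<psi> "e x0" .
  obtain k f p where ex: "expansion (top_of_set A) \<psi> (e x0) k f p"
    and ap: "(\<forall>t>0. \<psi> t (e x0) \<noteq> e x0) \<longrightarrow> (\<forall>i. proper_posmap (k (Suc i)) (f i))"
    and per: "(\<exists>t>0. \<psi> t (e x0) = e x0) \<longrightarrow> (\<forall>n\<ge>1. degenerate_proper (k n) (bond f 0 n))"
    using dense_flow_expansion by blast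
  have "expansion X \<phi> x0 k f (\<lambda>i x. p i (e x))"
    by (rule expansion_transport[OF ex e x0X conj])
  moreover have "\<psi> t (e x0) \<noteq> e x0" if "aperiodic_flow X \<phi>" "t > 0" for t
  proof
    assume *: "\<psi> t (e x0) = e x0"
    have "e ` (topspace X \<inter> orbit \<phi> x0) = topspace (top_of_set A) \<inter> orbit \<psi> (e x0)"
    proof -
      have "orbit \<phi> x0 \<subseteq> topspace X" "e ` orbit \<phi> x0 = orbit \<psi> (e x0)" "orbit \<psi> (e x0) \<subseteq> A"
        unfolding orbit_def using conj[OF x0X] flow_in[OF x0] by (auto simp: image_image)
      then show ?thesis
        by (simp add: inf.absorb2)
    qed
    then have "homeomorphic_map (subtopology X (orbit \<phi> x0)) (subtopology (top_of_set A) (orbit \<psi> (e x0))) e"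
      by (rule homeomorphic_map_subtopologies[OF e])
    moreover have "subtopology (top_of_set A) (orbit \<psi> (e x0)) = top_of_set (orbit \<psi> (e x0))"
      using flow_in[OF x0] unfolding orbit_def subtopology_subtopology
      by (metis image_subsetI inf.absorb2)
    ultimately have "subtopology X (orbit \<phi> x0) homeomorphic_space top_of_set (sphere (0::complex) 1)"
      using periodic_orbit_circle[OF that(2) *] homeomorphic_map_imp_homeomorphic_space
        homeomorphic_space_trans by metis
    then show False
      using that(1) x0X unfolding aperiodic_flow_def by blast
  qed
  moreover have "\<exists>t>0. \<psi> t (e x0) = e x0" if not_ap: "\<not> aperiodic_flow X \<phi>"
  proof (rule compact_orbit_periodic)
    obtain x where x: "x \<in> topspace X"
      and circ: "subtopology X (orbit \<phi> x) homeomorphic_space top_of_set (sphere (0::complex) 1)"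
      using not_ap unfolding aperiodic_flow_def by blast
    have orb: "orbit \<phi> x \<subseteq> topspace X"
      unfolding orbit_def using conj[OF x] by blast
    have "compact_space (subtopology X (orbit \<phi> x))"
      using homeomorphic_compact_space[OF circ] by (simp add: compact_space_subtopology)
    then have comp: "compactin X (orbit \<phi> x)"
      using orb by (simp add: compactin_subspace)
    have "compactin (top_of_set A) (e ` orbit \<phi> x)"
      by (rule image_compactin[OF comp e_cont])
    moreover have img: "e ` orbit \<phi> x = orbit \<psi> (e x)"
      unfolding orbit_def using conj[OF x] by (auto simp: image_image)
    ultimately have comp': "compact (orbit \<psi> (e x))"
      by (simp add: compactin_subtopology)
    have ex_A: "e x \<in> A"
      using x e_top by blast
    have "e x0 \<in> orbit \<psi> (e x)"
    \<comment> \<open>Otherwise the complement of this closed orbit would be a neighbourhood of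
      \<open>e x0\<close> that the orbit never enters. So the circle orbit found is the orbit of
      \<open>e x0\<close>.\<close>
    proof (rule ccontr)
      assume "e x0 \<notin> orbit \<psi> (e x)"
      moreover have "openin (top_of_set A) (A - orbit \<psi> (e x))"
        using compact_imp_closed[OF comp'] by (simp add: Diff_eq openin_open_Int open_Compl)
      ultimately obtain t where "\<psi> t (e x) \<in> A - orbit \<psi> (e x)"
        using dense[OF _ _ ex_A] x0 by blast
      then show False
        unfolding orbit_def by blast
    qed
    then obtain s where s: "e x0 = \<psi> s (e x)"
      unfolding orbit_def by blast
    have "orbit \<psi> (e x0) = orbit \<psi> (e x)"
    proof
      show "orbit \<psi> (e x0) \<subseteq> orbit \<psi> (e x)"
        unfolding orbit_def s using flow_add[OF ex_A, symmetric] by auto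
      show "orbit \<psi> (e x) \<subseteq> orbit \<psi> (e x0)"
      proof
        fix y assume "y \<in> orbit \<psi> (e x)"
        then obtain t where "y = \<psi> t (e x)"
          unfolding orbit_def by blast
        then have "y = \<psi> (t - s) (e x0)"
          unfolding s using flow_add[OF ex_A, of "t - s" s] by simp
        then show "y \<in> orbit \<psi> (e x0)"
          unfolding orbit_def by blast
      qed
    qed
    then show "compact (orbit \<psi> (e x0))"
      using comp' by simp
  qed
  ultimately show ?thesis
    using ap per by blast
qed

text \<open>Minimality concerns full orbits, whereas density at a point asks for positive times;
  \<open>two_sided_imp_forward_dense\<close> bridges the gap in the sequence model.\<close>

lemma minimal_imp_dense_at:
  fixes X :: "'a topology"
  assumes fs: "flow_space X \<phi>" and y: "y \<in> topspace X" and min: "minimal_flow X \<phi>"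
  shows "dense_at X \<phi> y"
  unfolding dense_at_def
proof (intro allI impI ballI)
  fix U x assume U: "openin X U \<and> y \<in> U" and x: "x \<in> topspace X"
  have ne: "topspace X \<noteq> {}"
    using y by blast
  obtain A :: "(nat \<Rightarrow> real) set" and \<psi> e where A: "metric_flow A \<psi>"
    and e: "homeomorphic_map X (top_of_set A) e"
    and conj: "\<And>x t. x \<in> topspace X \<Longrightarrow> \<phi> t x \<in> topspace X \<and> e (\<phi> t x) = \<psi> t (e x)"
    and "cov_dim_le (top_of_set A) 1"
    by (rule flow_space_model[OF fs ne]) (rule that)
  interpret metric_flow A \<psi>
    by (rule A)
  have e_top: "e ` topspace X = A"
    using homeomorphic_imp_surjective_map[OF e] by simp
  have e_inj: "inj_on e (topspace X)"
    using e homeomorphic_eq_everything_map by blast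
  have e_cont: "continuous_map X (top_of_set A) e"
    by (rule homeomorphic_imp_continuous_map[OF e])
  have U_sub: "U \<subseteq> topspace X"
    using U openin_subset by blast
  have "\<exists>t>0. \<psi> t (e x) \<in> e ` U"
  proof (rule two_sided_imp_forward_dense)
    show "openin (top_of_set A) (e ` U)"
      using homeomorphic_imp_open_map[OF e] U unfolding open_map_def by blast
    show "e ` U \<noteq> {}" "e x \<in> A"
      using U x e_top by blast+
    show "\<exists>t. \<psi> t z \<in> V" if V: "openin (top_of_set A) V" "V \<noteq> {}" and z: "z \<in> A" for V z
    proof -
      obtain w where w: "w \<in> topspace X" "z = e w"
        using z e_top by blast
      obtain v where v: "v \<in> topspace X" "e v \<in> V"
        using V openin_imp_subset[OF V(1)] e_top by blast
      let ?V = "{x\<in>topspace X. e x \<in> V}"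
      have "openin X ?V"
        using e_cont V(1) unfolding continuous_map_def by blast
      moreover have "v \<in> X closure_of (orbit \<phi> w)"
        using min w(1) v(1) unfolding minimal_flow_def by simp
      then have "v \<in> ?V \<and> openin X ?V \<longrightarrow> (\<exists>u. u \<in> orbit \<phi> w \<and> u \<in> ?V)"
        unfolding in_closure_of by (elim conjE) (rule spec)
      ultimately have "\<exists>u. u \<in> orbit \<phi> w \<and> u \<in> ?V"
        using v by simp
      then obtain u where "u \<in> orbit \<phi> w" "e u \<in> V"
        by blast
      then show ?thesis
        using conj[OF w(1)] w(2) unfolding orbit_def by auto
    qed
  qed
  then obtain t u where "t > 0" "u \<in> U" "\<psi> t (e x) = e u"
    by blast
  moreover from this have "\<phi> t x = u"
    using conj[OF x, of t] inj_onD[OF e_inj, of "\<phi> t x" u] U_sub by auto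
  ultimately show "\<exists>t>0. \<phi> t x \<in> U"
    by blast
qed

theorem theorem3p5:
  fixes X :: "'a topology" and \<phi> :: "real \<Rightarrow> 'a \<Rightarrow> 'a" and x0 :: 'a
  assumes "flow_space X \<phi>" and "x0 \<in> topspace X"
  shows "(dense_at X \<phi> x0 \<longrightarrow>
            (aperiodic_flow X \<phi> \<longrightarrow>
               (\<exists>k f p. expansion X \<phi> x0 k f p \<and> (\<forall>i. proper_posmap (k (Suc i)) (f i)))) \<and>
            (\<not> aperiodic_flow X \<phi> \<longrightarrow>
               (\<exists>k f p. expansion X \<phi> x0 k f p \<and>
                  (\<forall>n\<ge>1. degenerate_proper (k n) (bond f 0 n))))) \<and>
         (minimal_flow X \<phi> \<longrightarrow> (\<forall>y\<in>topspace X. \<exists>k f p. expansion X \<phi> y k f p))"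
proof (intro conjI impI ballI)
  assume "dense_at X \<phi> x0"
  note ex = dense_at_expansion[OF assms this]
  show "\<exists>k f p. expansion X \<phi> x0 k f p \<and> (\<forall>i. proper_posmap (k (Suc i)) (f i))"
    if "aperiodic_flow X \<phi>"
    using ex that by blast
  show "\<exists>k f p. expansion X \<phi> x0 k f p \<and> (\<forall>n\<ge>1. degenerate_proper (k n) (bond f 0 n))"
    if "\<not> aperiodic_flow X \<phi>"
    using ex that by blast
next
  fix y assume "minimal_flow X \<phi>" "y \<in> topspace X"
  then show "\<exists>k f p. expansion X \<phi> y k f p"
    using dense_at_expansion[OF assms(1)] minimal_imp_dense_at[OF assms(1)] by blast
qed

end
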